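(* Let $f$ be a $C^1$ expanding map on the circle $S^1$. Then any observable measure of $f$, and any convex combination of observable measures of $f$, is an equilibrium state for $\psi=-\log f'$, and its pressure is equal to $0$; i.e. any observable measure $\mu$ of $f$ satisfies the equality $$h_\mu(f)=\int\log f'\,d\mu .$$
   Context: A $C^1$ (order preserving) map $f\colon S^1\to S^1$ is expanding if $f'(x)>1$ for all $x\in S^1$. $m$ is the Lebesgue probability measure on $S^1$. $\mathcal{P}$ is the set of all Borel probability measures on $S^1$ with the weak$^*$ topology, $\mathrm{dist}^*$ is a metric inducing this topology, and $\mathcal{P}_f\subset\mathcal{P}$ is the set of $f$-invariant measures. For $x\in S^1$, $p\omega(x)\subset\mathcal{P}$ is the set of all weak$^*$ limits of convergent subsequences of $\left\{\frac1n\sum_{j=0}^{n-1}\delta_{f^j(x)}\right\}_{n\ge1}$. A measure $\mu\in\mathcal{P}$ is observable for $f$ if for every $\varepsilon>0$ the set $\{x\in S^1:\mathrm{dist}^*(p\omega(x),\mu)<\varepsilon\}$ has positive Lebesgue measure (the distance being the minimum distance from $\mu$ to points of $p\omega(x)$). Observable measures are $f$-invariant. For $\nu\in\mathcal{P}_f$, $h_\nu(f)$ is the (Kolmogorov–Sinai) entropy. For $\varphi\in C^0(S^1,\mathbb{R})$ the pressure is $P_f(\varphi)=\sup_{\nu\in\mathcal{P}_f}\{h_\nu(f)+\int\varphi\,d\nu\}$, and $\mu\in\mathcal{P}_f$ is an equilibrium state for $\varphi$ if $h_\mu(f)+\int\varphi\,d\mu=P_f(\varphi)$. The pressure of a measure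 $\mu\in\mathcal{P}_f$ (for $\psi$) refers to the value $h_\mu(f)+\int\psi\,d\mu$. *)

theory Defs
  imports "HOL-Probability.Probability"
begin

text \<open>
  The circle is the unit circle of the complex plane. A self-map of it is a function
  on the complex numbers preserving the circle, its values elsewhere being irrelevant.
\<close>

abbreviation circle :: "complex set" where
  "circle \<equiv> sphere 0 1"

definition circle_borel :: "complex measure" where
  "circle_borel = restrict_space borel circle"

definition circle_lebesgue :: "complex measure" where
  "circle_lebesgue =
     distr (uniform_measure lborel {0..1}) circle_borel (\<lambda>t. cis (2 * pi * t))"


subsection \<open>Expanding maps\<close>

text \<open>
  The derivative is taken with respect to the angle in source and target. If
  f (x cis t) = cis (F t) for a real function F, then the derivative of
  f (x cis t) at t = 0 is F' 0 * i * f x; the real number F' 0 is f' x.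
  It is the same number when the circle is parametrised by a coordinate modulo 1.
\<close>

definition has_circle_deriv :: "(complex \<Rightarrow> complex) \<Rightarrow> real \<Rightarrow> complex \<Rightarrow> bool" where
  "has_circle_deriv f D x \<longleftrightarrow>
     ((\<lambda>t. f (x * cis t)) has_vector_derivative (of_real D * \<i> * f x)) (at 0)"

definition circle_deriv :: "(complex \<Rightarrow> complex) \<Rightarrow> complex \<Rightarrow> real" where
  "circle_deriv f x = (THE D. has_circle_deriv f D x)"

definition C1_circle_map :: "(complex \<Rightarrow> complex) \<Rightarrow> bool" where
  "C1_circle_map f \<longleftrightarrow>
     f \<in> circle \<rightarrow> circle \<and>
     (\<forall>x\<in>circle. \<exists>D. has_circle_deriv f D x) \<and>
     continuous_on circle (circle_deriv f)"

definition expanding_circle_map :: "(complex \<Rightarrow> complex) \<Rightarrow> bool" where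
  "expanding_circle_map f \<longleftrightarrow> C1_circle_map f \<and> (\<forall>x\<in>circle. circle_deriv f x > 1)"


subsection \<open>Borel probability measures on the circle\<close>

definition circle_measures :: "complex measure set" where
  "circle_measures = {\<mu>. sets \<mu> = sets circle_borel \<and> prob_space \<mu>}"

text \<open>
  The coarsest topology on the set of probability measures making integration of
  every continuous real function on the circle continuous.
\<close>

definition weak_star_topology :: "complex measure topology" where
  "weak_star_topology = topology_generated_by
     {{\<mu> \<in> circle_measures. (\<integral>x. \<phi> x \<partial>\<mu>) \<in> U} | (\<phi> :: complex \<Rightarrow> real) U.
        continuous_on circle \<phi> \<and> open U}"

definition weak_star_metric :: "(complex measure \<Rightarrow> complex measure \<Rightarrow> real) \<Rightarrow> bool" where
  "weak_star_metric d \<longleftrightarrow>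
     Metric_space circle_measures d \<and>
     Metric_space.mtopology circle_measures d = weak_star_topology"

definition invariant_measures :: "(complex \<Rightarrow> complex) \<Rightarrow> complex measure set" where
  "invariant_measures f = {\<mu> \<in> circle_measures. distr \<mu> circle_borel f = \<mu>}"

definition convex_combination_of :: "complex measure set \<Rightarrow> complex measure \<Rightarrow> bool" where
  "convex_combination_of \<O> \<mu> \<longleftrightarrow>
     \<mu> \<in> circle_measures \<and>
     (\<exists>(n::nat) (c :: nat \<Rightarrow> real) \<nu>.
        (\<forall>i<n. 0 \<le> c i \<and> \<nu> i \<in> \<O>) \<and> (\<Sum>i<n. c i) = 1 \<and>
        (\<forall>A \<in> sets circle_borel. measure \<mu> A = (\<Sum>i<n. c i * measure (\<nu> i) A)))"


subsection \<open>Observable measures\<close>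

definition empirical_measure :: "(complex \<Rightarrow> complex) \<Rightarrow> nat \<Rightarrow> complex \<Rightarrow> complex measure" where
  "empirical_measure f n x = measure_of (space circle_borel) (sets circle_borel)
     (\<lambda>A. (\<Sum>j<n. emeasure (return circle_borel ((f ^^ j) x)) A) / of_nat n)"

text \<open>The index is shifted by one because the empirical measures start at length 1.\<close>

definition p_omega :: "(complex \<Rightarrow> complex) \<Rightarrow> complex \<Rightarrow> complex measure set" where
  "p_omega f x = {\<mu>. \<exists>r :: nat \<Rightarrow> nat. strict_mono r \<and>
     limitin weak_star_topology (\<lambda>k. empirical_measure f (Suc (r k)) x) \<mu> sequentially}"

definition observable ::
  "(complex measure \<Rightarrow> complex measure \<Rightarrow> real) \<Rightarrow> (complex \<Rightarrow> complex) \<Rightarrow> complex measure \<Rightarrow> bool"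
where
  "observable d f \<mu> \<longleftrightarrow>
     \<mu> \<in> circle_measures \<and>
     (\<forall>\<epsilon>>0. emeasure circle_lebesgue {x \<in> circle. (INF \<nu>\<in>p_omega f x. d \<nu> \<mu>) < \<epsilon>} > 0)"


subsection \<open>Entropy, pressure and equilibrium states\<close>

definition finite_meas_partition :: "'a measure \<Rightarrow> 'a set set \<Rightarrow> bool" where
  "finite_meas_partition M \<alpha> \<longleftrightarrow> finite \<alpha> \<and> \<alpha> \<subseteq> sets M \<and> partition_on (space M) \<alpha>"

definition partition_entropy :: "'a measure \<Rightarrow> 'a set set \<Rightarrow> real" where
  "partition_entropy M \<alpha> = - (\<Sum>A\<in>\<alpha>. measure M A * ln (measure M A))"

definition preimage_partition :: "'a measure \<Rightarrow> ('a \<Rightarrow> 'a) \<Rightarrow> 'a set set \<Rightarrow> 'a set set" where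
  "preimage_partition M g \<alpha> = (\<lambda>A. g -` A \<inter> space M) ` \<alpha> - {{}}"

definition iterated_partition :: "'a measure \<Rightarrow> ('a \<Rightarrow> 'a) \<Rightarrow> 'a set set \<Rightarrow> nat \<Rightarrow> 'a set set" where
  "iterated_partition M f \<alpha> n =
     common_refinement ((\<lambda>j. preimage_partition M (f ^^ j) \<alpha>) ` {..<n})"

definition entropy_wrt :: "'a measure \<Rightarrow> ('a \<Rightarrow> 'a) \<Rightarrow> 'a set set \<Rightarrow> real" where
  "entropy_wrt M f \<alpha> = lim (\<lambda>n. partition_entropy M (iterated_partition M f \<alpha> n) / real n)"

definition KS_entropy :: "'a measure \<Rightarrow> ('a \<Rightarrow> 'a) \<Rightarrow> ereal" where
  "KS_entropy M f = (SUP \<alpha>\<in>{\<alpha>. finite_meas_partition M \<alpha>}. ereal (entropy_wrt M f \<alpha>))"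

definition measure_pressure ::
  "(complex \<Rightarrow> complex) \<Rightarrow> (complex \<Rightarrow> real) \<Rightarrow> complex measure \<Rightarrow> ereal" where
  "measure_pressure f \<phi> \<mu> = KS_entropy \<mu> f + ereal (\<integral>x. \<phi> x \<partial>\<mu>)"

definition pressure :: "(complex \<Rightarrow> complex) \<Rightarrow> (complex \<Rightarrow> real) \<Rightarrow> ereal" where
  "pressure f \<phi> = (SUP \<nu>\<in>invariant_measures f. measure_pressure f \<phi> \<nu>)"

definition equilibrium_state ::
  "(complex \<Rightarrow> complex) \<Rightarrow> (complex \<Rightarrow> real) \<Rightarrow> complex measure \<Rightarrow> bool" where
  "equilibrium_state f \<phi> \<mu> \<longleftrightarrow>
     \<mu> \<in> invariant_measures f \<and> measure_pressure f \<phi> \<mu> = pressure f \<phi>"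

end

theory Submission imports Defs begin

text \<open>
  Write $h_\mu$ for the entropy and $\lambda(\mu) = \int \log f' \, d\mu$ for the exponent of a measure.
  The theorem says that $h_\nu \<le> \lambda(\nu)$ for every invariant $\nu$, with equality for observable
  measures and their convex combinations. Both halves compare how fast cells shrink in Lebesgue
  measure, which $\log f'$ controls, with how many cells a measure charges, which the entropy
  controls. As $f$ is only $C^1$ there is no bounded distortion; uniform continuity of $\log f'$
  gives an error of $\epsilon$ per iterate, and that is enough.

  A partition is handled as a labelling of the points, its refinement under $f$ as the itinerary of
  labels along an orbit, and entropies are estimated by Gibbs' inequality
  (\<open>gibbs_inequality\<close>): a random word has entropy at most the mean of $-\log q$, for every
  subprobability weight $q$ on words. Each estimate is a choice of $q$.

  Upper bound (\<open>KS_entropy_le_exponent\<close>). Cutting the circle at the preimages under $f^n$ of a fixed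
  point gives arcs that $f^n$ maps onto the circle, so by the mean value theorem such an arc has
  length about $1 / (f^n)'$ (\<open>markov_cell_volume\<close>). Given a labelling $a$, take for $q$ the length
  of the arc times a product of conditional probabilities of $a$ given the arc of a fixed level $N$.
  The length contributes $\lambda(\nu)$ per iterate. Each conditional factor contributes the
  conditional entropy of $a$ given the arcs of level $N$, which tends to $0$ as $N$ grows because every
  Borel set is nearly a union of short arcs (\<open>markov_conditional_entropy\<close>).

  Lower bound (\<open>observable_arc_entropy\<close>). Cut the circle into short equal arcs whose endpoints carry no
  mass for $\mu$. Suppose that the entropy of one label given the $k$ labels after it is smaller than
  $\lambda(\mu) - \epsilon$. Let $q$ be the law of the order $k$ Markov chain with the transition
  probabilities of $\mu$. For points whose empirical measures are near $\mu$, $-\log q$ of the itinerary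
  grows at most at that smaller rate, while the cell has Lebesgue measure at most
  $\exp(-n(\lambda(\mu) - \epsilon))$. The weights $q$ add up to at most $1$, so the set of such
  points is exponentially small in $n$ (\<open>typical_set_volume_le\<close>). By Borel--Cantelli almost no point
  visits a neighbourhood of $\mu$ infinitely often, contrary to observability. Hence each conditional
  entropy is at least $\lambda(\mu) - \epsilon$, and their sum bounds the entropy of the itinerary.

  Convex combinations reduce to their components because entropy is concave, the exponent is affine,
  and one system of arcs serves all components.
\<close>

section \<open>Entropy of finite labellings\<close>

definition label_prob :: "'a measure \<Rightarrow> ('a \<Rightarrow> 'b) \<Rightarrow> 'b \<Rightarrow> real" where
  "label_prob M X v = measure M (X -` {v} \<inter> space M)"

definition label_entropy :: "'a measure \<Rightarrow> ('a \<Rightarrow> 'b) \<Rightarrow> real" where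
  "label_entropy M X = - (\<Sum>v\<in>X ` space M. label_prob M X v * ln (label_prob M X v))"

text \<open>
  Words turn the join of partitions into concatenation; \<open>iterated_partition_fibres\<close> translates back.
\<close>

definition itinerary :: "('a \<Rightarrow> 'b) \<Rightarrow> ('a \<Rightarrow> 'a) \<Rightarrow> nat \<Rightarrow> 'a \<Rightarrow> 'b list" where
  "itinerary a f n x = map (\<lambda>j. a ((f ^^ j) x)) [0..<n]"

lemma label_prob_nonneg [simp]: "label_prob M X v \<ge> 0"
  by (simp add: label_prob_def)

lemma itinerary_0 [simp]: "itinerary a f 0 x = []"
  by (simp add: itinerary_def)

lemma itinerary_Suc: "itinerary a f (Suc n) x = a x # itinerary a f n (f x)"
  unfolding itinerary_def map_upt_Suc by (simp add: funpow_swap1)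

lemma length_itinerary [simp]: "length (itinerary a f n x) = n"
  by (simp add: itinerary_def)

lemma itinerary_nth: "j < n \<Longrightarrow> itinerary a f n x ! j = a ((f ^^ j) x)"
  by (simp add: itinerary_def)

lemma itinerary_eq_iff: "itinerary a f n x = itinerary a f n y \<longleftrightarrow> (\<forall>j<n. a ((f ^^ j) x) = a ((f ^^ j) y))"
  by (auto simp: itinerary_def list_eq_iff_nth_eq)

lemma take_itinerary: "take k (itinerary a f n x) = itinerary a f (min k n) x"
  by (simp add: itinerary_def take_map min_def)

lemma drop_itinerary: "drop m (itinerary a f (m + n) x) = itinerary a f n ((f ^^ m) x)"
proof (rule nth_equalityI)
  fix i assume "i < length (drop m (itinerary a f (m + n) x))"
  then have "i < n" by simp
  then show "drop m (itinerary a f (m + n) x) ! i = itinerary a f n ((f ^^ m) x) ! i"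
    by (simp add: itinerary_nth funpow_add add.commute[of m])
qed simp

lemma funpow_measurable:
  assumes "f \<in> measurable M M"
  shows "f ^^ n \<in> measurable M M"
  using assms by (induction n) (auto simp: id_def comp_def)

lemma simple_function_itinerary:
  assumes "simple_function M a" "f \<in> measurable M M"
  shows "simple_function M (itinerary a f n)"
proof (induction n)
  case 0
  then show ?case by (simp add: simple_function_def)
next
  case (Suc n)
  have "simple_function M (\<lambda>x. (a x, itinerary a f n (f x)))"
    by (intro simple_function_Pair assms simple_function_comp[OF assms(2) Suc])
  from simple_function_compose1[OF this, of "\<lambda>(u,v). u # v"]
  show ?case by (simp add: itinerary_Suc[abs_def])
qed

context prob_space begin

lemma
  fixes g :: "'b \<Rightarrow> real"
  assumes X: "simple_function M X"
  shows integrable_label: "integrable M (\<lambda>\<omega>. g (X \<omega>))"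
    and integral_label: "(\<integral>\<omega>. g (X \<omega>) \<partial>M) = (\<Sum>v\<in>X ` space M. g v * label_prob M X v)"
proof -
  have fin: "finite (X ` space M)" and [measurable]: "\<And>v. v \<in> X ` space M \<Longrightarrow> X -` {v} \<inter> space M \<in> sets M"
    using X by (auto simp: simple_function_def)
  have eq: "g (X \<omega>) = (\<Sum>v\<in>X ` space M. g v * indicator (X -` {v} \<inter> space M) \<omega>)" if "\<omega> \<in> space M" for \<omega>
  proof -
    have "(\<Sum>v\<in>X ` space M. g v * indicator (X -` {v} \<inter> space M) \<omega>)
        = (\<Sum>v\<in>X ` space M. if v = X \<omega> then g v else 0)"
      by (rule sum.cong) (use that in \<open>auto simp: indicator_def\<close>)
    also have "\<dots> = g (X \<omega>)" using fin that by (subst sum.delta) auto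
    finally show ?thesis by simp
  qed
  have "integrable M (\<lambda>\<omega>. \<Sum>v\<in>X ` space M. g v * indicator (X -` {v} \<inter> space M) \<omega>)"
    by (intro Bochner_Integration.integrable_sum integrable_mult_right integrable_real_indicator) (auto simp: emeasure_eq_measure)
  then show "integrable M (\<lambda>\<omega>. g (X \<omega>))"
    by (subst Bochner_Integration.integrable_cong[OF refl eq]) auto
  have "(\<integral>\<omega>. g (X \<omega>) \<partial>M) = (\<integral>\<omega>. (\<Sum>v\<in>X ` space M. g v * indicator (X -` {v} \<inter> space M) \<omega>) \<partial>M)"
    by (intro Bochner_Integration.integral_cong eq refl)
  also have "\<dots> = (\<Sum>v\<in>X ` space M. \<integral>\<omega>. g v * indicator (X -` {v} \<inter> space M) \<omega> \<partial>M)"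
    by (intro Bochner_Integration.integral_sum integrable_mult_right integrable_real_indicator) (auto simp: emeasure_eq_measure)
  also have "\<dots> = (\<Sum>v\<in>X ` space M. g v * label_prob M X v)"
    by (intro sum.cong) (auto simp: label_prob_def)
  finally show "(\<integral>\<omega>. g (X \<omega>) \<partial>M) = (\<Sum>v\<in>X ` space M. g v * label_prob M X v)" .
qed

lemma sum_label_prob:
  assumes "simple_function M X"
  shows "(\<Sum>v\<in>X ` space M. label_prob M X v) = 1"
  using integral_label[OF assms, of "\<lambda>_. 1"] by (simp add: prob_space)

lemma label_entropy_eq_integral:
  assumes "simple_function M X"
  shows "label_entropy M X = (\<integral>\<omega>. - ln (label_prob M X (X \<omega>)) \<partial>M)"
  by (subst integral_label[OF assms, of "\<lambda>v. - ln (label_prob M X v)"])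
     (simp add: label_entropy_def sum_negf mult.commute)

lemma AE_label_prob_pos:
  assumes X: "simple_function M X"
  shows "AE \<omega> in M. label_prob M X (X \<omega>) > 0"
proof -
  let ?N = "\<Union>v\<in>{v \<in> X ` space M. label_prob M X v = 0}. X -` {v} \<inter> space M"
  have "?N \<in> null_sets M"
  proof (rule null_sets_UN')
    show "countable {v \<in> X ` space M. label_prob M X v = 0}"
      using X by (auto simp: simple_function_def intro: countable_finite)
  next
    fix v assume "v \<in> {v \<in> X ` space M. label_prob M X v = 0}"
    then show "X -` {v} \<inter> space M \<in> null_sets M"
      using X by (intro null_setsI) (auto simp: simple_function_def label_prob_def emeasure_eq_measure)
  qed
  then show ?thesis
  proof (rule AE_I', intro subsetI)
    fix \<omega> assume "\<omega> \<in> {\<omega> \<in> space M. \<not> 0 < label_prob M X (X \<omega>)}"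
    then have "\<omega> \<in> space M" "label_prob M X (X \<omega>) = 0"
      using label_prob_nonneg[of M X "X \<omega>"] by (auto simp del: label_prob_nonneg)
    then show "\<omega> \<in> ?N" by auto
  qed
qed

lemma label_prob_le_image:
  assumes W: "simple_function M W"
  shows "label_prob M W w \<le> label_prob M (\<lambda>\<omega>. h (W \<omega>)) (h w)"
  unfolding label_prob_def
  by (rule finite_measure_mono)
     (auto intro: simple_functionD(2)[OF simple_function_compose1[OF W]])

text \<open>
  By $\ln t \<le> t - 1$. A function $h$ of $W$ may be taken on the left, since a value of $W$ is at most as
  probable as its image: so a weight on a finer object bounds the entropy of a coarser one.
\<close>

lemma gibbs_inequality:
  assumes W: "simple_function M W"
    and q0: "\<And>w. w \<in> W ` space M \<Longrightarrow> q w \<ge> 0"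
    and q1: "(\<Sum>w\<in>W ` space M. q w) \<le> 1"
    and qpos: "\<And>w. w \<in> W ` space M \<Longrightarrow> label_prob M W w > 0 \<Longrightarrow> q w > 0"
  shows "label_entropy M (\<lambda>\<omega>. h (W \<omega>)) \<le> (\<integral>\<omega>. - ln (q (W \<omega>)) \<partial>M)"
proof -
  let ?X = "\<lambda>\<omega>. h (W \<omega>)"
  let ?p = "label_prob M W" and ?P = "label_prob M ?X"
  have X: "simple_function M ?X" by (rule simple_function_compose1[OF W])
  have "label_entropy M ?X = (\<integral>\<omega>. - ln (?P (h (W \<omega>))) \<partial>M)"
    by (rule label_entropy_eq_integral[OF X])
  also have "\<dots> = (\<Sum>w\<in>W ` space M. - ln (?P (h w)) * ?p w)"
    by (rule integral_label[OF W])
  finally have 1: "label_entropy M ?X = (\<Sum>w\<in>W ` space M. - ln (?P (h w)) * ?p w)" .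
  have 2: "(\<integral>\<omega>. - ln (q (W \<omega>)) \<partial>M) = (\<Sum>w\<in>W ` space M. - ln (q w) * ?p w)"
    by (rule integral_label[OF W])
  have "- ln (?P (h w)) * ?p w - (- ln (q w) * ?p w) \<le> q w - ?p w" if w: "w \<in> W ` space M" for w
  proof (cases "?p w > 0")
    case False
    then have "?p w = 0" using label_prob_nonneg[of M W w] by linarith
    then show ?thesis using q0[OF w] by simp
  next
    case True
    have qp: "q w > 0" by (rule qpos[OF w True])
    have le: "?p w \<le> ?P (h w)" by (rule label_prob_le_image[OF W])
    then have P: "?P (h w) > 0" using True by linarith
    have "- ln (?P (h w)) * ?p w - (- ln (q w) * ?p w) = ?p w * ln (q w / ?P (h w))"
      using qp P by (simp add: ln_div algebra_simps)
    also have "\<dots> \<le> ?p w * (q w / ?P (h w) - 1)"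
      using True qp P by (intro mult_left_mono ln_le_minus_one) auto
    also have "\<dots> = ?p w / ?P (h w) * q w - ?p w" by (simp add: algebra_simps)
    also have "\<dots> \<le> 1 * q w - ?p w"
      using le P qp by (intro diff_mono mult_right_mono) auto
    finally show ?thesis by simp
  qed
  then have "(\<Sum>w\<in>W ` space M. - ln (?P (h w)) * ?p w - (- ln (q w) * ?p w)) \<le> (\<Sum>w\<in>W ` space M. q w - ?p w)"
    by (rule sum_mono)
  then have "label_entropy M ?X - (\<integral>\<omega>. - ln (q (W \<omega>)) \<partial>M) \<le> (\<Sum>w\<in>W ` space M. q w) - 1"
    unfolding 1 2 sum_subtractf sum_label_prob[OF W] .
  with q1 show ?thesis by linarith
qed

end

lemma label_prob_invariant:
  assumes "T \<in> measurable M M" "distr M M T = M" "simple_function M X"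
  shows "label_prob M (\<lambda>x. X (T x)) v = label_prob M X v"
proof -
  have s: "X -` {v} \<inter> space M \<in> sets M" by (rule simple_functionD(2)[OF assms(3)])
  have "measure M (X -` {v} \<inter> space M) = measure (distr M M T) (X -` {v} \<inter> space M)" using assms by simp
  also have "\<dots> = measure M (T -` (X -` {v} \<inter> space M) \<inter> space M)"
    by (rule measure_distr[OF assms(1) s])
  also have "T -` (X -` {v} \<inter> space M) \<inter> space M = (\<lambda>x. X (T x)) -` {v} \<inter> space M"
    using measurable_space[OF assms(1)] by auto
  finally show ?thesis by (simp add: label_prob_def)
qed

lemma distr_funpow:
  assumes "f \<in> measurable M M" "distr M M f = M"
  shows "distr M M (f ^^ n) = M"
proof (induction n)
  case 0
  then show ?case by (simp add: id_def distr_id)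
next
  case (Suc n)
  have "distr M M (f ^^ Suc n) = distr (distr M M (f ^^ n)) M f"
    using assms funpow_measurable[OF assms(1), of n] by (subst distr_distr) auto
  then show ?case using Suc assms by (simp only: )
qed

lemma sum_take_drop_le:
  fixes p r :: "'b list \<Rightarrow> real"
  assumes "finite S" "\<And>v. v \<in> S \<Longrightarrow> take m v \<in> A \<and> drop m v \<in> B" "finite A" "finite B"
    and "\<And>v. p v \<ge> 0" "\<And>v. r v \<ge> 0"
  shows "(\<Sum>v\<in>S. p (take m v) * r (drop m v)) \<le> (\<Sum>v\<in>A. p v) * (\<Sum>v\<in>B. r v)"
proof -
  have inj: "inj_on (\<lambda>v. (take m v, drop m v)) S"
    by (rule inj_onI) (metis append_take_drop_id prod.inject)
  have "(\<Sum>v\<in>S. p (take m v) * r (drop m v)) = (\<Sum>(v,w)\<in>(\<lambda>v. (take m v, drop m v)) ` S. p v * r w)"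
    by (subst sum.reindex[OF inj]) simp
  also have "\<dots> \<le> (\<Sum>(v,w)\<in>A \<times> B. p v * r w)"
    using assms by (intro sum_mono2) auto
  also have "\<dots> = (\<Sum>v\<in>A. p v) * (\<Sum>v\<in>B. r v)"
    by (simp add: sum_product sum.cartesian_product)
  finally show ?thesis .
qed

text \<open>
  Gibbs' inequality for the product of the laws of the first $m$ and of the last $n$ letters; by
  invariance the last $n$ letters are distributed like an itinerary started at time $0$.
\<close>

lemma label_entropy_itinerary_subadditive:
  assumes "prob_space M" and f: "f \<in> measurable M M" "distr M M f = M" and a: "simple_function M a"
  shows "label_entropy M (itinerary a f (m + n))
       \<le> label_entropy M (itinerary a f m) + label_entropy M (itinerary a f n)"
proof -
  interpret prob_space M by fact
  let ?W = "itinerary a f (m + n)" and ?U = "itinerary a f m" and ?V = "itinerary a f n"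
  have W: "simple_function M ?W" and U: "simple_function M ?U" and V: "simple_function M ?V"
    by (auto intro: simple_function_itinerary a f)
  have fm: "f ^^ m \<in> measurable M M" by (rule funpow_measurable[OF f(1)])
  let ?V' = "\<lambda>x. ?V ((f ^^ m) x)"
  have V': "simple_function M ?V'" by (rule simple_function_comp[OF fm V])
  have inv: "label_prob M ?V' v = label_prob M ?V v" for v
    by (rule label_prob_invariant[OF fm distr_funpow[OF f] V])
  have td: "take m (?W x) = ?U x" "drop m (?W x) = ?V' x" for x
    by (auto simp: take_itinerary drop_itinerary)
  let ?q = "\<lambda>w. label_prob M ?U (take m w) * label_prob M ?V (drop m w)"
  have "label_entropy M ?W \<le> (\<integral>x. - ln (?q (?W x)) \<partial>M)"
  proof (rule gibbs_inequality[OF W, where h="\<lambda>x. x"])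
    have "(\<Sum>w\<in>?W ` space M. ?q w) \<le> (\<Sum>v\<in>?U ` space M. label_prob M ?U v) * (\<Sum>v\<in>?V ` space M. label_prob M ?V v)"
      using U V W measurable_space[OF fm]
      by (intro sum_take_drop_le) (auto simp: simple_function_def td)
    then show "(\<Sum>w\<in>?W ` space M. ?q w) \<le> 1"
      by (simp add: sum_label_prob U V)
  next
    fix w assume "label_prob M ?W w > 0"
    then have "label_prob M (\<lambda>x. take m (?W x)) (take m w) > 0" "label_prob M (\<lambda>x. drop m (?W x)) (drop m w) > 0"
      using label_prob_le_image[OF W, of w "take m"] label_prob_le_image[OF W, of w "drop m"] by linarith+
    then show "?q w > 0" by (simp add: td inv)
  qed simp
  also have "\<dots> = (\<integral>x. - ln (label_prob M ?U (?U x)) + - ln (label_prob M ?V (?V' x)) \<partial>M)"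
  proof (rule integral_cong_AE)
    show "AE x in M. - ln (?q (?W x)) = - ln (label_prob M ?U (?U x)) + - ln (label_prob M ?V (?V' x))"
      using AE_label_prob_pos[OF U] AE_label_prob_pos[OF V'] unfolding inv
    proof eventually_elim
      case (elim x)
      then show ?case by (simp add: td ln_mult)
    qed
    show "(\<lambda>x. - ln (?q (?W x))) \<in> borel_measurable M"
      using integrable_label[OF W, of "\<lambda>w. - ln (?q w)"] by simp
    show "(\<lambda>x. - ln (label_prob M ?U (?U x)) + - ln (label_prob M ?V (?V' x))) \<in> borel_measurable M"
      using integrable_label[OF U, of "\<lambda>w. - ln (label_prob M ?U w)"] integrable_label[OF V', of "\<lambda>w. - ln (label_prob M ?V w)"]
      by simp
  qed
  also have "\<dots> = (\<integral>x. - ln (label_prob M ?U (?U x)) \<partial>M) + (\<integral>x. - ln (label_prob M ?V (?V' x)) \<partial>M)"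
    by (rule Bochner_Integration.integral_add[OF integrable_label[OF U, of "\<lambda>w. - ln (label_prob M ?U w)"] integrable_label[OF V', of "\<lambda>w. - ln (label_prob M ?V w)"]])
  also have "(\<integral>x. - ln (label_prob M ?V (?V' x)) \<partial>M) = (\<integral>x. - ln (label_prob M ?V (?V x)) \<partial>distr M M (f ^^ m))"
    using integrable_label[OF V, of "\<lambda>w. - ln (label_prob M ?V w)"]
    by (subst integral_distr[OF fm]) auto
  finally show ?thesis
    by (simp add: label_entropy_eq_integral U V distr_funpow[OF f])
qed

text \<open>
  Writing $n = kq + r$ with $r < q$ gives $h_n \<le> k h_q + h_r$, where $h_r$ is bounded. The lemma is needed
  because the entropy with respect to a partition is a bare limit.
\<close>

lemma fekete_subadditive:
  fixes h :: "nat \<Rightarrow> real"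
  assumes sub: "\<And>m n. h (m + n) \<le> h m + h n" and nonneg: "\<And>n. h n \<ge> 0"
  shows "(\<lambda>n. h n / real n) \<longlonglongrightarrow> (INF n\<in>{1..}. h n / real n)"
proof -
  let ?L = "INF n\<in>{1..}. h n / real n"
  have bdd: "bdd_below ((\<lambda>n. h n / real n) ` {1..})"
    by (rule bdd_belowI[of _ 0]) (auto simp: nonneg)
  have lower: "?L \<le> h n / real n" if "n \<ge> 1" for n
    by (rule cINF_lower[OF bdd]) (use that in auto)
  have mult: "h (k * q + r) \<le> real k * h q + h r" for k q r
  proof (induction k)
    case (Suc k)
    have "h (Suc k * q + r) \<le> h q + h (k * q + r)"
      using sub[of q "k * q + r"] by (simp add: algebra_simps)
    then show ?case using Suc by (simp add: algebra_simps)
  qed simp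
  show ?thesis
  proof (rule LIMSEQ_I)
    fix e :: real assume e: "e > 0"
    have "\<exists>q\<in>{1..}. h q / real q < ?L + e / 2"
      using e by (subst cINF_less_iff[OF _ bdd, symmetric]) auto
    then obtain q where q: "q \<ge> 1" "h q / real q < ?L + e / 2" by auto
    let ?C = "\<Sum>r<q. h r"
    obtain n0 :: nat where n0: "?C / (e / 2) < real n0" using reals_Archimedean2 by blast
    show "\<exists>no. \<forall>n\<ge>no. norm (h n / real n - ?L) < e"
    proof (intro exI allI impI)
      fix n assume n: "n \<ge> max 1 n0"
      have "h n = h ((n div q) * q + n mod q)" by simp
      also have "\<dots> \<le> real (n div q) * h q + h (n mod q)" by (rule mult)
      also have "\<dots> \<le> (real n / real q) * h q + ?C"
      proof (rule add_mono)
        show "real (n div q) * h q \<le> real n / real q * h q"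
          using nonneg[of q] of_nat_div_le_of_nat[of n q, where 'a=real] by (intro mult_right_mono) auto
        show "h (n mod q) \<le> ?C"
          using q by (intro member_le_sum) (auto simp: nonneg)
      qed
      also have "?C < e / 2 * real n"
      proof -
        have "?C < e / 2 * real n0" using n0 e by (simp add: field_simps)
        also have "\<dots> \<le> e / 2 * real n" using n e by (intro mult_left_mono) auto
        finally show ?thesis .
      qed
      finally have "h n < real n * (h q / real q + e / 2)" by (simp add: algebra_simps)
      then have "h n / real n < h q / real q + e / 2"
        using n by (simp add: field_simps)
      then show "norm (h n / real n - ?L) < e" using q lower[of n] n by auto
    qed
  qed
qed

lemma label_entropy_nonneg:
  assumes "prob_space M"
  shows "label_entropy M X \<ge> 0"
proof -
  interpret prob_space M by fact
  have "label_prob M X v * ln (label_prob M X v) \<le> 0" for v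
  proof (cases "label_prob M X v = 0")
    case False
    then have "label_prob M X v > 0" using label_prob_nonneg[of M X v] by linarith
    moreover have "label_prob M X v \<le> 1" by (simp add: label_prob_def)
    ultimately show ?thesis by (intro mult_nonneg_nonpos) auto
  qed simp
  then show ?thesis unfolding label_entropy_def by (simp add: sum_nonpos)
qed

definition fibres :: "'a measure \<Rightarrow> ('a \<Rightarrow> 'b) \<Rightarrow> 'a set set" where
  "fibres M X = (\<lambda>v. X -` {v} \<inter> space M) ` (X ` space M)"

lemma partition_entropy_fibres:
  "partition_entropy M (fibres M X) = label_entropy M X"
proof -
  have "inj_on (\<lambda>v. X -` {v} \<inter> space M) (X ` space M)"
    by (rule inj_onI) blast
  then show ?thesis
    unfolding partition_entropy_def fibres_def label_entropy_def
    by (subst sum.reindex) (auto simp: label_prob_def)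
qed

lemma finite_meas_partition_fibres:
  assumes "simple_function M X"
  shows "finite_meas_partition M (fibres M X)"
  using assms unfolding finite_meas_partition_def fibres_def partition_on_def disjoint_def simple_function_def
  by auto

text \<open>
  Label each point with the cell that contains it.
\<close>

lemma finite_meas_partition_labels:
  assumes "finite_meas_partition M \<alpha>"
  obtains a :: "'a \<Rightarrow> 'a set" where "simple_function M a" "fibres M a = \<alpha>"
proof -
  let ?a = "\<lambda>x. THE A. A \<in> \<alpha> \<and> x \<in> A"
  have p: "partition_on (space M) \<alpha>" "finite \<alpha>" "\<alpha> \<subseteq> sets M" using assms by (auto simp: finite_meas_partition_def)
  have a: "?a x = A" if "A \<in> \<alpha>" "x \<in> A" for x A
    using that p(1) by (intro the_equality) (auto simp: partition_on_def disjoint_def)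
  have ex: "\<exists>A\<in>\<alpha>. x \<in> A" if "x \<in> space M" for x
    using that p(1) by (auto simp: partition_on_def)
  have vim: "?a -` {A} \<inter> space M = A" if "A \<in> \<alpha>" for A
  proof
    show "?a -` {A} \<inter> space M \<subseteq> A" using a ex by fastforce
    show "A \<subseteq> ?a -` {A} \<inter> space M" using a that p(1) by (auto simp: partition_on_def)
  qed
  have img: "?a ` space M = \<alpha>"
  proof
    show "?a ` space M \<subseteq> \<alpha>" using a ex by fastforce
    show "\<alpha> \<subseteq> ?a ` space M"
    proof
      fix A assume A: "A \<in> \<alpha>"
      then obtain x where "x \<in> A" using p(1) unfolding partition_on_def by (metis ex_in_conv)
      then have "?a x = A" "x \<in> space M" using a A p(1) by (auto simp: partition_on_def)
      then show "A \<in> ?a ` space M" by blast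
    qed
  qed
  show ?thesis
  proof
    show "simple_function M ?a" unfolding simple_function_def img using p vim by auto
    show "fibres M ?a = \<alpha>" unfolding fibres_def img using vim by simp
  qed
qed

text \<open>
  A nonempty intersection of preimages of cells is the set of points with a common itinerary. For
  $n = 0$ the common refinement of no partitions would be the whole type and not the space.
\<close>

lemma iterated_partition_fibres:
  assumes f: "f \<in> space M \<rightarrow> space M" and n: "n \<ge> 1"
  shows "iterated_partition M f (fibres M a) n = fibres M (itinerary a f n)"
proof -
  let ?cell = "\<lambda>j x. {y \<in> space M. a ((f ^^ j) y) = a ((f ^^ j) x)}"
  let ?P = "\<lambda>j. preimage_partition M (f ^^ j) (fibres M a)"
  have fj: "(f ^^ j) x \<in> space M" if "x \<in> space M" for j x
    using that f by (induction j) auto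
  have P: "?P j = ?cell j ` space M" for j
  proof
    show "?P j \<subseteq> ?cell j ` space M"
    proof
      fix A assume "A \<in> ?P j"
      then obtain u where A: "A = (f ^^ j) -` (a -` {u} \<inter> space M) \<inter> space M" "A \<noteq> {}"
        unfolding preimage_partition_def fibres_def by blast
      then obtain x where x: "x \<in> space M" "u = a ((f ^^ j) x)" by auto
      have "A = ?cell j x" using x fj unfolding A(1) by auto
      then show "A \<in> ?cell j ` space M" using x by blast
    qed
    show "?cell j ` space M \<subseteq> ?P j"
    proof
      fix A assume "A \<in> ?cell j ` space M"
      then obtain x where x: "x \<in> space M" "A = ?cell j x" by auto
      have "A = (f ^^ j) -` (a -` {a ((f ^^ j) x)} \<inter> space M) \<inter> space M"
        using x fj by auto
      moreover have "a -` {a ((f ^^ j) x)} \<inter> space M \<in> fibres M a"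
        unfolding fibres_def using x fj by auto
      moreover have "A \<noteq> {}" using x by auto
      ultimately show "A \<in> ?P j" unfolding preimage_partition_def by blast
    qed
  qed
  have cellmem: "B = ?cell j y" if "B \<in> ?P j" "y \<in> B" for B j y
    using that unfolding P by auto
  show ?thesis
  proof
    show "iterated_partition M f (fibres M a) n \<subseteq> fibres M (itinerary a f n)"
    proof
      fix A assume "A \<in> iterated_partition M f (fibres M a) n"
      then obtain F where F: "\<And>j. j < n \<Longrightarrow> F (?P j) \<in> ?P j" and A: "A = (\<Inter>j<n. F (?P j))" and ne: "A \<noteq> {}"
        unfolding iterated_partition_def common_refinement by (auto simp: Pi_iff image_image)
      from ne obtain y where y: "y \<in> A" by auto
      have c: "F (?P j) = ?cell j y" if "j < n" for j
        using cellmem[OF F[OF that]] y that A by auto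
      have z: "0 \<in> {..<n}" using n by auto
      from this have "y \<in> F (?P 0)" using y unfolding A by blast
      then have yM: "y \<in> space M" using c[of 0] n by (simp only:) auto
      have "A = itinerary a f n -` {itinerary a f n y} \<inter> space M"
        unfolding A using c z by (auto simp: itinerary_eq_iff)
      then show "A \<in> fibres M (itinerary a f n)" unfolding fibres_def using yM by auto
    qed
    show "fibres M (itinerary a f n) \<subseteq> iterated_partition M f (fibres M a) n"
    proof
      fix A assume "A \<in> fibres M (itinerary a f n)"
      then obtain y where y: "y \<in> space M" "A = itinerary a f n -` {itinerary a f n y} \<inter> space M"
        unfolding fibres_def by auto
      let ?F = "\<lambda>P. THE B. B \<in> P \<and> y \<in> B"
      have F: "?F (?P j) = ?cell j y" for j
      proof (rule the_equality)
        show "?cell j y \<in> ?P j \<and> y \<in> ?cell j y" unfolding P using y by auto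
      qed (use cellmem in auto)
      have z: "0 \<in> {..<n}" using n by auto
      have "A = (\<Inter>j<n. ?F (?P j))"
        unfolding F y(2) using z by (auto simp: itinerary_eq_iff)
      moreover have "?F \<in> (\<Pi> P\<in>?P ` {..<n}. P)"
      proof (rule Pi_I)
        fix Q assume "Q \<in> ?P ` {..<n}"
        then obtain j where "Q = ?P j" by auto
        then show "?F Q \<in> Q" using F[of j] P[of j] y by auto
      qed
      moreover have "A \<noteq> {}" using y by auto
      ultimately show "A \<in> iterated_partition M f (fibres M a) n"
        unfolding iterated_partition_def common_refinement by (auto simp: image_image)
    qed
  qed
qed

text \<open>
  By Fekete's lemma the limit exists and is the infimum over $n$, so one $n$ bounds it from above and a
  bound for all $n$ bounds it from below.
\<close>

lemma
  assumes "prob_space M" and f: "f \<in> measurable M M" "distr M M f = M" and a: "simple_function M a"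
  shows entropy_wrt_le: "n \<ge> 1 \<Longrightarrow> entropy_wrt M f (fibres M a) \<le> label_entropy M (itinerary a f n) / real n"
    and entropy_wrt_ge: "(\<And>n. n \<ge> 1 \<Longrightarrow> c * real n \<le> label_entropy M (itinerary a f n)) \<Longrightarrow> c \<le> entropy_wrt M f (fibres M a)"
proof -
  let ?h = "\<lambda>n. label_entropy M (itinerary a f n)"
  have L: "(\<lambda>n. ?h n / real n) \<longlonglongrightarrow> (INF n\<in>{1..}. ?h n / real n)"
    by (rule fekete_subadditive) (auto intro: label_entropy_nonneg label_entropy_itinerary_subadditive assms)
  have eq: "partition_entropy M (iterated_partition M f (fibres M a) n) / real n = ?h n / real n" if "n \<ge> 1" for n
    using that iterated_partition_fibres[of f M n a] measurable_space[OF f(1)]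
    by (simp add: partition_entropy_fibres Pi_iff)
  have "(\<lambda>n. partition_entropy M (iterated_partition M f (fibres M a) n) / real n) \<longlonglongrightarrow> (INF n\<in>{1..}. ?h n / real n)"
    using L by (rule Lim_transform_eventually) (unfold eventually_sequentially, metis eq)
  then have E: "entropy_wrt M f (fibres M a) = (INF n\<in>{1..}. ?h n / real n)"
    unfolding entropy_wrt_def by (rule limI)
  have bdd: "bdd_below ((\<lambda>n. ?h n / real n) ` {1..})"
    by (rule bdd_belowI[of _ 0]) (auto simp: label_entropy_nonneg assms)
  show "n \<ge> 1 \<Longrightarrow> entropy_wrt M f (fibres M a) \<le> ?h n / real n"
    unfolding E by (rule cINF_lower[OF bdd]) auto
  show "(\<And>n. n \<ge> 1 \<Longrightarrow> c * real n \<le> ?h n) \<Longrightarrow> c \<le> entropy_wrt M f (fibres M a)"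
    unfolding E by (rule cINF_greatest) (auto simp: field_simps)
qed

section \<open>The circle, its Lebesgue measure and lifts\<close>

text \<open>
  The circle with a coordinate of period $1$, which makes lifts commute with integer translations up
  to the degree.
\<close>

definition turn :: "real \<Rightarrow> complex" where "turn t = cis (2 * pi * t)"

lemma turn_circle [simp]: "turn t \<in> circle" unfolding turn_def mem_sphere_0 by (rule norm_cis)

lemma norm_turn [simp]: "norm (turn t) = 1" unfolding turn_def by (rule norm_cis)

lemma turn_add: "turn (s + t) = turn s * turn t"
  unfolding turn_def cis_mult by (simp only: distrib_left)

lemma turn_int [simp]: "turn (of_int n) = 1"
  unfolding turn_def by (rule cis_multiple_2pi, rule Ints_of_int)

lemma turn_0 [simp]: "turn 0 = 1" using turn_int[of 0] by (simp only: of_int_0)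

lemma turn_eq_iff: "turn s = turn t \<longleftrightarrow> s - t \<in> \<int>"
proof
  assume "turn s = turn t"
  then have "turn (s - t) * turn t = turn t" using turn_add[of "s - t" t] by simp
  moreover have "turn t \<noteq> 0" by (simp add: turn_def)
  ultimately have "turn (s - t) = 1" by (metis mult_cancel_right1)
  then have "Re (turn (s - t)) = 1" by (simp only: one_complex.simps)
  then have "cos (2 * pi * (s - t)) = 1" by (simp only: turn_def cis.simps)
  then obtain n :: int where "2 * pi * (s - t) = of_int n * 2 * pi"
    unfolding cos_one_2pi_int by blast
  then have "2 * pi * (s - t) = 2 * pi * of_int n" by (simp only: mult.commute mult.left_commute)
  then have "s - t = of_int n" by (metis mult_cancel_left pi_neq_zero mult_eq_0_iff zero_neq_numeral)
  then show "s - t \<in> \<int>" by simp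
next
  assume "s - t \<in> \<int>"
  then obtain n :: int where "s - t = of_int n" by (auto elim: Ints_cases)
  then have "s = t + of_int n" by linarith
  then show "turn s = turn t" by (simp add: turn_add)
qed

lemma turn_plus_int [simp]: "turn (t + of_int n) = turn t" by (simp add: turn_eq_iff)

lemma turn_eq_unique: "turn s = turn t \<Longrightarrow> \<theta> \<le> s \<Longrightarrow> s < \<theta> + 1 \<Longrightarrow> \<theta> \<le> t \<Longrightarrow> t < \<theta> + 1 \<Longrightarrow> s = t"
proof -
  assume a: "turn s = turn t" "\<theta> \<le> s" "s < \<theta> + 1" "\<theta> \<le> t" "t < \<theta> + 1"
  then obtain n :: int where n: "s - t = of_int n" by (auto simp: turn_eq_iff elim: Ints_cases)
  then have "\<bar>real_of_int n\<bar> < 1" using a by linarith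
  then have "n = 0" by linarith
  then show "s = t" using n by simp
qed

lemma turn_measurable [measurable]: "turn \<in> borel_measurable borel"
  unfolding turn_def[abs_def] by (intro borel_measurable_continuous_onI continuous_intros)

lemma continuous_turn: "continuous_on A turn"
  unfolding turn_def[abs_def] by (intro continuous_intros)

text \<open>
  The inverse branch of \<open>turn\<close> with values in $[\theta, \theta + 1)$.
\<close>

definition angle :: "real \<Rightarrow> complex \<Rightarrow> real" where
  "angle \<theta> x = \<theta> + Arg2pi (x * turn (-\<theta>)) / (2 * pi)"

lemma angle_bounds: "\<theta> \<le> angle \<theta> x" "angle \<theta> x < \<theta> + 1"
  using Arg2pi_ge_0[of "x * turn (-\<theta>)"] Arg2pi_lt_2pi[of "x * turn (-\<theta>)"]
  by (auto simp: angle_def field_simps)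

lemma turn_angle: assumes "x \<in> circle" shows "turn (angle \<theta> x) = x"
proof -
  have n: "norm (x * turn (-\<theta>)) = 1" using assms by (simp add: norm_mult turn_def)
  have "cis (Arg2pi (x * turn (-\<theta>))) = x * turn (-\<theta>)"
    using n by (metis complex_norm_eq_1_exp cis_conv_exp)
  then have "turn (Arg2pi (x * turn (-\<theta>)) / (2 * pi)) = x * turn (-\<theta>)"
    by (simp add: turn_def)
  then have "turn (angle \<theta> x) = turn \<theta> * (x * turn (-\<theta>))"
    unfolding angle_def turn_add by simp
  also have "\<dots> = x * turn (\<theta> + -\<theta>)" unfolding turn_add by (simp add: algebra_simps)
  finally show ?thesis by simp
qed

lemma angle_turn: "\<theta> \<le> t \<Longrightarrow> t < \<theta> + 1 \<Longrightarrow> angle \<theta> (turn t) = t"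
  using turn_eq_unique[OF turn_angle[OF turn_circle]] angle_bounds by blast

lemma circleE: assumes "x \<in> circle" obtains t where "\<theta> \<le> t" "t < \<theta> + 1" "x = turn t"
  using turn_angle[OF assms, of \<theta>] angle_bounds[of \<theta> x] by metis

lemma Arg2pi_measurable [measurable]: "Arg2pi \<in> borel_measurable borel"
proof -
  have "(\<lambda>z. indicator (- \<real>\<^sub>\<ge>\<^sub>0) z *\<^sub>R Arg2pi z) \<in> borel_measurable borel"
    by (rule borel_measurable_continuous_on_indicator)
       (auto intro!: continuous_at_imp_continuous_on continuous_at_Arg2pi borel_comp)
  also have "(\<lambda>z. indicator (- \<real>\<^sub>\<ge>\<^sub>0) z *\<^sub>R Arg2pi z) = Arg2pi"
    using Arg2pi_eq_0 by (auto simp: indicator_def fun_eq_iff complex_nonneg_Reals_iff complex_is_Real_iff)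
  finally show ?thesis .
qed

lemma angle_measurable [measurable]: "angle \<theta> \<in> borel_measurable borel"
  unfolding angle_def[abs_def] by measurable

lemma angle_isCont:
  assumes x: "x \<in> circle" "x \<noteq> turn \<theta>"
  shows "isCont (angle \<theta>) x"
proof -
  have "x * turn (-\<theta>) \<notin> \<real>\<^sub>\<ge>\<^sub>0"
  proof
    assume a: "x * turn (-\<theta>) \<in> \<real>\<^sub>\<ge>\<^sub>0"
    then have "Arg2pi (x * turn (-\<theta>)) = 0"
      using Arg2pi_eq_0 by (auto simp: complex_nonneg_Reals_iff complex_is_Real_iff)
    then have "angle \<theta> x = \<theta>" by (simp add: angle_def)
    then show False using turn_angle[OF x(1), of \<theta>] x(2) by simp
  qed
  then have "isCont Arg2pi (x * turn (-\<theta>))" by (rule continuous_at_Arg2pi)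
  moreover have "isCont (\<lambda>x. x * turn (-\<theta>)) x" by (intro continuous_intros)
  ultimately have "isCont (\<lambda>x. Arg2pi (x * turn (-\<theta>))) x" by (rule isCont_o2[rotated])
  then show ?thesis unfolding angle_def[abs_def] by (intro isCont_add isCont_divide continuous_const) auto
qed

lemma space_circle_borel [simp]: "space circle_borel = circle"
  by (simp add: circle_borel_def space_restrict_space)

lemma turn_measurable_circle [measurable]: "turn \<in> measurable borel circle_borel"
  unfolding circle_borel_def by (rule measurable_restrict_space2) auto

lemma circle_measurableI: "g \<in> measurable borel N \<Longrightarrow> g \<in> measurable circle_borel N"
  unfolding circle_borel_def by (rule measurable_restrict_space1)

lemma circle_measurable_continuous:
  "continuous_on circle g \<Longrightarrow> g \<in> borel_measurable circle_borel"
  unfolding circle_borel_def by (rule borel_measurable_continuous_on_restrict)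

subsection \<open>Lebesgue measure\<close>

lemma space_circle_lebesgue [simp]: "space circle_lebesgue = circle"
  by (simp add: circle_lebesgue_def)
lemma sets_circle_lebesgue [simp, measurable_cong]: "sets circle_lebesgue = sets circle_borel"
  by (simp add: circle_lebesgue_def)

lemma prob_space_circle_lebesgue: "prob_space circle_lebesgue"
proof -
  interpret prob_space "uniform_measure lborel {0..1::real}"
    by (rule prob_space_uniform_measure) auto
  have "(\<lambda>t. cis (2 * pi * t)) = turn" by (simp add: turn_def[abs_def])
  then show ?thesis unfolding circle_lebesgue_def
    by (intro prob_space_distr) (simp add: measurable_cong_sets[OF sets_uniform_measure refl])
qed

text \<open>
  Cut $[s, s + 1)$ at an integer and translate the left piece by one period.
\<close>

lemma periodic_emeasure:
  assumes T [measurable]: "T \<in> sets (borel::real measure)" and per: "\<And>t n. t + of_int n \<in> T \<longleftrightarrow> t \<in> T"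
  shows "emeasure lborel ({s..<s+1} \<inter> T) = emeasure lborel ({0..1} \<inter> T)"
proof -
  have per': "of_int k + t \<in> T \<longleftrightarrow> t \<in> T" for k t using per[of t k] by (simp add: add.commute)
  have shift: "emeasure lborel ({a..<b} \<inter> T) = emeasure lborel ({a + of_int k..<b + of_int k} \<inter> T)" for a b k
  proof -
    have "emeasure lborel ({a + of_int k..<b + of_int k} \<inter> T)
        = emeasure (distr lborel borel ((+) (of_int k))) ({a + of_int k..<b + of_int k} \<inter> T)"
      by (simp add: lborel_distr_plus)
    also have "\<dots> = emeasure lborel ((+) (of_int k) -` ({a + of_int k..<b + of_int k} \<inter> T) \<inter> space lborel)"
      by (rule emeasure_distr) auto
    also have "(+) (of_int k) -` ({a + of_int k..<b + of_int k} \<inter> T) \<inter> space lborel = {a..<b} \<inter> T"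
      by (auto simp: per')
    finally show ?thesis by (rule sym)
  qed
  define n where "n = \<lceil>s\<rceil>"
  have n: "s \<le> of_int n" "of_int n < s + 1" unfolding n_def by linarith+
  have "emeasure lborel ({s..<s+1} \<inter> T) = emeasure lborel ({s..<of_int n} \<inter> T \<union> {of_int n..<s+1} \<inter> T)"
    using n by (intro arg_cong[where f="emeasure lborel"]) auto
  also have "\<dots> = emeasure lborel ({s..<of_int n} \<inter> T) + emeasure lborel ({of_int n..<s+1} \<inter> T)"
    by (rule plus_emeasure[symmetric]) auto
  also have "emeasure lborel ({s..<of_int n} \<inter> T) = emeasure lborel ({s+1..<of_int n+1} \<inter> T)"
    using shift[of s "of_int n" 1] by simp
  also have "emeasure lborel ({s+1..<of_int n+1} \<inter> T) + emeasure lborel ({of_int n..<s+1} \<inter> T)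
      = emeasure lborel ({s+1..<of_int n+1} \<inter> T \<union> {of_int n..<s+1} \<inter> T)"
    by (rule plus_emeasure) auto
  also have "{s+1..<of_int n+1} \<inter> T \<union> {of_int n..<s+1} \<inter> T = {of_int n..<of_int n+1} \<inter> T"
    using n by auto
  also have "emeasure lborel ({of_int n..<of_int n+1} \<inter> T) = emeasure lborel ({0..<1} \<inter> T)"
    using shift[of 0 1 n] by (simp add: add.commute)
  also have "\<dots> = emeasure lborel ({0..1} \<inter> T)"
  proof (rule emeasure_eq_AE)
    show "AE x in lborel. (x \<in> {0..<1} \<inter> T) = (x \<in> {0..1} \<inter> T)"
      using AE_lborel_singleton[of "1::real"] by eventually_elim auto
  qed auto
  finally show ?thesis .
qed

text \<open>
  Any interval of length one can serve as fundamental domain, so that an arc never has to be split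
  at a cut point.
\<close>

lemma emeasure_circle_lebesgue:
  assumes B: "B \<in> sets circle_borel"
  shows "emeasure circle_lebesgue B = emeasure lborel ({s..<s+1} \<inter> turn -` B)"
proof -
  have T: "turn -` B \<in> sets borel" using measurable_sets[OF turn_measurable_circle B] by simp
  have "(\<lambda>t. cis (2 * pi * t)) = turn" by (simp add: turn_def[abs_def])
  then have "emeasure circle_lebesgue B = emeasure (uniform_measure lborel {0..1}) (turn -` B \<inter> space (uniform_measure lborel {0..1::real}))"
    unfolding circle_lebesgue_def using B by (simp add: emeasure_distr measurable_cong_sets[OF sets_uniform_measure refl])
  also have "\<dots> = emeasure lborel ({0..1} \<inter> turn -` B)"
    using T by (simp add: emeasure_uniform_measure divide_ennreal_def)
  also have "\<dots> = emeasure lborel ({s..<s+1} \<inter> turn -` B)"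
    by (rule periodic_emeasure[OF T, symmetric]) simp
  finally show ?thesis .
qed

subsection \<open>Lifts to the line\<close>

lemma has_circle_deriv_unique:
  assumes "has_circle_deriv f D x" "has_circle_deriv f E x" "f x \<noteq> 0" shows "D = E"
  using vector_derivative_unique_at[OF assms(1,2)[unfolded has_circle_deriv_def]] assms(3) by simp

lemma circle_deriv_eq:
  assumes "has_circle_deriv f D x" "f x \<noteq> 0" shows "circle_deriv f x = D"
  unfolding circle_deriv_def using assms has_circle_deriv_unique by blast

lemma C1_has_circle_deriv:
  assumes "C1_circle_map f" "x \<in> circle"
  shows "has_circle_deriv f (circle_deriv f x) x"
proof -
  obtain D where D: "has_circle_deriv f D x" using assms unfolding C1_circle_map_def by blast
  have "f x \<in> circle" using assms by (auto simp: C1_circle_map_def)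
  then have "f x \<noteq> 0" by auto
  then show ?thesis using circle_deriv_eq[OF D] D by simp
qed

lemma has_vector_derivative_along_turn:
  assumes "C1_circle_map f"
  shows "((\<lambda>u. f (turn u)) has_vector_derivative (of_real (2 * pi * circle_deriv f (turn t)) * \<i> * f (turn t))) (at t)"
proof -
  let ?D = "circle_deriv f (turn t)"
  have "((\<lambda>s. f (turn t * cis s)) has_vector_derivative (of_real ?D * \<i> * f (turn t))) (at (2 * pi * (t - t)))"
    using C1_has_circle_deriv[OF assms turn_circle] by (simp add: has_circle_deriv_def)
  moreover have "((\<lambda>u. 2 * pi * (u - t)) has_vector_derivative (2 * pi)) (at t)"
    by (auto intro!: derivative_eq_intros simp: has_real_derivative_iff_has_vector_derivative[symmetric])
  ultimately have "((\<lambda>s. f (turn t * cis s)) \<circ> (\<lambda>u. 2 * pi * (u - t)) has_vector_derivative (2 * pi) *\<^sub>R (of_real ?D * \<i> * f (turn t))) (at t)"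
    by (intro vector_diff_chain_at)
  moreover have "(\<lambda>s. f (turn t * cis s)) \<circ> (\<lambda>u. 2 * pi * (u - t)) = (\<lambda>u. f (turn u))"
    by (auto simp: fun_eq_iff turn_def cis_mult algebra_simps)
  ultimately show ?thesis by (simp add: scaleR_conv_of_real mult.assoc)
qed

lemma continuous_on_compose_turn:
  assumes "continuous_on circle g" shows "continuous_on A (\<lambda>t. g (turn t))"
  by (rule continuous_on_compose2[OF assms continuous_turn]) auto

lemma turn_has_vector_derivative:
  assumes "(F has_real_derivative D) (at t)"
  shows "((\<lambda>u. turn (F u)) has_vector_derivative (of_real (2 * pi * D) * \<i> * turn (F t))) (at t)"
proof -
  have "((\<lambda>u. 2 * pi * F u) has_vector_derivative (2 * pi * D)) (at t)"
    using assms by (auto intro!: derivative_eq_intros simp: has_real_derivative_iff_has_vector_derivative[symmetric])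
  moreover have "(cis has_vector_derivative (\<i> * cis (2 * pi * F t))) (at (2 * pi * F t))"
    by (auto simp: cis_conv_exp intro!: derivative_eq_intros simp: has_vector_derivative_def scaleR_conv_of_real fun_eq_iff)
  ultimately have "(cis \<circ> (\<lambda>u. 2 * pi * F u) has_vector_derivative (2 * pi * D) *\<^sub>R (\<i> * cis (2 * pi * F t))) (at t)"
    by (intro vector_diff_chain_at)
  then show ?thesis by (simp add: turn_def[abs_def] comp_def scaleR_conv_of_real mult.assoc)
qed

text \<open>
  Let $F_0$ be an antiderivative of $f'$ along the circle. Then \<open>f (turn t) * turn (- F0 t)\<close> has
  derivative $0$, so it is a constant, which is absorbed by adding a number to $F_0$.
\<close>

lemma lift_exists:
  assumes f: "C1_circle_map f"
  obtains F where "\<And>t. f (turn t) = turn (F t)" "\<And>t. (F has_real_derivative circle_deriv f (turn t)) (at t)"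
proof -
  have cD: "continuous_on circle (circle_deriv f)" using f by (simp add: C1_circle_map_def)
  have "isCont (\<lambda>t. circle_deriv f (turn t)) x" for x
    using continuous_on_compose_turn[OF cD, of UNIV] by (simp add: continuous_on_eq_continuous_at)
  then obtain F0 where F0: "\<And>t. (F0 has_vector_derivative circle_deriv f (turn t)) (at t)"
    using einterval_antiderivative[of "-\<infinity>" "\<infinity>" "\<lambda>t. circle_deriv f (turn t)"] by auto
  then have F0r: "(F0 has_real_derivative circle_deriv f (turn t)) (at t)" for t
    by (simp add: has_real_derivative_iff_has_vector_derivative)
  let ?G = "\<lambda>t. f (turn t) * turn (- F0 t)"
  have "(?G has_vector_derivative 0) (at t)" for t
  proof -
    have m: "((\<lambda>t. - F0 t) has_real_derivative - circle_deriv f (turn t)) (at t)"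
      using F0r by (rule DERIV_minus)
    from has_vector_derivative_mult[OF has_vector_derivative_along_turn[OF f, of t] turn_has_vector_derivative[OF m]]
    show ?thesis by (simp add: algebra_simps)
  qed
  then obtain c where c: "\<And>t. ?G t = c"
    using has_vector_derivative_zero_constant[of UNIV ?G] by auto
  have "c \<in> circle" using c[of 0] f by (force simp: C1_circle_map_def norm_mult turn_def[of "- F0 0"] Pi_iff)
  then obtain \<theta> where \<theta>: "c = turn \<theta>" using circleE[of c 0] by metis
  have "f (turn t) = turn (\<theta> + F0 t)" for t
  proof -
    have "turn (\<theta> + F0 t) = ?G t * turn (F0 t)" by (simp add: turn_add c \<theta>)
    also have "\<dots> = f (turn t) * turn (- F0 t + F0 t)" unfolding turn_add by simp
    finally show ?thesis by simp
  qed
  moreover have "((\<lambda>t. \<theta> + F0 t) has_real_derivative circle_deriv f (turn t)) (at t)" for t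
    using F0r[of t] by (auto intro!: derivative_eq_intros)
  ultimately show ?thesis using that[of "\<lambda>t. \<theta> + F0 t"] by blast
qed

text \<open>
  Differentiability is only given along \<open>turn\<close>. Near $x$ the map $f$ is the composition of its
  values along \<open>turn\<close> with a branch of the angle that is cut opposite to $x$.
\<close>

lemma C1_continuous:
  assumes f: "C1_circle_map f" shows "continuous_on circle f"
  unfolding continuous_on_eq_continuous_within
proof
  fix x assume x: "x \<in> circle"
  obtain s' where "x = turn s'" using circleE[OF x, of 0] by blast
  then obtain s where s: "x = turn (s + 1/2)" using that[of "s' - 1/2"] by simp
  have "x \<noteq> turn s"
  proof
    assume "x = turn s"
    then obtain n :: int where "s + 1/2 - s = of_int n" unfolding s turn_eq_iff by (auto elim: Ints_cases)
    then have "of_int (2 * n) = (1::real)" by simp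
    then have "2 * n = 1" by (metis of_int_eq_1_iff)
    then show False by presburger
  qed
  then have c: "isCont (angle s) x" using x by (rule angle_isCont[rotated])
  have "isCont (\<lambda>u. f (turn u)) (angle s x)"
    using has_vector_derivative_along_turn[OF f] has_vector_derivative_continuous by blast
  then have "isCont (\<lambda>y. f (turn (angle s y))) x"
    by (rule isCont_o2[OF c])
  then have "continuous (at x within circle) (\<lambda>y. f (turn (angle s y)))"
    by (rule continuous_at_imp_continuous_within)
  then show "continuous (at x within circle) f"
    by (rule continuous_transform_within[OF _ zero_less_one]) (use x in \<open>auto simp: turn_angle\<close>)
qed

text \<open>
  Substitution $u = F(t)$ on an arc where the derivative is at least $c$. The bound on $F(s')$ keeps the
  image from covering any point twice.
\<close>

lemma expanding_branch_volume_le: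
  assumes F: "\<And>t. f (turn t) = turn (F t)" "\<And>t. (F has_real_derivative F' t) (at t)" "continuous_on UNIV F'"
    and s: "s \<le> s'" "s' \<le> s + 1" "F s' \<le> F s + 1"
    and c: "c > 0" "\<And>t. t \<in> {s..s'} \<Longrightarrow> c \<le> F' t"
    and S: "S \<in> sets circle_borel" "S \<subseteq> turn ` {s..<s'}" "f ` S \<subseteq> B" and B: "B \<in> sets circle_borel"
  shows "c * measure circle_lebesgue S \<le> measure circle_lebesgue B"
proof -
  interpret m: prob_space circle_lebesgue by (rule prob_space_circle_lebesgue)
  have TB [measurable]: "turn -` B \<in> sets borel" and TS [measurable]: "turn -` S \<in> sets borel"
    using measurable_sets[OF turn_measurable_circle] B S by auto
  have Fm [measurable]: "F \<in> borel_measurable borel"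
    by (intro borel_measurable_continuous_onI continuous_at_imp_continuous_on) (auto intro: DERIV_isCont F)
  have F'm [measurable]: "F' \<in> borel_measurable borel"
    using F(3) by (rule borel_measurable_continuous_onI)
  have "ennreal c * emeasure circle_lebesgue S = ennreal c * (\<integral>\<^sup>+t. indicator ({s..<s+1} \<inter> turn -` S) t \<partial>lborel)"
    unfolding emeasure_circle_lebesgue[OF S(1), of s] by (simp)
  also have "\<dots> = (\<integral>\<^sup>+t. ennreal c * indicator ({s..<s+1} \<inter> turn -` S) t \<partial>lborel)"
    by (rule nn_integral_cmult[symmetric]) auto
  also have "\<dots> \<le> (\<integral>\<^sup>+t. ennreal (indicator (turn -` B) (F t) * F' t * indicator {s..s'} t) \<partial>lborel)"
  proof (rule nn_integral_mono)
    fix t :: real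
    show "ennreal c * indicator ({s..<s+1} \<inter> turn -` S) t \<le> ennreal (indicator (turn -` B) (F t) * F' t * indicator {s..s'} t)"
    proof (cases "t \<in> {s..<s+1} \<inter> turn -` S")
      case True
      then have "turn t \<in> turn ` {s..<s'}" using S(2) by blast
      then obtain t' where t': "s \<le> t'" "t' < s'" "turn t = turn t'" by auto
      then have "t = t'" using turn_eq_unique[of t t' s] True s by auto
      then have t: "t \<in> {s..s'}" using t' by auto
      have "turn (F t) \<in> B" using True S(3) F(1)[of t] by auto
      then show ?thesis using True t c by (auto simp: indicator_def intro!: ennreal_leI)
    qed simp
  qed
  also have "\<dots> = (\<integral>\<^sup>+u. ennreal (indicator (turn -` B) u * indicator {F s..F s'} u) \<partial>lborel)"
    by (rule nn_integral_substitution[symmetric])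
       (use F s c in \<open>auto simp: set_borel_measurable_def intro: continuous_on_subset order_trans[OF less_imp_le[OF c(1)]]\<close>)
  also have "\<dots> \<le> (\<integral>\<^sup>+u. indicator ({F s..<F s + 1} \<inter> turn -` B) u \<partial>lborel)"
  proof (rule nn_integral_mono_AE)
    show "AE u in lborel. ennreal (indicator (turn -` B) u * indicator {F s..F s'} u) \<le> indicator ({F s..<F s + 1} \<inter> turn -` B) u"
      using AE_lborel_singleton[of "F s + 1"] by eventually_elim (use s(3) in \<open>auto simp: indicator_def\<close>)
  qed
  also have "\<dots> = emeasure circle_lebesgue B"
    unfolding emeasure_circle_lebesgue[OF B, of "F s"] by simp
  finally show ?thesis
    using c by (simp add: m.emeasure_eq_measure ennreal_mult'[symmetric])
qed

section \<open>Weak-star topology and observable measures\<close>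

lemma circle_measuresD:
  assumes "\<mu> \<in> circle_measures"
  shows "sets \<mu> = sets circle_borel" "space \<mu> = circle" "prob_space \<mu>"
  using assms sets_eq_imp_space_eq[of \<mu> circle_borel] by (auto simp: circle_measures_def)

lemma continuous_bounded_circle:
  assumes "continuous_on circle (\<phi>::complex \<Rightarrow> real)"
  obtains B where "B \<ge> 0" "\<And>x. x \<in> circle \<Longrightarrow> \<bar>\<phi> x\<bar> \<le> B"
proof -
  have "bounded (\<phi> ` circle)"
    by (intro compact_imp_bounded compact_continuous_image assms compact_sphere)
  then have "\<exists>B. \<forall>x\<in>circle. \<bar>\<phi> x\<bar> \<le> B" unfolding bounded_iff by (metis imageI real_norm_def)
  then obtain B where B: "\<And>x. x \<in> circle \<Longrightarrow> \<bar>\<phi> x\<bar> \<le> B" by blast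
  have "B \<ge> 0" using B[of 1] by (simp add: order_trans[OF abs_ge_zero])
  then show ?thesis using that B by blast
qed

lemma measurable_circle_measure:
  assumes "\<mu> \<in> circle_measures" "\<phi> \<in> borel_measurable circle_borel"
  shows "\<phi> \<in> borel_measurable \<mu>"
  using assms(2) measurable_cong_sets[OF circle_measuresD(1)[OF assms(1)] refl] by blast

lemma integrable_bounded_circle:
  assumes \<mu>: "\<mu> \<in> circle_measures" and "\<phi> \<in> borel_measurable circle_borel" and B: "\<And>x. x \<in> circle \<Longrightarrow> \<bar>\<phi> x\<bar> \<le> (B::real)"
  shows "integrable \<mu> \<phi>"
proof -
  interpret prob_space \<mu> using circle_measuresD[OF \<mu>] by simp
  show ?thesis
    by (rule integrable_const_bound[where B=B])
       (use measurable_circle_measure[OF \<mu>] assms circle_measuresD(2)[OF \<mu>] in auto)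
qed

lemma integrable_continuous_circle:
  assumes \<mu>: "\<mu> \<in> circle_measures" and \<phi>: "continuous_on circle (\<phi>::complex \<Rightarrow> real)"
  shows "integrable \<mu> \<phi>"
  using continuous_bounded_circle[OF \<phi>] integrable_bounded_circle[OF \<mu> circle_measurable_continuous[OF \<phi>]] by metis

lemma C1_maps_circle: "C1_circle_map f \<Longrightarrow> x \<in> circle \<Longrightarrow> f x \<in> circle"
  by (auto simp: C1_circle_map_def)

lemma C1_measurable: assumes "C1_circle_map f" shows "f \<in> measurable circle_borel circle_borel"
proof -
  have "f \<in> measurable circle_borel borel" by (intro circle_measurable_continuous C1_continuous assms)
  then show ?thesis using C1_maps_circle[OF assms] unfolding circle_borel_def
    by (intro measurable_restrict_space2) (auto simp: space_restrict_space)
qed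

lemma funpow_circle: "C1_circle_map f \<Longrightarrow> x \<in> circle \<Longrightarrow> (f ^^ j) x \<in> circle"
  by (induction j) (auto simp: C1_circle_map_def Pi_iff)

lemma funpow_continuous: assumes "C1_circle_map f" shows "continuous_on circle (f ^^ j)"
proof (induction j)
  case 0 then show ?case by (simp add: id_def)
next
  case (Suc j)
  have "continuous_on circle (\<lambda>x. f ((f ^^ j) x))"
    by (rule continuous_on_compose2[OF C1_continuous[OF assms] Suc]) (use funpow_circle[OF assms] in auto)
  then show ?case by (simp add: comp_def)
qed

lemma continuous_along_orbit:
  assumes "C1_circle_map f" "continuous_on circle \<kappa>"
  shows "continuous_on circle (\<lambda>x. \<kappa> ((f ^^ j) x))"
  by (rule continuous_on_compose2[OF assms(2) funpow_continuous[OF assms(1)]]) (use funpow_circle[OF assms(1)] in auto)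

subsection \<open>Empirical measures\<close>

text \<open>
  As image of the uniform measure on the times $0, \ldots, n - 1$, the empirical measure integrates
  functions to time averages.
\<close>

lemma empirical_measure_eq:
  assumes f: "C1_circle_map f" and x: "x \<in> circle" and n: "n > 0"
  shows "empirical_measure f n x = distr (uniform_count_measure {..<n}) circle_borel (\<lambda>j. (f ^^ j) x)"
proof -
  let ?N = "distr (uniform_count_measure {..<n}) circle_borel (\<lambda>j. (f ^^ j) x)"
  have m: "(\<lambda>j. (f ^^ j) x) \<in> measurable (uniform_count_measure {..<n}) circle_borel"
    using funpow_circle[OF f x] by (auto simp: measurable_def sets_uniform_count_measure space_uniform_count_measure)
  have "?N = measure_of (space circle_borel) (sets circle_borel) (emeasure ?N)"
    using measure_of_of_measure[of ?N] by simp
  also have "\<dots> = empirical_measure f n x"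
    unfolding empirical_measure_def
  proof (rule measure_of_eq)
    show "sets circle_borel \<subseteq> Pow (space circle_borel)" by (rule sets.space_closed)
    fix A assume "A \<in> sigma_sets (space circle_borel) (sets circle_borel)"
    then have A: "A \<in> sets circle_borel" by (simp only: sets.sigma_sets_eq)
    have "emeasure ?N A = of_nat (card {j. j < n \<and> (f ^^ j) x \<in> A}) / of_nat n"
      unfolding emeasure_distr[OF m A]
      by (subst emeasure_uniform_count_measure)
         (use n in \<open>auto simp: space_uniform_count_measure ennreal_of_nat_eq_real_of_nat vimage_def Int_def conj_commute divide_ennreal\<close>)
    also have "of_nat (card {j. j < n \<and> (f ^^ j) x \<in> A}) = (\<Sum>j<n. (if (f ^^ j) x \<in> A then 1 else 0 :: ennreal))"
      by (simp add: sum.If_cases Int_def)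
    also have "\<dots> = (\<Sum>j<n. emeasure (return circle_borel ((f ^^ j) x)) A)"
      using A by (intro sum.cong) (auto simp: indicator_def)
    finally show "emeasure ?N A = (\<Sum>j<n. emeasure (return circle_borel ((f ^^ j) x)) A) / of_nat n" .
  qed
  finally show ?thesis by simp
qed

lemma
  assumes f: "C1_circle_map f" and x: "x \<in> circle" and n: "n > 0"
  shows empirical_in_circle_measures: "empirical_measure f n x \<in> circle_measures"
    and integral_empirical: "\<phi> \<in> borel_measurable circle_borel \<Longrightarrow>
      (\<integral>y. \<phi> y \<partial>empirical_measure f n x) = (\<Sum>j<n. \<phi> ((f ^^ j) x)) / real n"
proof -
  have m: "(\<lambda>j. (f ^^ j) x) \<in> measurable (uniform_count_measure {..<n}) circle_borel"
    using funpow_circle[OF f x] by (auto simp: measurable_def sets_uniform_count_measure space_uniform_count_measure)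
  interpret prob_space "uniform_count_measure {..<n}"
    by (rule prob_spaceI) (use n in \<open>auto simp: emeasure_uniform_count_measure space_uniform_count_measure\<close>)
  show "empirical_measure f n x \<in> circle_measures"
    unfolding empirical_measure_eq[OF f x n] circle_measures_def using prob_space_distr[OF m] by simp
  assume "\<phi> \<in> borel_measurable circle_borel"
  then show "(\<integral>y. \<phi> y \<partial>empirical_measure f n x) = (\<Sum>j<n. \<phi> ((f ^^ j) x)) / real n"
    unfolding empirical_measure_eq[OF f x n]
    by (subst integral_distr[OF m]) (auto simp: integral_uniform_count_measure)
qed

subsection \<open>Convergence, visits and invariance\<close>

lemma openin_weak_star_basic:
  assumes "continuous_on circle (\<phi>::complex \<Rightarrow> real)" "open U"
  shows "openin weak_star_topology {\<mu> \<in> circle_measures. (\<integral>x. \<phi> x \<partial>\<mu>) \<in> U}"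
  unfolding weak_star_topology_def by (rule topology_generated_by_Basis) (use assms in blast)

lemma topspace_weak_star [simp]: "topspace weak_star_topology = circle_measures"
proof
  show "topspace weak_star_topology \<subseteq> circle_measures"
    unfolding weak_star_topology_def topology_generated_by_topspace by auto
  show "circle_measures \<subseteq> topspace weak_star_topology"
    using openin_subset[OF openin_weak_star_basic[of "\<lambda>_. 0" UNIV]] by auto
qed

text \<open>
  Convergence need only be tested on the subbasis: lying in a set eventually is inherited by the
  finite intersections and unions that generate the topology.
\<close>

lemma limitin_weak_starI:
  assumes \<nu>: "\<And>k. \<nu> k \<in> circle_measures" and \<mu>: "\<mu> \<in> circle_measures"
    and conv: "\<And>\<phi>::complex \<Rightarrow> real. continuous_on circle \<phi> \<Longrightarrow> (\<lambda>k. \<integral>x. \<phi> x \<partial>\<nu> k) \<longlonglongrightarrow> (\<integral>x. \<phi> x \<partial>\<mu>)"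
  shows "limitin weak_star_topology \<nu> \<mu> sequentially"
proof -
  have "eventually (\<lambda>k. \<nu> k \<in> U) sequentially" if "openin weak_star_topology U" "\<mu> \<in> U" for U
    using that(1) that(2) unfolding weak_star_topology_def openin_topology_generated_by_iff
  proof (induction rule: generate_topology_on.induct)
    case (Int a b)
    then show ?case by (auto intro: eventually_conj)
  next
    case (UN K)
    then obtain k where "k \<in> K" "\<mu> \<in> k" by auto
    with UN have "eventually (\<lambda>n. \<nu> n \<in> k) sequentially" by auto
    then show ?case by (rule eventually_mono) (use \<open>k \<in> K\<close> in auto)
  next
    case (Basis s)
    then obtain \<phi> :: "complex \<Rightarrow> real" and V where s: "s = {\<mu> \<in> circle_measures. (\<integral>x. \<phi> x \<partial>\<mu>) \<in> V}"
      "continuous_on circle \<phi>" "open V" by blast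
    then have "eventually (\<lambda>k. (\<integral>x. \<phi> x \<partial>\<nu> k) \<in> V) sequentially"
      using Basis(2) by (intro topological_tendstoD[OF conv]) auto
    then show ?case using \<nu> unfolding s by simp
  qed simp
  then show ?thesis unfolding limitin_def using \<mu> by simp
qed

text \<open>
  The infimum in the definition of observability means something only over a nonempty set. Helly's
  selection theorem applies to the angles of the orbit; the limit law may charge the cut point, but
  test functions composed with \<open>turn\<close> are continuous on the whole line.
\<close>

lemma p_omega_nonempty:
  assumes f: "C1_circle_map f" and x: "x \<in> circle"
  shows "p_omega f x \<noteq> {}"
proof -
  define \<nu> where "\<nu> n = empirical_measure f (Suc n) x" for n
  define M where "M n = distr (\<nu> n) borel (angle 0)" for n
  have \<nu>: "\<nu> n \<in> circle_measures" for n
    unfolding \<nu>_def by (rule empirical_in_circle_measures[OF f x]) simp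
  have am: "angle 0 \<in> measurable (\<nu> n) borel" for n
    using measurable_circle_measure[OF \<nu> circle_measurableI[OF angle_measurable]] .
  have rd: "real_distribution (M n)" for n
    unfolding M_def using prob_space.real_distribution_distr[OF circle_measuresD(3)[OF \<nu>] am] .
  have "measure (M n) {-1<..1} = 1" for n
  proof -
    have "measure (M n) {-1<..1} = measure (\<nu> n) (angle 0 -` {-1<..1} \<inter> space (\<nu> n))"
      unfolding M_def by (rule measure_distr[OF am]) simp
    also have "angle 0 -` {-1<..1} \<inter> space (\<nu> n) = space (\<nu> n)"
    proof -
      have "angle 0 x \<in> {-1<..1}" for x using angle_bounds[of 0 x] by simp
      then show ?thesis by blast
    qed
    finally show ?thesis using prob_space.prob_space[OF circle_measuresD(3)[OF \<nu>]] by simp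
  qed
  then have "\<exists>a b. a < b \<and> (\<forall>n. 1 - \<epsilon> < measure (M n) {a<..b})" if "\<epsilon> > 0" for \<epsilon> :: real
    using that by (intro exI[of _ "-1"] exI[of _ 1]) simp
  then have "tight M" unfolding tight_def using rd by blast
  moreover have "strict_mono (id :: nat \<Rightarrow> nat)" by (simp add: strict_mono_def)
  ultimately obtain r L where r: "strict_mono (r::nat\<Rightarrow>nat)" "real_distribution L" "weak_conv_m (M \<circ> id \<circ> r) L"
    using tight_imp_convergent_subsubsequence[of M id] by blast
  interpret L: real_distribution L by (rule r(2))
  define \<mu> where "\<mu> = distr L circle_borel turn"
  have tm: "turn \<in> measurable L circle_borel" by measurable
  have \<mu>: "\<mu> \<in> circle_measures" unfolding \<mu>_def circle_measures_def using L.prob_space_distr[OF tm] by simp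
  have "limitin weak_star_topology (\<lambda>k. \<nu> (r k)) \<mu> sequentially"
  proof (rule limitin_weak_starI[OF \<nu> \<mu>])
    fix \<phi> :: "complex \<Rightarrow> real" assume \<phi>: "continuous_on circle \<phi>"
    obtain B where B: "\<And>x. x \<in> circle \<Longrightarrow> \<bar>\<phi> x\<bar> \<le> B" using continuous_bounded_circle[OF \<phi>] by metis
    have \<phi>m: "\<phi> \<in> borel_measurable circle_borel" by (rule circle_measurable_continuous[OF \<phi>])
    have "(\<lambda>k. \<integral>t. \<phi> (turn t) \<partial>(M \<circ> id \<circ> r) k) \<longlonglongrightarrow> (\<integral>t. \<phi> (turn t) \<partial>L)"
    proof (rule weak_conv_imp_integral_bdd_continuous_conv)
      show "isCont (\<lambda>t. \<phi> (turn t)) t" for t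
        using continuous_on_compose_turn[OF \<phi>, of UNIV] by (simp add: continuous_on_eq_continuous_at)
      show "norm (\<phi> (turn t)) \<le> B" for t using B[of "turn t"] by simp
    qed (use r rd in \<open>auto simp: comp_def\<close>)
    also have "(\<integral>t. \<phi> (turn t) \<partial>L) = (\<integral>x. \<phi> x \<partial>\<mu>)"
      unfolding \<mu>_def by (rule integral_distr[OF tm \<phi>m, symmetric])
    also have "(\<lambda>k. \<integral>t. \<phi> (turn t) \<partial>(M \<circ> id \<circ> r) k) = (\<lambda>k. \<integral>x. \<phi> x \<partial>\<nu> (r k))"
    proof
      fix k
      have "(\<integral>t. \<phi> (turn t) \<partial>M (r k)) = (\<integral>x. \<phi> (turn (angle 0 x)) \<partial>\<nu> (r k))"
        unfolding M_def using measurable_compose[OF turn_measurable_circle \<phi>m] by (intro integral_distr[OF am])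
      also have "\<dots> = (\<integral>x. \<phi> x \<partial>\<nu> (r k))"
        by (intro Bochner_Integration.integral_cong) (auto simp: circle_measuresD(2)[OF \<nu>] turn_angle)
      finally show "(\<integral>t. \<phi> (turn t) \<partial>(M \<circ> id \<circ> r) k) = (\<integral>x. \<phi> x \<partial>\<nu> (r k))" by simp
    qed
    finally show "(\<lambda>k. \<integral>x. \<phi> x \<partial>\<nu> (r k)) \<longlonglongrightarrow> (\<integral>x. \<phi> x \<partial>\<mu>)" .
  qed
  then have "\<mu> \<in> p_omega f x" unfolding p_omega_def \<nu>_def using r(1) by blast
  then show ?thesis by auto
qed

text \<open>
  Some limit of empirical measures of $x$ lies in a ball around $\mu$ inside $U$, hence in $U$, and $U$
  is open.
\<close>

lemma observable_visits:
  assumes d: "weak_star_metric d" and f: "C1_circle_map f" and ob: "observable d f \<mu>"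
    and U: "openin weak_star_topology U" "\<mu> \<in> U"
  shows "\<exists>A\<subseteq>circle. emeasure circle_lebesgue A > 0 \<and>
           (\<forall>x\<in>A. \<exists>\<^sub>F n in sequentially. empirical_measure f (Suc n) x \<in> U)"
proof -
  interpret D: Metric_space circle_measures d using d by (simp add: weak_star_metric_def)
  have top: "D.mtopology = weak_star_topology" using d by (simp add: weak_star_metric_def)
  obtain \<epsilon> where \<epsilon>: "\<epsilon> > 0" "D.mball \<mu> \<epsilon> \<subseteq> U"
    using U unfolding top[symmetric] D.openin_mtopology by blast
  let ?A = "{x \<in> circle. (INF \<nu>\<in>p_omega f x. d \<nu> \<mu>) < \<epsilon>}"
  have "\<exists>\<^sub>F n in sequentially. empirical_measure f (Suc n) x \<in> U" if x: "x \<in> ?A" for x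
  proof -
    have xc: "x \<in> circle" using x by simp
    have "\<exists>\<nu>\<in>p_omega f x. d \<nu> \<mu> < \<epsilon>"
    proof (rule ccontr)
      assume "\<not> ?thesis"
      then have "\<epsilon> \<le> (INF \<nu>\<in>p_omega f x. d \<nu> \<mu>)"
        by (intro cINF_greatest p_omega_nonempty[OF f xc]) (auto simp: not_less)
      then show False using x by simp
    qed
    then obtain \<nu> r where \<nu>: "d \<nu> \<mu> < \<epsilon>" "strict_mono (r::nat\<Rightarrow>nat)"
      "limitin weak_star_topology (\<lambda>k. empirical_measure f (Suc (r k)) x) \<nu> sequentially"
      unfolding p_omega_def by auto
    have "\<nu> \<in> circle_measures" "\<mu> \<in> circle_measures"
      using \<nu>(3) ob by (auto simp: limitin_def observable_def)
    then have "\<nu> \<in> U" using \<nu>(1) \<epsilon> D.commute by auto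
    then have "\<forall>\<^sub>F k in sequentially. empirical_measure f (Suc (r k)) x \<in> U"
      using \<nu>(3) U(1) by (auto simp: limitin_def)
    then obtain K where K: "\<And>k. k \<ge> K \<Longrightarrow> empirical_measure f (Suc (r k)) x \<in> U"
      by (auto simp: eventually_sequentially)
    show ?thesis unfolding frequently_sequentially
    proof
      fix N
      show "\<exists>n\<ge>N. empirical_measure f (Suc n) x \<in> U"
        using K[of "max K N"] strict_mono_imp_increasing[OF \<nu>(2), of "max K N"] by (intro exI[of _ "r (max K N)"]) auto
    qed
  qed
  moreover have "emeasure circle_lebesgue ?A > 0" using ob \<epsilon>(1) by (simp add: observable_def)
  ultimately show ?thesis by (intro exI[of _ ?A]) auto
qed

text \<open>
  The only neighbourhoods of $\mu$ that the sequel uses are half-spaces given by one continuous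
  function.
\<close>

lemma observable_average_below:
  assumes d: "weak_star_metric d" and f: "C1_circle_map f" and ob: "observable d f \<mu>"
    and \<kappa>: "continuous_on circle \<kappa>" and c: "(\<integral>x. \<kappa> x \<partial>\<mu>) < c"
  shows "\<exists>A\<subseteq>circle. emeasure circle_lebesgue A > 0 \<and>
           (\<forall>x\<in>A. \<exists>\<^sub>F n in sequentially. (\<Sum>j<Suc n. \<kappa> ((f ^^ j) x)) < c * real (Suc n))"
proof -
  let ?U = "{\<nu> \<in> circle_measures. (\<integral>x. \<kappa> x \<partial>\<nu>) \<in> {..<c}}"
  have "\<mu> \<in> ?U" using ob c by (simp add: observable_def)
  from observable_visits[OF d f ob openin_weak_star_basic[OF \<kappa> open_lessThan] this]
  obtain A where A: "A \<subseteq> circle" "emeasure circle_lebesgue A > 0"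
    "\<And>x. x \<in> A \<Longrightarrow> \<exists>\<^sub>F n in sequentially. empirical_measure f (Suc n) x \<in> ?U" by blast
  have "\<exists>\<^sub>F n in sequentially. (\<Sum>j<Suc n. \<kappa> ((f ^^ j) x)) < c * real (Suc n)" if "x \<in> A" for x
    using A(3)[OF that]
  proof (rule frequently_elim1)
    fix n assume "empirical_measure f (Suc n) x \<in> ?U"
    then have "(\<Sum>j<Suc n. \<kappa> ((f ^^ j) x)) / real (Suc n) < c"
      using integral_empirical[OF f _ zero_less_Suc circle_measurable_continuous[OF \<kappa>], of x n] A(1) that by auto
    then show "(\<Sum>j<Suc n. \<kappa> ((f ^^ j) x)) < c * real (Suc n)" by (simp add: field_simps del: sum.lessThan_Suc)
  qed
  then show ?thesis using A(1,2) by (intro exI[of _ A] conjI ballI)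
qed

lemma Int_circle_borel: "B \<in> sets borel \<Longrightarrow> B \<inter> circle \<in> sets circle_borel"
  unfolding circle_borel_def sets_restrict_space by (rule image_eqI[of _ _ B]) (rule Int_commute)

text \<open>
  The integrands decrease to the indicator of $K$, because $K$ is closed.
\<close>

lemma integral_closed_limit:
  assumes \<mu>: "\<mu> \<in> circle_measures" and K: "closed K" "K \<noteq> {}"
  shows "(\<lambda>n. \<integral>x. max 0 (1 - real n * infdist x K) \<partial>\<mu>) \<longlonglongrightarrow> measure \<mu> (K \<inter> circle)"
proof -
  interpret prob_space \<mu> using circle_measuresD[OF \<mu>] by simp
  have Km: "K \<inter> circle \<in> sets \<mu>"
    unfolding circle_measuresD(1)[OF \<mu>] using K by (intro Int_circle_borel borel_closed)
  have "(\<lambda>n. \<integral>x. max 0 (1 - real n * infdist x K) \<partial>\<mu>) \<longlonglongrightarrow> (\<integral>x. indicator (K \<inter> circle) x \<partial>\<mu>)"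
  proof (rule integral_dominated_convergence[where w="\<lambda>_. 1"])
    show "(\<lambda>x. max 0 (1 - real n * infdist x K)) \<in> borel_measurable \<mu>" for n
      by (intro measurable_circle_measure[OF \<mu>] circle_measurable_continuous continuous_intros)
    show "AE x in \<mu>. (\<lambda>n. max 0 (1 - real n * infdist x K)) \<longlonglongrightarrow> indicator (K \<inter> circle) x"
    proof (rule AE_I2)
      fix x assume x: "x \<in> space \<mu>"
      show "(\<lambda>n. max 0 (1 - real n * infdist x K)) \<longlonglongrightarrow> indicator (K \<inter> circle) x"
      proof (cases "x \<in> K")
        case True
        then show ?thesis using x circle_measuresD(2)[OF \<mu>] by simp
      next
        case False
        then have p: "infdist x K > 0" using in_closed_iff_infdist_zero[OF K, of x] infdist_nonneg[of x K] by linarith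
        obtain n0 :: nat where n0: "1 / infdist x K < real n0" using reals_Archimedean2 by blast
        have "max 0 (1 - real n * infdist x K) = 0" if "n \<ge> n0" for n
        proof -
          have "1 < real n0 * infdist x K" using n0 p by (simp add: field_simps)
          also have "\<dots> \<le> real n * infdist x K" using that p by (intro mult_right_mono) auto
          finally show ?thesis by simp
        qed
        then have "eventually (\<lambda>n. max 0 (1 - real n * infdist x K) = 0) sequentially"
          by (auto simp: eventually_sequentially)
        then show ?thesis using False by (simp add: tendsto_eventually)
      qed
    qed
    show "AE x in \<mu>. norm (max 0 (1 - real n * infdist x K)) \<le> 1" for n
      by (simp add: infdist_nonneg)
  qed (use Km in auto)
  then show ?thesis using Km by simp
qed

lemma circle_measure_eqI:
  assumes \<mu>: "\<mu> \<in> circle_measures" and \<nu>: "\<nu> \<in> circle_measures"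
    and eq: "\<And>\<phi>::complex \<Rightarrow> real. continuous_on circle \<phi> \<Longrightarrow> (\<integral>x. \<phi> x \<partial>\<mu>) = (\<integral>x. \<phi> x \<partial>\<nu>)"
  shows "\<mu> = \<nu>"
proof -
  interpret \<mu>: prob_space \<mu> using circle_measuresD[OF \<mu>] by simp
  interpret \<nu>: prob_space \<nu> using circle_measuresD[OF \<nu>] by simp
  have ic: "(\<lambda>x::complex. x) \<in> measurable circle_borel borel" by (rule circle_measurableI) simp
  have im: "(\<lambda>x. x) \<in> measurable \<mu> borel" "(\<lambda>x. x) \<in> measurable \<nu> borel"
    using measurable_cong_sets[OF circle_measuresD(1)[OF \<mu>] refl] measurable_cong_sets[OF circle_measuresD(1)[OF \<nu>] refl] ic by blast+
  have closed_eq: "emeasure \<mu> (K \<inter> circle) = emeasure \<nu> (K \<inter> circle)" if K: "closed K" for K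
  proof (cases "K = {}")
    case False
    have "(\<integral>x. max 0 (1 - real n * infdist x K) \<partial>\<mu>) = (\<integral>x. max 0 (1 - real n * infdist x K) \<partial>\<nu>)" for n
      by (rule eq) (intro continuous_intros)
    then have "measure \<mu> (K \<inter> circle) = measure \<nu> (K \<inter> circle)"
      using integral_closed_limit[OF \<mu> K False] integral_closed_limit[OF \<nu> K False] LIMSEQ_unique by simp
    then show ?thesis by (simp add: \<mu>.emeasure_eq_measure \<nu>.emeasure_eq_measure)
  qed simp
  have D: "distr \<mu> borel (\<lambda>x. x) = distr \<nu> borel (\<lambda>x. x)"
  proof (rule measure_eqI_generator_eq[where E="Collect closed" and \<Omega>=UNIV and A="\<lambda>_. UNIV"])
    show "Int_stable (Collect closed)" by (auto simp: Int_stable_def)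
    fix K :: "complex set" assume "K \<in> Collect closed"
    then show "emeasure (distr \<mu> borel (\<lambda>x. x)) K = emeasure (distr \<nu> borel (\<lambda>x. x)) K"
      using closed_eq[of K] im by (simp add: emeasure_distr circle_measuresD[OF \<mu>] circle_measuresD[OF \<nu>])
  next
    show "sets (distr \<mu> borel (\<lambda>x. x)) = sigma_sets UNIV (Collect closed)"
      "sets (distr \<nu> borel (\<lambda>x. x)) = sigma_sets UNIV (Collect closed)"
      by (simp_all add: borel_eq_closed)
    show "emeasure (distr \<mu> borel (\<lambda>x. x)) UNIV \<noteq> \<infinity>"
      using im(1) by (simp add: emeasure_distr \<mu>.emeasure_eq_measure)
  qed auto
  show ?thesis
  proof (rule measure_eqI)
    show "sets \<mu> = sets \<nu>" using circle_measuresD \<mu> \<nu> by simp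
    fix A assume "A \<in> sets \<mu>"
    then obtain B where B: "B \<in> sets borel" "A = B \<inter> circle"
      unfolding circle_measuresD(1)[OF \<mu>] circle_borel_def sets_restrict_space by blast
    have "emeasure \<mu> A = emeasure (distr \<mu> borel (\<lambda>x. x)) B"
      using B im by (simp add: emeasure_distr circle_measuresD[OF \<mu>])
    also have "\<dots> = emeasure \<nu> A"
      unfolding D using B im by (simp add: emeasure_distr circle_measuresD[OF \<nu>])
    finally show "emeasure \<mu> A = emeasure \<nu> A" .
  qed
qed

text \<open>
  Averages of a coboundary $\phi \circ f - \phi$ along an orbit telescope and tend to $0$, so its integral
  against $\mu$ cannot be negative; the same holds for $-\phi$.
\<close>

lemma observable_invariant:
  assumes d: "weak_star_metric d" and f: "C1_circle_map f" and ob: "observable d f \<mu>"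
  shows "\<mu> \<in> invariant_measures f"
proof -
  have \<mu>: "\<mu> \<in> circle_measures" using ob by (simp add: observable_def)
  interpret prob_space \<mu> using circle_measuresD[OF \<mu>] by simp
  have fm: "f \<in> measurable \<mu> circle_borel"
    using C1_measurable[OF f] measurable_cong_sets[OF circle_measuresD(1)[OF \<mu>] refl] by blast
  have cf: "continuous_on circle (\<lambda>x. \<phi> (f x))" if "continuous_on circle \<phi>" for \<phi> :: "complex \<Rightarrow> real"
    using continuous_along_orbit[OF f that, of 1] by simp
  have ge: "(\<integral>x. \<phi> x \<partial>\<mu>) \<le> (\<integral>x. \<phi> (f x) \<partial>\<mu>)" if \<phi>: "continuous_on circle \<phi>" for \<phi> :: "complex \<Rightarrow> real"
  proof (rule ccontr)
    assume "\<not> ?thesis"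
    moreover have "(\<integral>x. \<phi> (f x) - \<phi> x \<partial>\<mu>) = (\<integral>x. \<phi> (f x) \<partial>\<mu>) - (\<integral>x. \<phi> x \<partial>\<mu>)"
      by (rule Bochner_Integration.integral_diff[OF integrable_continuous_circle[OF \<mu> cf[OF \<phi>]] integrable_continuous_circle[OF \<mu> \<phi>]])
    ultimately have "(\<integral>x. \<phi> (f x) - \<phi> x \<partial>\<mu>) < 0" by linarith
    then obtain c where c: "(\<integral>x. \<phi> (f x) - \<phi> x \<partial>\<mu>) < c" "c < 0" using dense by blast
    obtain B where B: "B \<ge> 0" "\<And>x. x \<in> circle \<Longrightarrow> \<bar>\<phi> x\<bar> \<le> B" using continuous_bounded_circle[OF \<phi>] by metis
    from observable_average_below[OF d f ob _ c(1)] obtain A where A: "A \<subseteq> circle" "emeasure circle_lebesgue A > 0"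
      and fr: "\<And>x. x \<in> A \<Longrightarrow> \<exists>\<^sub>F n in sequentially. (\<Sum>j<Suc n. \<phi> (f ((f ^^ j) x)) - \<phi> ((f ^^ j) x)) < c * real (Suc n)"
      using continuous_on_diff[OF cf[OF \<phi>] \<phi>] by blast
    from A(2) have "A \<noteq> {}" by auto
    then obtain x where x: "x \<in> A" by blast
    obtain n0 :: nat where n0: "2 * B / (- c) < real n0" using reals_Archimedean2 by blast
    obtain n where n: "n \<ge> n0" "(\<Sum>j<Suc n. \<phi> (f ((f ^^ j) x)) - \<phi> ((f ^^ j) x)) < c * real (Suc n)"
      using fr[OF x] unfolding frequently_sequentially by blast
    have "(\<Sum>j<Suc n. \<phi> (f ((f ^^ j) x)) - \<phi> ((f ^^ j) x)) = \<phi> ((f ^^ Suc n) x) - \<phi> x"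
      using sum_lessThan_telescope[of "\<lambda>j. \<phi> ((f ^^ j) x)" "Suc n"] by simp
    then have "\<phi> ((f ^^ Suc n) x) - \<phi> x < c * real (Suc n)" using n by simp
    moreover have "\<bar>\<phi> ((f ^^ Suc n) x)\<bar> \<le> B" "\<bar>\<phi> x\<bar> \<le> B"
      using x A(1) by (intro B funpow_circle[OF f]; auto)+
    ultimately have "- (2 * B) < c * real (Suc n)" by linarith
    moreover have "2 * B < (- c) * real n0" using n0 c by (simp add: field_simps)
    moreover have "(- c) * real n0 \<le> (- c) * real (Suc n)" using n c by (intro mult_left_mono) auto
    ultimately show False by simp
  qed
  have \<mu>f: "distr \<mu> circle_borel f \<in> circle_measures"
    unfolding circle_measures_def using prob_space_distr[OF fm] by simp
  have "distr \<mu> circle_borel f = \<mu>"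
  proof (rule circle_measure_eqI[OF \<mu>f \<mu>])
    fix \<phi> :: "complex \<Rightarrow> real" assume \<phi>: "continuous_on circle \<phi>"
    have "(\<integral>x. \<phi> x \<partial>distr \<mu> circle_borel f) = (\<integral>x. \<phi> (f x) \<partial>\<mu>)"
      by (rule integral_distr[OF fm circle_measurable_continuous[OF \<phi>]])
    also have "\<dots> = (\<integral>x. \<phi> x \<partial>\<mu>)"
      using ge[OF \<phi>] ge[OF continuous_on_minus[OF \<phi>]] by simp
    finally show "(\<integral>x. \<phi> x \<partial>distr \<mu> circle_borel f) = (\<integral>x. \<phi> x \<partial>\<mu>)" .
  qed
  then show ?thesis using \<mu> by (simp add: invariant_measures_def)
qed

text \<open>
  The functions $\sup_y (G(y) - k |x - y|)$ are Lipschitz, lie above $G$ and converge to $G$ at each of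
  its continuity points. This replaces a labelling that jumps on a null set by a continuous test function.
\<close>

lemma continuous_majorant:
  assumes \<mu>: "\<mu> \<in> circle_measures" and Gm: "G \<in> borel_measurable circle_borel"
    and G: "\<And>x. x \<in> circle \<Longrightarrow> \<bar>G x\<bar> \<le> (B::real)"
    and E: "E \<in> null_sets \<mu>" "\<And>x. x \<in> circle - E \<Longrightarrow> continuous (at x within circle) G"
    and \<delta>: "\<delta> > 0"
  obtains \<phi> where "continuous_on circle \<phi>" "\<And>x. x \<in> circle \<Longrightarrow> G x \<le> \<phi> x" "(\<integral>x. \<phi> x \<partial>\<mu>) < (\<integral>x. G x \<partial>\<mu>) + \<delta>"
proof -
  interpret prob_space \<mu> using circle_measuresD[OF \<mu>] by simp
  have B0: "B \<ge> 0" using G[of 1] by (simp add: order_trans[OF abs_ge_zero])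
  have ne: "circle \<noteq> {}" using turn_circle by blast
  define \<phi> where "\<phi> k x = (SUP y\<in>circle. G y - real k * dist x y)" for k x
  have le: "G y - real k * dist x y \<le> B" if "y \<in> circle" for k x y
  proof -
    have "0 \<le> real k * dist x y" by simp
    then show ?thesis using G[OF that] by linarith
  qed
  have bdd: "bdd_above ((\<lambda>y. G y - real k * dist x y) ` circle)" for k x
    by (rule bdd_aboveI2[where M=B]) (rule le)
  have up: "G y - real k * dist x y \<le> \<phi> k x" if "y \<in> circle" for k x y
    unfolding \<phi>_def by (rule cSUP_upper[OF that bdd])
  have Gle: "G x \<le> \<phi> k x" if "x \<in> circle" for k x using up[OF that, of k x] by simp
  have \<phi>B: "\<phi> k x \<le> B" for k x unfolding \<phi>_def by (rule cSUP_least[OF ne]) (rule le)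
  have lip: "\<phi> k x \<le> \<phi> k x' + real k * dist x x'" for k x x'
    unfolding \<phi>_def[of k x]
  proof (rule cSUP_least[OF ne])
    fix y assume y: "y \<in> circle"
    have "real k * dist x' y \<le> real k * (dist x x' + dist x y)"
      by (intro mult_left_mono) (metis add.commute dist_commute dist_triangle, simp)
    then show "G y - real k * dist x y \<le> \<phi> k x' + real k * dist x x'"
      using up[OF y, of k x'] by (simp add: algebra_simps)
  qed
  have cont: "continuous_on circle (\<phi> k)" for k
  proof (rule continuous_onI)
    fix x and e :: real assume "e > 0"
    have "dist (\<phi> k x') (\<phi> k x) \<le> e" if "dist x' x < e / (real k + 1)" for x'
    proof -
      have "real k * dist x' x \<le> (real k + 1) * dist x' x" by (intro mult_right_mono) auto
      also have "\<dots> \<le> e" using that by (simp add: field_simps)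
      finally show ?thesis using lip[of k x x'] lip[of k x' x] by (simp add: dist_real_def dist_commute abs_le_iff)
    qed
    then show "\<exists>d>0. \<forall>x'\<in>circle. dist x' x < d \<longrightarrow> dist (\<phi> k x') (\<phi> k x) \<le> e"
      using \<open>e > 0\<close> by (intro exI[of _ "e / (real k + 1)"]) auto
  qed
  have lim: "(\<lambda>k. \<phi> k x) \<longlonglongrightarrow> G x" if x: "x \<in> circle - E" for x
  proof (rule LIMSEQ_I)
    fix e :: real assume e: "e > 0"
    obtain d where d: "d > 0" "\<And>y. y \<in> circle \<Longrightarrow> dist y x < d \<Longrightarrow> dist (G y) (G x) < e / 2"
      using E(2)[OF x] e unfolding continuous_within_eps_delta by (metis half_gt_zero)
    obtain k0 :: nat where k0: "2 * B / d < real k0" using reals_Archimedean2 by blast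
    show "\<exists>k0. \<forall>k\<ge>k0. norm (\<phi> k x - G x) < e"
    proof (intro exI allI impI)
      fix k assume k: "k \<ge> k0"
      have "\<phi> k x \<le> G x + e / 2" unfolding \<phi>_def
      proof (rule cSUP_least[OF ne])
        fix y assume y: "y \<in> circle"
        show "G y - real k * dist x y \<le> G x + e / 2"
        proof (cases "dist y x < d")
          case True
          moreover have "0 \<le> real k * dist x y" by simp
          ultimately show ?thesis using d(2)[OF y True] unfolding dist_real_def by linarith
        next
          case False
          have "2 * B \<le> real k0 * d" using k0 d(1) by (simp add: field_simps)
          also have "\<dots> \<le> real k * dist x y"
            using False k d(1) by (intro mult_mono) (auto simp: dist_commute)
          finally show ?thesis using G[OF y] G[of x] x e by (simp add: abs_le_iff)
        qed
      qed
      then show "norm (\<phi> k x - G x) < e" using Gle[of x k] x e by auto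
    qed
  qed
  have "(\<lambda>k. \<integral>x. \<phi> k x \<partial>\<mu>) \<longlonglongrightarrow> (\<integral>x. G x \<partial>\<mu>)"
  proof (rule integral_dominated_convergence[where w="\<lambda>_. B"])
    show "AE x in \<mu>. (\<lambda>k. \<phi> k x) \<longlonglongrightarrow> G x"
      using AE_not_in[OF E(1)] AE_space by eventually_elim (use lim circle_measuresD(2)[OF \<mu>] in auto)
    show "AE x in \<mu>. norm (\<phi> k x) \<le> B" for k
    proof (rule AE_I2)
      fix x assume "x \<in> space \<mu>"
      then show "norm (\<phi> k x) \<le> B"
        using \<phi>B[of k x] Gle[of x k] G[of x] circle_measuresD(2)[OF \<mu>] by (auto simp: abs_le_iff)
    qed
  qed (use measurable_circle_measure[OF \<mu>] Gm circle_measurable_continuous[OF cont] in auto)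
  from order_tendstoD(2)[OF this, of "(\<integral>x. G x \<partial>\<mu>) + \<delta>"] \<delta>
  obtain k where "(\<integral>x. \<phi> k x \<partial>\<mu>) < (\<integral>x. G x \<partial>\<mu>) + \<delta>" by (auto simp: eventually_sequentially)
  then show ?thesis using that[OF cont] Gle by blast
qed

section \<open>Markov partitions of an expanding map\<close>

text \<open>
  The fixed point $p$ is what makes the cuts at $f^{-n}(p)$ a Markov partition: $F^n$ maps $[p, p + 1)$ onto
  $[p, p + d^n)$, where $d$ is the degree.
\<close>

locale expanding_lift =
  fixes f :: "complex \<Rightarrow> complex" and F :: "real \<Rightarrow> real" and p :: real
  assumes C1: "C1_circle_map f"
    and gt1: "x \<in> circle \<Longrightarrow> circle_deriv f x > 1"
    and lift: "f (turn t) = turn (F t)"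
    and der: "(F has_real_derivative circle_deriv f (turn t)) (at t)"
    and fixpt: "F p = p"

text \<open>
  $F(t + 1) - F(t)$ has derivative $0$, is an integer, and exceeds $1$ by the mean value theorem.
\<close>

lemma lift_shift:
  assumes f: "C1_circle_map f" and gt1: "\<And>x. x \<in> circle \<Longrightarrow> circle_deriv f x > 1"
    and F: "\<And>t. f (turn t) = turn (F t)" "\<And>t. (F has_real_derivative circle_deriv f (turn t)) (at t)"
  obtains k :: nat where "k \<ge> 2" "\<And>t. F (t + 1) = F t + real k"
proof -
  have "((\<lambda>t. F (t + 1) - F t) has_real_derivative 0) (at t)" for t
  proof -
    have "((\<lambda>t. F (t + 1)) has_real_derivative circle_deriv f (turn (t + 1))) (at t)"
      using F(2)[of "t + 1"] by (simp add: DERIV_shift)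
    from DERIV_diff[OF this F(2)[of t]] show ?thesis
      using turn_plus_int[of t 1] by simp
  qed
  then have const: "F (t + 1) - F t = F (0 + 1) - F 0" for t
    using DERIV_isconst_all[of "\<lambda>t. F (t + 1) - F t" t 0] by blast
  have "turn (F 1) = turn (F 0)" using F(1)[of 1] F(1)[of 0] turn_int[of 1] by simp
  then obtain m :: int where m: "F 1 - F 0 = of_int m" by (auto simp: turn_eq_iff elim: Ints_cases)
  obtain z where z: "F 1 - F 0 = (1 - 0) * circle_deriv f (turn z)"
    using MVT2[of 0 1 F "\<lambda>t. circle_deriv f (turn t)"] F(2) by auto
  then have "real_of_int m > 1" using gt1[of "turn z"] m by simp
  then have m1: "m \<ge> 2" by linarith
  show ?thesis
  proof
    show "nat m \<ge> 2" using m1 by linarith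
    show "F (t + 1) = F t + real (nat m)" for t using const[of t] m m1 by simp
  qed
qed

text \<open>
  Over one period $F(t) - t$ increases by at least $1$, so it takes an integer value $m$; the lift $F - m$
  has a fixed point there.
\<close>

lemma expanding_lift_exists:
  assumes f: "C1_circle_map f" and gt1: "\<And>x. x \<in> circle \<Longrightarrow> circle_deriv f x > 1"
  obtains F p where "expanding_lift f F p"
proof -
  obtain F where F: "\<And>t. f (turn t) = turn (F t)" "\<And>t. (F has_real_derivative circle_deriv f (turn t)) (at t)"
    using lift_exists[OF f] by blast
  obtain k :: nat where k: "k \<ge> 2" "\<And>t. F (t + 1) = F t + real k" using lift_shift[OF f gt1 F] by blast
  \<comment> \<open>This is the least integer above the value of $F(t) - t$ at $t = 0$.\<close>
  define m where "m = \<lceil>F 0\<rceil>"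
  have "F 0 - 0 \<le> of_int m" unfolding m_def by linarith
  moreover have "of_int m \<le> F 1 - 1" using k(2)[of 0] k(1) unfolding m_def by simp linarith
  moreover have "continuous_on {0..1} (\<lambda>t. F t - t)"
    by (intro continuous_on_diff continuous_on_id continuous_at_imp_continuous_on ballI DERIV_isCont[OF F(2)])
  ultimately obtain p where p: "F p - p = of_int m"
    using IVT'[of "\<lambda>t. F t - t" 0 "of_int m" 1] by auto
  have "expanding_lift f (\<lambda>t. F t - of_int m) p"
  proof
    show "f (turn t) = turn (F t - of_int m)" for t using F(1)[of t] turn_plus_int[of "F t" "- m"] by simp
    show "((\<lambda>t. F t - of_int m) has_real_derivative circle_deriv f (turn t)) (at t)" for t
      using F(2)[of t] by (auto intro!: derivative_eq_intros)
  qed (use f gt1 p in auto)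
  then show ?thesis using that by blast
qed

lemma dist_turn_le: "dist (turn s) (turn t) \<le> 2 * pi * \<bar>s - t\<bar>"
proof -
  have "norm (turn s - turn t) \<le> (2 * pi) * norm (s - t)"
  proof (rule differentiable_bound[where S=UNIV and f'="\<lambda>x h. h *\<^sub>R (of_real (2 * pi) * \<i> * turn x)"])
    show "(turn has_derivative (\<lambda>h. h *\<^sub>R (of_real (2 * pi) * \<i> * turn x))) (at x)" for x
      using turn_has_vector_derivative[of "\<lambda>t. t" 1 x] by (simp add: has_vector_derivative_def)
    show "onorm (\<lambda>h. h *\<^sub>R (complex_of_real (2 * pi) * \<i> * turn x)) \<le> 2 * pi" for x
      by (rule onorm_le) (simp add: norm_mult)
  qed auto
  then show ?thesis by (simp add: dist_norm)
qed

lemma uniformly_continuous_turn: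
  fixes \<kappa> :: "complex \<Rightarrow> real"
  assumes "continuous_on circle \<kappa>" "\<epsilon> > 0"
  obtains \<delta> where "\<delta> > 0" "\<And>s t. \<bar>s - t\<bar> \<le> \<delta> \<Longrightarrow> \<bar>\<kappa> (turn s) - \<kappa> (turn t)\<bar> < \<epsilon>"
proof -
  have "uniformly_continuous_on circle \<kappa>"
    by (rule compact_uniformly_continuous[OF assms(1) compact_sphere])
  then obtain d where d: "d > 0" "\<And>x y. x \<in> circle \<Longrightarrow> y \<in> circle \<Longrightarrow> dist y x < d \<Longrightarrow> dist (\<kappa> y) (\<kappa> x) < \<epsilon>"
    unfolding uniformly_continuous_on_def using assms(2) by meson
  show ?thesis
  proof
    show "d / (4 * pi) > 0" using d(1) by simp
    fix s t :: real assume st: "\<bar>s - t\<bar> \<le> d / (4 * pi)"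
    have "dist (turn s) (turn t) \<le> 2 * pi * \<bar>s - t\<bar>" by (rule dist_turn_le)
    also have "\<dots> \<le> 2 * pi * (d / (4 * pi))" using st by (intro mult_left_mono) auto
    also have "\<dots> < d" using d(1) by simp
    finally have "dist (\<kappa> (turn s)) (\<kappa> (turn t)) < \<epsilon>" by (intro d(2)) auto
    then show "\<bar>\<kappa> (turn s) - \<kappa> (turn t)\<bar> < \<epsilon>" by (simp add: dist_real_def)
  qed
qed

context expanding_lift begin

definition lnD :: "complex \<Rightarrow> real" where "lnD x = ln (circle_deriv f x)"

lemma deriv_continuous: "continuous_on circle (circle_deriv f)"
  using C1 by (simp add: C1_circle_map_def)

lemma lnD_continuous: "continuous_on circle lnD"
  unfolding lnD_def[abs_def]
proof (intro continuous_on_ln deriv_continuous ballI)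
  show "circle_deriv f x \<noteq> 0" if "x \<in> circle" for x using gt1[OF that] by linarith
qed

lemma lnD_pos: "x \<in> circle \<Longrightarrow> lnD x > 0"
  unfolding lnD_def using gt1 by (simp add: ln_gt_zero)

lemma min_expansion: obtains l where "l > 1" "\<And>x. x \<in> circle \<Longrightarrow> l \<le> circle_deriv f x"
proof -
  have "circle \<noteq> {}" using turn_circle by blast
  then obtain x where "x \<in> circle" "\<And>y. y \<in> circle \<Longrightarrow> circle_deriv f x \<le> circle_deriv f y"
    using continuous_attains_inf[OF compact_sphere _ deriv_continuous] by blast
  then show ?thesis using that[of "circle_deriv f x"] gt1 by blast
qed

lemma F_isCont: "isCont F t" by (rule DERIV_isCont[OF der])

lemma F_pow_isCont: "isCont (F ^^ n) t"
proof (induction n)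
  case (Suc n)
  then show ?case using isCont_o2[OF Suc F_isCont] by (simp add: comp_def)
qed (simp add: id_def)

lemma lift_pow: "(f ^^ n) (turn t) = turn ((F ^^ n) t)"
  by (induction n) (auto simp: lift)

lemma fix_pow [simp]: "(F ^^ n) p = p" by (induction n) (auto simp: fixpt)

lemma F_pow_deriv:
  "((F ^^ n) has_real_derivative (\<Prod>j<n. circle_deriv f (turn ((F ^^ j) t)))) (at t)"
proof (induction n)
  case 0
  then show ?case by (simp add: id_def)
next
  case (Suc n)
  from DERIV_chain2[OF der Suc] show ?case by (simp add: comp_def mult.commute)
qed

lemma F_expand:
  assumes l: "l > 0" "\<And>x. x \<in> circle \<Longrightarrow> l \<le> circle_deriv f x" and st: "s \<le> t"
  shows "l ^ n * (t - s) \<le> (F ^^ n) t - (F ^^ n) s"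
proof (cases "s = t")
  case False
  then obtain z where z: "(F ^^ n) t - (F ^^ n) s = (t - s) * (\<Prod>j<n. circle_deriv f (turn ((F ^^ j) z)))"
    using MVT2[of s t "F ^^ n" "\<lambda>z. \<Prod>j<n. circle_deriv f (turn ((F ^^ j) z))"] F_pow_deriv st by force
  have "l ^ n = (\<Prod>j<n. l)" by simp
  also have "\<dots> \<le> (\<Prod>j<n. circle_deriv f (turn ((F ^^ j) z)))"
    using l by (intro prod_mono) (auto simp: less_imp_le)
  finally have "(t - s) * l ^ n \<le> (F ^^ n) t - (F ^^ n) s" unfolding z using st by (intro mult_left_mono) auto
  then show ?thesis by (simp add: mult.commute)
qed simp

lemma F_pow_mono: "s \<le> t \<Longrightarrow> (F ^^ n) s \<le> (F ^^ n) t"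
  using F_expand[of 1 s t n] gt1 by (auto simp: less_imp_le)

lemma F_pow_less: "s < t \<Longrightarrow> (F ^^ n) s < (F ^^ n) t"
  using F_expand[of 1 s t n] gt1 by (auto simp: less_imp_le)

lemma F_pow_le_iff: "(F ^^ n) s \<le> (F ^^ n) t \<longleftrightarrow> s \<le> t"
  using F_pow_mono F_pow_less by (meson not_le)

lemma F_pow_less_iff: "(F ^^ n) s < (F ^^ n) t \<longleftrightarrow> s < t"
  using F_pow_le_iff by (meson not_le)

definition deg :: nat where "deg = (SOME k. k \<ge> 2 \<and> (\<forall>t. F (t + 1) = F t + real k))"

lemma deg: "deg \<ge> 2" "F (t + 1) = F t + real deg"
proof -
  have "\<exists>k\<ge>2. \<forall>t. F (t + 1) = F t + real k"
    using lift_shift[OF C1 gt1 lift der] by metis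
  from someI_ex[OF this] show "deg \<ge> 2" "F (t + 1) = F t + real deg" unfolding deg_def by blast+
qed

lemma F_add_nat: "F (t + real i) = F t + real i * real deg"
proof (induction i)
  case (Suc i)
  have "F (t + real (Suc i)) = F ((t + real i) + 1)" by (simp only: of_nat_Suc ac_simps)
  also have "\<dots> = F t + real i * real deg + real deg" unfolding deg(2) Suc ..
  finally show ?case by (simp add: algebra_simps)
qed simp

lemma F_add_int: "F (t + of_int i) = F t + of_int i * real deg"
proof (cases "i \<ge> 0")
  case True
  then show ?thesis using F_add_nat[of t "nat i"] by simp
next
  case False
  then show ?thesis using F_add_nat[of "t + of_int i" "nat (- i)"] by simp
qed

lemma F_pow_add_int: "(F ^^ n) (t + of_int i) = (F ^^ n) t + of_int i * real deg ^ n"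
proof (induction n)
  case (Suc n)
  have "F ((F ^^ n) t + of_int (i * int deg ^ n)) = F ((F ^^ n) t) + of_int (i * int deg ^ n) * real deg"
    by (rule F_add_int)
  then show ?case using Suc by (simp add: mult.commute mult.left_commute)
qed simp

lemma deg_pow_pos: "int deg ^ n > 0" using deg(1) by simp

text \<open>
  The number $i$ of the unit interval $[p + i, p + i + 1)$ that contains the lifted $n$-th iterate. Its
  base $d$ digits, with $d$ the degree, are the itinerary for the partition into the $d$ branches of $f$.
\<close>

definition markov :: "nat \<Rightarrow> complex \<Rightarrow> int" where
  "markov n x = \<lfloor>(F ^^ n) (angle p x) - p\<rfloor>"

text \<open>
  $F^m$ maps the unit interval with number $l$ onto the $d^m$ unit intervals that start with number
  $l d^m$.
\<close>

lemma floor_lift_pow: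
  "\<lfloor>(F ^^ m) u - p\<rfloor> div int deg ^ m = \<lfloor>u - p\<rfloor>"
proof -
  let ?l = "\<lfloor>u - p\<rfloor>"
  have "p + of_int ?l \<le> u" "u < p + of_int (?l + 1)" by linarith+
  then have 1: "(F ^^ m) (p + of_int ?l) \<le> (F ^^ m) u" "(F ^^ m) u < (F ^^ m) (p + of_int (?l + 1))"
    by (auto simp only: F_pow_le_iff F_pow_less_iff)
  then have 2: "of_int (?l * int deg ^ m) \<le> (F ^^ m) u - p" "(F ^^ m) u - p < of_int ((?l + 1) * int deg ^ m)"
    unfolding F_pow_add_int by simp_all
  have 3: "?l * int deg ^ m \<le> \<lfloor>(F ^^ m) u - p\<rfloor>" using 2(1) by (simp only: le_floor_iff)
  have 4: "\<lfloor>(F ^^ m) u - p\<rfloor> < (?l + 1) * int deg ^ m" using 2(2) by (simp only: floor_less_iff)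
  show ?thesis
    using 3 4 deg_pow_pos[of m] by (intro int_div_pos_eq[where r="\<lfloor>(F ^^ m) u - p\<rfloor> - ?l * int deg ^ m"]) (auto simp: algebra_simps)
qed

lemma markov_bounds: "0 \<le> markov n x" "markov n x < int deg ^ n"
proof -
  have "markov n x div int deg ^ n = \<lfloor>angle p x - p\<rfloor>" unfolding markov_def by (rule floor_lift_pow)
  also have "\<dots> = 0" using angle_bounds[of p x] by (simp add: floor_eq_iff)
  finally have "markov n x div int deg ^ n = 0" .
  then show "0 \<le> markov n x" "markov n x < int deg ^ n"
    using deg_pow_pos[of n] unfolding zdiv_eq_0_iff by linarith+
qed

lemma markov_turn: "p \<le> t \<Longrightarrow> t < p + 1 \<Longrightarrow> markov n (turn t) = \<lfloor>(F ^^ n) t - p\<rfloor>"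
  by (simp add: markov_def angle_turn)

text \<open>
  Passing to $f^j(x)$ drops the first $j$ digits: the number is first cut down to its $N + j$ leading
  digits, and the $j$ leading ones are subtracted.
\<close>

lemma markov_orbit:
  assumes x: "x \<in> circle" and j: "j \<le> n"
  shows "markov N ((f ^^ j) x) =
    markov (N + n) x div int deg ^ (n - j) - markov (N + n) x div int deg ^ (N + n - j) * int deg ^ N"
proof -
  obtain t where t: "p \<le> t" "t < p + 1" "x = turn t" using circleE[OF x] by metis
  let ?l = "\<lfloor>(F ^^ j) t - p\<rfloor>"
  let ?s = "(F ^^ j) t - of_int ?l"
  have s: "p \<le> ?s" "?s < p + 1" by linarith+
  have "(f ^^ j) x = turn ?s" unfolding t(3) lift_pow using turn_plus_int[of ?s ?l] by simp
  then have "markov N ((f ^^ j) x) = \<lfloor>(F ^^ N) ?s - p\<rfloor>" using markov_turn[OF s] by simp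
  also have "(F ^^ N) ?s = (F ^^ (N + j)) t - of_int (?l * int deg ^ N)"
    using F_pow_add_int[of N "(F ^^ j) t" "- ?l"] by (simp add: funpow_add)
  also have "\<lfloor>(F ^^ (N + j)) t - of_int (?l * int deg ^ N) - p\<rfloor> = \<lfloor>(F ^^ (N + j)) t - p - of_int (?l * int deg ^ N)\<rfloor>"
    by (simp only: algebra_simps)
  also have "\<dots> = \<lfloor>(F ^^ (N + j)) t - p\<rfloor> - ?l * int deg ^ N"
    by (rule floor_diff_of_int)
  also have "\<lfloor>(F ^^ (N + j)) t - p\<rfloor> = markov (N + n) x div int deg ^ (n - j)"
    using floor_lift_pow[of "n - j" "(F ^^ (N + j)) t"] j t markov_turn[OF t(1,2), of "N + n"]
      funpow_add[of "n - j" "N + j" F] by (simp add: add.commute[of N n])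
  also have "?l = markov (N + n) x div int deg ^ (N + n - j)"
    using floor_lift_pow[of "N + n - j" "(F ^^ j) t"] j t markov_turn[OF t(1,2), of "N + n"]
      funpow_add[of "N + n - j" j F] by simp
  finally show ?thesis .
qed

lemma markov_measurable: "markov n \<in> measurable circle_borel (count_space UNIV)"
proof -
  have [measurable]: "F ^^ n \<in> borel_measurable borel"
    by (intro borel_measurable_continuous_onI continuous_at_imp_continuous_on ballI F_pow_isCont)
  show ?thesis unfolding markov_def[abs_def] by (rule circle_measurableI) measurable
qed

lemma markov_simple:
  assumes "sets M = sets circle_borel" "space M = circle"
  shows "simple_function M (markov n)"
  unfolding simple_function_def
proof
  have "markov n ` space M \<subseteq> {0..<int deg ^ n}" using markov_bounds by auto
  then show "finite (markov n ` space M)" by (rule finite_subset) simp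
  show "\<forall>x\<in>markov n ` space M. markov n -` {x} \<inter> space M \<in> sets M"
    using measurable_sets[OF markov_measurable] assms by simp
qed

text \<open>
  The cell is an arc $[a, b)$ of the angle, and $F^n$ maps it onto a unit interval.
\<close>

lemma markov_cell:
  assumes x: "x \<in> circle"
  obtains a b t where "a \<le> t" "t < b" "x = turn t" "(F ^^ n) b = (F ^^ n) a + 1"
    "label_prob circle_lebesgue (markov n) (markov n x) = b - a"
    "\<And>y. y \<in> circle \<Longrightarrow> markov n y = markov n x \<Longrightarrow> \<exists>s. a \<le> s \<and> s < b \<and> y = turn s"
proof -
  interpret m: prob_space circle_lebesgue by (rule prob_space_circle_lebesgue)
  obtain t where t: "p \<le> t" "t < p + 1" "x = turn t" using circleE[OF x] by metis
  let ?i = "markov n x"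
  have i: "?i = \<lfloor>(F ^^ n) t - p\<rfloor>" using t markov_turn by simp
  have top: "(F ^^ n) (p + 1) = p + of_int (int deg ^ n)" using F_pow_add_int[of n p 1] by simp
  have cont: "continuous_on {p..p+1} (F ^^ n)" by (intro continuous_at_imp_continuous_on ballI F_pow_isCont)
  have ex: "\<exists>a\<ge>p. a \<le> p + 1 \<and> (F ^^ n) a = p + of_int z" if "0 \<le> z" "z \<le> int deg ^ n" for z
  proof -
    have "real_of_int z \<le> of_int (int deg ^ n)" using that by (simp only: of_int_le_iff)
    then show ?thesis
      using IVT'[of "F ^^ n" p "p + of_int z" "p + 1", OF _ _ _ cont] that unfolding top by auto
  qed
  obtain a where a: "p \<le> a" "(F ^^ n) a = p + of_int ?i" using ex[of ?i] markov_bounds[of n x] by auto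
  obtain b where b: "b \<le> p + 1" "(F ^^ n) b = p + of_int (?i + 1)" using ex[of "?i + 1"] markov_bounds[of n x] by auto
  have cell: "markov n (turn s) = ?i \<longleftrightarrow> a \<le> s \<and> s < b" if "p \<le> s" "s < p + 1" for s
  proof -
    have "markov n (turn s) = ?i \<longleftrightarrow> p + of_int ?i \<le> (F ^^ n) s \<and> (F ^^ n) s < p + of_int (?i + 1)"
      unfolding markov_turn[OF that] floor_eq_iff by auto
    also have "\<dots> \<longleftrightarrow> a \<le> s \<and> s < b" unfolding a(2)[symmetric] b(2)[symmetric] F_pow_le_iff F_pow_less_iff ..
    finally show ?thesis .
  qed
  have ab: "a \<le> t" "t < b" using cell[OF t(1,2)] t(3) by auto
  have S: "markov n -` {?i} \<inter> circle \<in> sets circle_borel"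
    using measurable_sets[OF markov_measurable, of "{?i}" n] by simp
  have "emeasure circle_lebesgue (markov n -` {?i} \<inter> circle) = emeasure lborel ({p..<p+1} \<inter> turn -` (markov n -` {?i} \<inter> circle))"
    by (rule emeasure_circle_lebesgue[OF S])
  also have "{p..<p+1} \<inter> turn -` (markov n -` {?i} \<inter> circle) = {a..<b}"
    using cell a b by (auto simp del: mem_sphere)
  also have "emeasure lborel {a..<b} = ennreal (b - a)" using ab by simp
  finally have m: "label_prob circle_lebesgue (markov n) ?i = b - a"
    unfolding label_prob_def using ab by (simp add: measure_def)
  show ?thesis
  proof (rule that[OF ab t(3) _ m])
    show "(F ^^ n) b = (F ^^ n) a + 1" using a b by simp
    fix y assume y: "y \<in> circle" "markov n y = ?i"
    obtain s where s: "p \<le> s" "s < p + 1" "y = turn s" using circleE[OF y(1)] by metis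
    then show "\<exists>s. a \<le> s \<and> s < b \<and> y = turn s" using cell[OF s(1,2)] y by auto
  qed
qed

lemma markov_cell_diameter:
  assumes l: "l > 0" "\<And>x. x \<in> circle \<Longrightarrow> l \<le> circle_deriv f x"
    and "x \<in> circle" "y \<in> circle" "markov n x = markov n y"
  shows "dist x y \<le> 2 * pi / l ^ n"
proof -
  obtain a b t where ab: "a \<le> t" "t < b" "x = turn t" "(F ^^ n) b = (F ^^ n) a + 1"
    "\<And>y. y \<in> circle \<Longrightarrow> markov n y = markov n x \<Longrightarrow> \<exists>s. a \<le> s \<and> s < b \<and> y = turn s"
    using markov_cell[OF assms(3), of n] by metis
  obtain s where s: "a \<le> s" "s < b" "y = turn s" using ab(5)[OF assms(4)] assms(5) by auto
  have "l ^ n * (b - a) \<le> 1" using F_expand[OF l, of a b n] ab by simp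
  then have "b - a \<le> 1 / l ^ n" using l by (simp add: field_simps)
  then have "\<bar>t - s\<bar> \<le> 1 / l ^ n" using s ab by linarith
  then have "2 * pi * \<bar>t - s\<bar> \<le> 2 * pi * (1 / l ^ n)" by (intro mult_left_mono) auto
  then show ?thesis using dist_turn_le[of t s] unfolding ab s by simp
qed

text \<open>
  By the mean value theorem the arc has length $1 / (F^n)'(z)$ for some $z$ in it. The $j$-th iterates of
  $z$ and $x$ are at distance at most $l^{-(n-j)}$, where $l > 1$ bounds the derivative from below: all but
  the last $J$ terms of the two sums of $\log f'$ differ by at most $\epsilon$, with $J$ independent of $n$.
\<close>

lemma markov_cell_volume:
  assumes \<epsilon>: "\<epsilon> > 0"
  obtains C where "\<And>n x. x \<in> circle \<Longrightarrow> label_prob circle_lebesgue (markov n) (markov n x) > 0 \<and>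
    - ln (label_prob circle_lebesgue (markov n) (markov n x)) \<le> (\<Sum>j<n. lnD ((f ^^ j) x)) + real n * \<epsilon> + C"
proof -
  obtain l where l: "l > 1" "\<And>x. x \<in> circle \<Longrightarrow> l \<le> circle_deriv f x" using min_expansion by blast
  obtain B where B: "B \<ge> 0" "\<And>x. x \<in> circle \<Longrightarrow> \<bar>lnD x\<bar> \<le> B" using continuous_bounded_circle[OF lnD_continuous] by metis
  obtain \<delta> where \<delta>: "\<delta> > 0" "\<And>s t. \<bar>s - t\<bar> \<le> \<delta> \<Longrightarrow> \<bar>lnD (turn s) - lnD (turn t)\<bar> < \<epsilon>"
    using uniformly_continuous_turn[OF lnD_continuous \<epsilon>] by blast
  obtain J where J: "1 / \<delta> < l ^ J" using real_arch_pow[OF l(1)] by blast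
  show ?thesis
  proof (rule that[of "2 * B * real J"])
    fix n x assume x: "x \<in> circle"
    obtain a b t where ab: "a \<le> t" "t < b" "x = turn t" "(F ^^ n) b = (F ^^ n) a + 1"
      "label_prob circle_lebesgue (markov n) (markov n x) = b - a"
      using markov_cell[OF x, of n] by metis
    have "\<exists>z>a. z < b \<and> (F ^^ n) b - (F ^^ n) a = (b - a) * (\<Prod>j<n. circle_deriv f (turn ((F ^^ j) z)))"
      using ab by (intro MVT2) (auto intro: F_pow_deriv)
    then obtain z where z: "a < z" "z < b" "1 = (b - a) * (\<Prod>j<n. circle_deriv f (turn ((F ^^ j) z)))"
      using ab(4) by auto
    have pos: "circle_deriv f (turn u) > 0" for u using gt1[OF turn_circle, of u] by linarith
    define P where "P = (\<Prod>j<n. circle_deriv f (turn ((F ^^ j) z)))"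
    have P: "P > 0" unfolding P_def by (intro prod_pos pos)
    have "b - a = inverse P" using z(3) P unfolding P_def[symmetric] by (intro inverse_unique[symmetric]) (simp add: mult.commute)
    then have "- ln (b - a) = ln P" using P by (simp add: ln_inverse)
    also have "ln P = ln (\<Prod>j<n. circle_deriv f (turn ((F ^^ j) z)))" by (simp only: P_def)
    also have "\<dots> = (\<Sum>j<n. lnD (turn ((F ^^ j) z)))"
      unfolding lnD_def using pos by (subst ln_prod) (auto simp: less_imp_neq[symmetric])
    also have "\<dots> \<le> (\<Sum>j<n. lnD ((f ^^ j) x) + (\<epsilon> + (if n < j + J then 2 * B else 0)))"
    proof (rule sum_mono)
      fix j assume "j \<in> {..<n}"
      then have j: "j < n" by simp
      have fx: "(f ^^ j) x = turn ((F ^^ j) t)" unfolding ab(3) by (rule lift_pow)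
      show "lnD (turn ((F ^^ j) z)) \<le> lnD ((f ^^ j) x) + (\<epsilon> + (if n < j + J then 2 * B else 0))"
      proof (cases "n < j + J")
        case True
        then show ?thesis using B(2)[of "turn ((F ^^ j) z)"] B(2)[of "(f ^^ j) x"] \<epsilon> funpow_circle[OF C1 x, of j]
          by (simp add: abs_le_iff)
      next
        case False
        have key: "l ^ (n - j) * \<bar>u - v\<bar> \<le> 1"
          if uv: "u = (F ^^ j) u'" "v = (F ^^ j) v'" "a \<le> u'" "u' < b" "a \<le> v'" "v' < b" "v \<le> u" for u v u' v'
        proof -
          have "l ^ (n - j) * (u - v) \<le> (F ^^ (n - j)) u - (F ^^ (n - j)) v"
            using F_expand[of l v u "n - j"] l uv by auto
          also have "\<dots> = (F ^^ n) u' - (F ^^ n) v'"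
            using funpow_add[of "n - j" j F] j uv by simp
          also have "\<dots> \<le> (F ^^ n) b - (F ^^ n) a"
            using uv by (intro diff_mono F_pow_mono) auto
          finally show ?thesis using ab(4) uv by simp
        qed
        have k: "l ^ (n - j) * \<bar>(F ^^ j) z - (F ^^ j) t\<bar> \<le> 1"
          using key[of "(F ^^ j) z" z "(F ^^ j) t" t] key[of "(F ^^ j) t" t "(F ^^ j) z" z] z ab
          by (cases "(F ^^ j) t \<le> (F ^^ j) z") (auto simp: abs_minus_commute)
        have "l ^ J \<le> l ^ (n - j)" using False l by (intro power_increasing) auto
        then have "1 / \<delta> \<le> l ^ (n - j)" using J by linarith
        then have "1 / \<delta> * \<bar>(F ^^ j) z - (F ^^ j) t\<bar> \<le> l ^ (n - j) * \<bar>(F ^^ j) z - (F ^^ j) t\<bar>"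
          by (intro mult_right_mono) auto
        from order_trans[OF this k] have "\<bar>(F ^^ j) z - (F ^^ j) t\<bar> \<le> \<delta>" using \<delta>(1) by (simp add: divide_le_eq)
        from \<delta>(2)[OF this] have "lnD (turn ((F ^^ j) z)) \<le> lnD ((f ^^ j) x) + \<epsilon>" unfolding fx by linarith
        then show ?thesis using False by (simp only: if_False add_0_right)
      qed
    qed
    also have "\<dots> = (\<Sum>j<n. lnD ((f ^^ j) x)) + (real n * \<epsilon> + (\<Sum>j<n. if n < j + J then 2 * B else 0))"
      by (simp add: sum.distrib)
    also have "(\<Sum>j<n. if n < j + J then 2 * B else 0) \<le> 2 * B * real J"
    proof -
      have "(\<Sum>j<n. if n < j + J then 2 * B else 0) = real (card ({..<n} \<inter> {j. n < j + J})) * (2 * B)"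
        by (simp add: sum.If_cases)
      also have "\<dots> \<le> real J * (2 * B)"
      proof (rule mult_right_mono)
        have "{..<n} \<inter> {j. n < j + J} \<subseteq> {n - J..<n}" by auto
        then have "card ({..<n} \<inter> {j. n < j + J}) \<le> card {n - J..<n}" by (intro card_mono) auto
        then show "real (card ({..<n} \<inter> {j. n < j + J})) \<le> real J" by simp
      qed (use B in simp)
      finally show ?thesis by (simp add: mult.commute)
    qed
    finally show "label_prob circle_lebesgue (markov n) (markov n x) > 0 \<and>
      - ln (label_prob circle_lebesgue (markov n) (markov n x)) \<le> (\<Sum>j<n. lnD ((f ^^ j) x)) + real n * \<epsilon> + 2 * B * real J"
      using ab by auto
  qed
qed

end

section \<open>Entropy is at most the exponent\<close>

lemma label_prob_cong: "(\<And>x. x \<in> space M \<Longrightarrow> X x = Y x) \<Longrightarrow> label_prob M X = label_prob M Y"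
  unfolding label_prob_def by (intro ext arg_cong[where f="measure M"]) auto

lemma integral_invariant:
  fixes g :: "'a \<Rightarrow> real"
  assumes "T \<in> measurable M M" "distr M M T = M" "g \<in> borel_measurable M"
  shows "(\<integral>x. g (T x) \<partial>M) = (\<integral>x. g x \<partial>M)"
  using integral_distr[OF assms(1), of g] assms by simp

lemma sum_lists_prod:
  fixes g :: "nat \<Rightarrow> 'b \<Rightarrow> real"
  assumes "finite A"
  shows "(\<Sum>v\<in>{v. set v \<subseteq> A \<and> length v = n}. \<Prod>j<n. g j (v ! j)) = (\<Prod>j<n. \<Sum>u\<in>A. g j u)"
proof (induction n arbitrary: g)
  case 0
  have "{v. set v \<subseteq> A \<and> length v = 0} = {[]}" by auto
  then show ?case by simp
next
  case (Suc n)
  let ?L = "{v. set v \<subseteq> A \<and> length v = n}"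
  have inj: "inj_on (\<lambda>(xs, x). x # xs) (?L \<times> A)" by (auto simp: inj_on_def)
  have "(\<Sum>v\<in>{v. set v \<subseteq> A \<and> length v = Suc n}. \<Prod>j<Suc n. g j (v ! j))
      = (\<Sum>(v,u)\<in>?L \<times> A. \<Prod>j<Suc n. g j ((u # v) ! j))"
    unfolding lists_length_Suc_eq by (subst sum.reindex[OF inj]) (simp add: case_prod_unfold comp_def)
  also have "\<dots> = (\<Sum>v\<in>?L. \<Sum>u\<in>A. g 0 u * (\<Prod>j<n. g (Suc j) (v ! j)))"
    by (simp add: sum.cartesian_product[symmetric] prod.lessThan_Suc_shift del: prod.lessThan_Suc)
  also have "\<dots> = (\<Sum>u\<in>A. g 0 u) * (\<Sum>v\<in>?L. \<Prod>j<n. g (Suc j) (v ! j))"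
    by (simp add: sum_distrib_right[symmetric] sum_distrib_left[symmetric])
  also have "\<dots> = (\<Prod>j<Suc n. \<Sum>u\<in>A. g j u)"
    using Suc[of "\<lambda>j. g (Suc j)"] by (simp add: prod.lessThan_Suc_shift del: prod.lessThan_Suc)
  finally show ?case .
qed

text \<open>
  With $t = r / P$ these bound $P \, t \ln(1/t)$: the first upper bound is good for $t$ near $1$, the second
  for $t$ near $0$.
\<close>

lemma entropy_term_bounds:
  fixes r P :: real
  assumes "0 \<le> r" "r \<le> P"
  shows "0 \<le> - ln (r / P) * r" "- ln (r / P) * r \<le> P - r" "- ln (r / P) * r \<le> 2 * sqrt (r * P)"
proof -
  have "0 \<le> - ln (r / P) * r \<and> - ln (r / P) * r \<le> P - r \<and> - ln (r / P) * r \<le> 2 * sqrt (r * P)"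
  proof (cases "r = 0")
    case False
    then have r: "r > 0" and P: "P > 0" using assms by auto
    have e: "- ln (r / P) = ln (P / r)" using r P by (simp add: ln_div)
    have "ln (P / r) \<ge> 0" using r P assms by simp
    moreover have "ln (P / r) * r \<le> P - r"
      using mult_right_mono[OF ln_le_minus_one[of "P / r"], of r] r P by (simp add: algebra_simps)
    moreover have "ln (P / r) * r \<le> 2 * sqrt (r * P)"
    proof -
      have "ln (P / r) = 2 * ln (sqrt (P / r))" using r P by (simp add: ln_sqrt)
      also have "\<dots> \<le> 2 * sqrt (P / r)" using ln_le_minus_one[of "sqrt (P / r)"] r P by simp
      finally have "ln (P / r) * r \<le> (2 * sqrt (P / r)) * r" using r by (intro mult_right_mono) auto
      then have "ln (P / r) * r \<le> 2 * (sqrt (P / r) * r)" by (simp only: mult.assoc)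
      also have "sqrt (P / r) * r = sqrt (r * P)"
      proof -
        have "sqrt (P / r) * r = sqrt (P / r) * sqrt (r\<^sup>2)" using r by simp
        also have "\<dots> = sqrt (P / r * r\<^sup>2)" by (simp only: real_sqrt_mult)
        also have "P / r * r\<^sup>2 = r * P" using r by (simp add: power2_eq_square)
        finally show ?thesis .
      qed
      finally show ?thesis .
    qed
    ultimately show ?thesis unfolding e using r by simp
  qed (use assms in simp)
  then show "0 \<le> - ln (r / P) * r" "- ln (r / P) * r \<le> P - r" "- ln (r / P) * r \<le> 2 * sqrt (r * P)" by auto
qed

text \<open>
  The value is $0$ where $y$ has probability $0$, so that it is a subprobability in $u$ for every $y$.
\<close>

definition cond_label_prob :: "'a measure \<Rightarrow> ('a \<Rightarrow> 'b) \<Rightarrow> ('a \<Rightarrow> 'c) \<Rightarrow> 'b \<Rightarrow> 'c \<Rightarrow> real" where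
  "cond_label_prob M X Y u y = label_prob M (\<lambda>\<omega>. (X \<omega>, Y \<omega>)) (u, y) / label_prob M Y y"

lemma cond_label_prob_nonneg [simp]: "cond_label_prob M X Y u y \<ge> 0"
  by (simp add: cond_label_prob_def)

context prob_space begin

lemma sum_prob_fibres:
  assumes Y: "simple_function M Y" and S: "finite S" and A: "A \<in> sets M"
  shows "(\<Sum>y\<in>S. prob (Y -` {y} \<inter> space M \<inter> A)) = prob (Y -` S \<inter> space M \<inter> A)"
proof -
  have "prob (\<Union>y\<in>S. Y -` {y} \<inter> space M \<inter> A) = (\<Sum>y\<in>S. prob (Y -` {y} \<inter> space M \<inter> A))"
    using S A simple_functionD(2)[OF Y] by (intro finite_measure_finite_Union) (auto simp: disjoint_family_on_def)
  moreover have "(\<Union>y\<in>S. Y -` {y} \<inter> space M \<inter> A) = Y -` S \<inter> space M \<inter> A" by auto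
  ultimately show ?thesis by simp
qed

lemma label_prob_pair: "label_prob M (\<lambda>\<omega>. (X \<omega>, Y \<omega>)) (u, y) = prob (Y -` {y} \<inter> space M \<inter> (X -` {u} \<inter> space M))"
  unfolding label_prob_def by (rule arg_cong[where f=prob]) auto

lemma label_prob_pair_le:
  assumes "simple_function M X" "simple_function M Y"
  shows "label_prob M (\<lambda>\<omega>. (X \<omega>, Y \<omega>)) (u, y) \<le> label_prob M Y y"
  using label_prob_le_image[OF simple_function_Pair[OF assms], of "(u, y)" snd] by simp

lemma sum_label_prob_pair:
  assumes X: "simple_function M X" and Y: "simple_function M Y"
  shows "(\<Sum>u\<in>X ` space M. label_prob M (\<lambda>\<omega>. (X \<omega>, Y \<omega>)) (u, y)) = label_prob M Y y"
proof -
  have "(\<Sum>u\<in>X ` space M. label_prob M (\<lambda>\<omega>. (X \<omega>, Y \<omega>)) (u, y))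
      = (\<Sum>u\<in>X ` space M. prob (X -` {u} \<inter> space M \<inter> (Y -` {y} \<inter> space M)))"
    unfolding label_prob_pair by (simp only: Int_commute)
  also have "\<dots> = prob (X -` (X ` space M) \<inter> space M \<inter> (Y -` {y} \<inter> space M))"
    using X by (intro sum_prob_fibres simple_functionD[OF Y]) (auto simp: simple_function_def)
  also have "X -` (X ` space M) \<inter> space M \<inter> (Y -` {y} \<inter> space M) = Y -` {y} \<inter> space M" by auto
  finally show ?thesis by (simp add: label_prob_def)
qed

lemma sum_cond_label_prob_le:
  assumes X: "simple_function M X" and Y: "simple_function M Y"
  shows "(\<Sum>u\<in>X ` space M. cond_label_prob M X Y u y) \<le> 1"
  using sum_label_prob_pair[OF X Y, of y] unfolding cond_label_prob_def by (simp add: sum_divide_distrib[symmetric])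

text \<open>
  If each event $X = u$ is nearly the event $Y \in H_u$, then $Y$ nearly determines $X$. For $y \in H_u$ the
  conditional probability of $u$ should be near $1$, otherwise near $0$; the two bounds of
  \<open>entropy_term_bounds\<close> are used accordingly, the square roots being summed by Cauchy--Schwarz.
\<close>

lemma conditional_entropy_le:
  assumes X: "simple_function M X" and Y: "simple_function M Y"
  shows "(\<integral>\<omega>. - ln (cond_label_prob M X Y (X \<omega>) (Y \<omega>)) \<partial>M)
    \<le> (\<Sum>u\<in>X ` space M. prob (Y -` H u \<inter> space M - X -` {u}) + 2 * sqrt (prob (X -` {u} \<inter> space M - Y -` H u)))"
proof -
  let ?W = "\<lambda>\<omega>. (X \<omega>, Y \<omega>)"
  let ?p = "\<lambda>u y. label_prob M ?W (u, y)" and ?P = "label_prob M Y"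
  let ?g = "\<lambda>u y. - ln (?p u y / ?P y) * ?p u y"
  have W: "simple_function M ?W" by (rule simple_function_Pair[OF X Y])
  have fX: "finite (X ` space M)" and fY: "finite (Y ` space M)" using X Y by (auto simp: simple_function_def)
  have b: "0 \<le> ?g u y" "?g u y \<le> ?P y - ?p u y" "?g u y \<le> 2 * sqrt (?p u y * ?P y)" for u y
    by (intro entropy_term_bounds label_prob_pair_le[OF X Y] label_prob_nonneg)+
  have Xs: "X -` {u} \<inter> space M \<in> sets M" for u by (rule simple_functionD[OF X])
  have "(\<integral>\<omega>. - ln (cond_label_prob M X Y (X \<omega>) (Y \<omega>)) \<partial>M) = (\<Sum>w\<in>?W ` space M. ?g (fst w) (snd w))"
    using integral_label[OF W, of "\<lambda>w. - ln (cond_label_prob M X Y (fst w) (snd w))"] by (simp add: cond_label_prob_def)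
  also have "\<dots> \<le> (\<Sum>w\<in>X ` space M \<times> Y ` space M. ?g (fst w) (snd w))"
    by (intro sum_mono2 finite_cartesian_product fX fY b) auto
  also have "\<dots> = (\<Sum>u\<in>X ` space M. \<Sum>y\<in>Y ` space M. ?g u y)"
    by (simp add: sum.cartesian_product case_prod_unfold)
  also have "\<dots> \<le> (\<Sum>u\<in>X ` space M. prob (Y -` H u \<inter> space M - X -` {u}) + 2 * sqrt (prob (X -` {u} \<inter> space M - Y -` H u)))"
  proof (rule sum_mono)
    fix u
    let ?S = "Y ` space M \<inter> H u" and ?T = "Y ` space M - H u"
    have "(\<Sum>y\<in>Y ` space M. ?g u y) = (\<Sum>y\<in>?S. ?g u y) + (\<Sum>y\<in>?T. ?g u y)"
      using sum.Int_Diff[OF fY, of "?g u" "H u"] by simp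
    also have "(\<Sum>y\<in>?S. ?g u y) \<le> (\<Sum>y\<in>?S. ?P y - ?p u y)" by (intro sum_mono b)
    also have "\<dots> = (\<Sum>y\<in>?S. prob (Y -` {y} \<inter> space M \<inter> (space M - X -` {u})))"
    proof (rule sum.cong[OF refl])
      fix y
      have "?P y - ?p u y = prob (Y -` {y} \<inter> space M - Y -` {y} \<inter> space M \<inter> (X -` {u} \<inter> space M))"
        unfolding label_prob_pair unfolding label_prob_def
        using simple_functionD(2)[OF Y] Xs by (intro finite_measure_Diff[symmetric]) auto
      also have "Y -` {y} \<inter> space M - Y -` {y} \<inter> space M \<inter> (X -` {u} \<inter> space M) = Y -` {y} \<inter> space M \<inter> (space M - X -` {u})"
        by auto
      finally show "?P y - ?p u y = prob (Y -` {y} \<inter> space M \<inter> (space M - X -` {u}))" .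
    qed
    also have "\<dots> = prob (Y -` ?S \<inter> space M \<inter> (space M - X -` {u}))"
    proof (rule sum_prob_fibres[OF Y])
      have "space M - X -` {u} = space M - X -` {u} \<inter> space M" by auto
      then show "space M - X -` {u} \<in> events" using Xs[of u] by auto
    qed (use fY in auto)
    also have "Y -` ?S \<inter> space M \<inter> (space M - X -` {u}) = Y -` H u \<inter> space M - X -` {u}" by auto
    also have "(\<Sum>y\<in>?T. ?g u y) \<le> 2 * (\<Sum>y\<in>?T. sqrt (?p u y) * sqrt (?P y))"
      unfolding sum_distrib_left using b by (intro sum_mono) (simp add: real_sqrt_mult)
    also have "(\<Sum>y\<in>?T. sqrt (?p u y) * sqrt (?P y)) \<le> sqrt ((\<Sum>y\<in>?T. ?p u y) * (\<Sum>y\<in>?T. ?P y))"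
      using Cauchy_Schwarz_ineq_sum[of "\<lambda>y. sqrt (?p u y)" "\<lambda>y. sqrt (?P y)" ?T]
      by (intro real_le_rsqrt) simp
    also have "\<dots> \<le> sqrt ((\<Sum>y\<in>?T. ?p u y) * 1)"
    proof (intro real_sqrt_le_mono mult_left_mono)
      have "(\<Sum>y\<in>?T. ?P y) \<le> (\<Sum>y\<in>Y ` space M. ?P y)" by (intro sum_mono2 fY) auto
      then show "(\<Sum>y\<in>?T. ?P y) \<le> 1" by (simp add: sum_label_prob[OF Y])
    qed (simp add: sum_nonneg)
    also have "(\<Sum>y\<in>?T. ?p u y) = prob (Y -` ?T \<inter> space M \<inter> (X -` {u} \<inter> space M))"
      unfolding label_prob_pair by (intro sum_prob_fibres[OF Y] Xs) (use fY in auto)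
    also have "Y -` ?T \<inter> space M \<inter> (X -` {u} \<inter> space M) = X -` {u} \<inter> space M - Y -` H u" by auto
    finally show "(\<Sum>y\<in>Y ` space M. ?g u y) \<le> prob (Y -` H u \<inter> space M - X -` {u}) + 2 * sqrt (prob (X -` {u} \<inter> space M - Y -` H u))"
      by simp
  qed
  finally show ?thesis .
qed

text \<open>
  Gibbs' inequality for the weight $w(z) \prod_j P(v_j \mid y_j)$ on pairs of an itinerary $v$ and a value
  $z$ of $Z$, where $y_j$ is the value of $Y$ at time $j$. It is a subprobability as $z$ determines all $y_j$,
  and by invariance each factor has the same mean logarithm.
\<close>

lemma label_entropy_itinerary_le_factor:
  assumes f: "f \<in> measurable M M" "distr M M f = M" and a: "simple_function M a"
    and Z: "simple_function M Z" and Y: "simple_function M Y"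
    and factor: "\<And>j x. j < n \<Longrightarrow> x \<in> space M \<Longrightarrow> Y ((f ^^ j) x) = yf j (Z x)"
    and w: "\<And>z. z \<in> Z ` space M \<Longrightarrow> w z > 0" "(\<Sum>z\<in>Z ` space M. w z) \<le> 1"
  shows "label_entropy M (itinerary a f n)
    \<le> (\<integral>x. - ln (w (Z x)) \<partial>M) + real n * (\<integral>x. - ln (cond_label_prob M a Y (a x) (Y x)) \<partial>M)"
proof -
  let ?I = "itinerary a f n" and ?r = "cond_label_prob M a Y"
  let ?W = "\<lambda>x. (?I x, Z x)"
  define q where "q vz = w (snd vz) * (\<Prod>j<n. ?r (fst vz ! j) (yf j (snd vz)))" for vz
  have I: "simple_function M ?I" by (intro simple_function_itinerary a f)
  have W: "simple_function M ?W" by (rule simple_function_Pair[OF I Z])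
  have aY: "simple_function M (\<lambda>x. (a x, Y x))" by (rule simple_function_Pair[OF a Y])
  have fin: "finite (a ` space M)" "finite (Z ` space M)" using a Z by (auto simp: simple_function_def)
  have fj: "f ^^ j \<in> measurable M M" "distr M M (f ^^ j) = M" for j
    using funpow_measurable[OF f(1)] distr_funpow[OF f] by auto
  have rpos: "?r (fst vz ! j) (yf j (snd vz)) > 0" if p: "label_prob M ?W vz > 0" and j: "j < n" for vz j
  proof -
    let ?h = "\<lambda>vz. (fst vz ! j, yf j (snd vz))"
    have "label_prob M ?W vz \<le> label_prob M (\<lambda>x. ?h (?W x)) (?h vz)" by (rule label_prob_le_image[OF W])
    also have "label_prob M (\<lambda>x. ?h (?W x)) = label_prob M (\<lambda>x. (a ((f ^^ j) x), Y ((f ^^ j) x)))"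
      by (rule label_prob_cong) (simp add: itinerary_nth j factor)
    also have "\<dots> (?h vz) = label_prob M (\<lambda>x. (a x, Y x)) (?h vz)"
      by (rule label_prob_invariant[OF fj aY])
    finally have "label_prob M (\<lambda>x. (a x, Y x)) (?h vz) > 0" using p by linarith
    moreover from this have "label_prob M Y (yf j (snd vz)) > 0"
      using label_prob_pair_le[OF a Y, of "fst vz ! j" "yf j (snd vz)"] by linarith
    ultimately show ?thesis by (simp add: cond_label_prob_def)
  qed
  have "label_entropy M (\<lambda>x. fst (?W x)) \<le> (\<integral>x. - ln (q (?W x)) \<partial>M)"
  proof (rule gibbs_inequality[OF W])
    show "q vz \<ge> 0" if "vz \<in> ?W ` space M" for vz
      using that w(1) unfolding q_def by (auto intro!: mult_nonneg_nonneg prod_nonneg simp: less_imp_le)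
    show "q vz > 0" if "vz \<in> ?W ` space M" "label_prob M ?W vz > 0" for vz
      using that w(1) rpos[OF that(2)] unfolding q_def by (auto intro!: mult_pos_pos prod_pos)
    let ?L = "{v. set v \<subseteq> a ` space M \<and> length v = n}"
    have "set (?I x) \<subseteq> a ` space M" if "x \<in> space M" for x
      using that measurable_space[OF fj(1)] by (auto simp: itinerary_def)
    then have sub: "?W ` space M \<subseteq> ?L \<times> Z ` space M" by auto
    have "(\<Sum>vz\<in>?W ` space M. q vz) \<le> (\<Sum>vz\<in>?L \<times> Z ` space M. q vz)"
      using fin sub w(1) unfolding q_def
      by (intro sum_mono2 finite_cartesian_product finite_lists_length_eq)
         (auto intro!: mult_nonneg_nonneg prod_nonneg simp: less_imp_le)
    also have "\<dots> = (\<Sum>v\<in>?L. \<Sum>z\<in>Z ` space M. q (v, z))"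
      by (simp add: sum.cartesian_product case_prod_unfold)
    also have "\<dots> = (\<Sum>z\<in>Z ` space M. w z * (\<Sum>v\<in>?L. \<Prod>j<n. ?r (v ! j) (yf j z)))"
      by (subst sum.swap) (simp add: q_def sum_distrib_left)
    also have "\<dots> = (\<Sum>z\<in>Z ` space M. w z * (\<Prod>j<n. \<Sum>u\<in>a ` space M. ?r u (yf j z)))"
      by (simp add: sum_lists_prod[OF fin(1), of "\<lambda>j u. ?r u (yf j _)"])
    also have "\<dots> \<le> (\<Sum>z\<in>Z ` space M. w z * 1)"
    proof (intro sum_mono mult_left_mono)
      show "(\<Prod>j<n. \<Sum>u\<in>a ` space M. ?r u (yf j z)) \<le> 1" for z
        by (intro prod_le_1) (auto intro: sum_nonneg sum_cond_label_prob_le[OF a Y])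
    qed (use w(1) in \<open>auto simp: less_imp_le\<close>)
    finally show "(\<Sum>vz\<in>?W ` space M. q vz) \<le> 1" using w(2) by simp
  qed
  also have "(\<integral>x. - ln (q (?W x)) \<partial>M)
     = (\<integral>x. - ln (w (Z x)) + (\<Sum>j<n. - ln (?r (a ((f ^^ j) x)) (Y ((f ^^ j) x)))) \<partial>M)"
  proof (rule integral_cong_AE)
    show "(\<lambda>x. - ln (q (?W x))) \<in> borel_measurable M"
      using integrable_label[OF W, of "\<lambda>w. - ln (q w)"] by simp
    have 1: "(\<lambda>x. - ln (w (Z x))) \<in> borel_measurable M"
      using integrable_label[OF Z, of "\<lambda>w'. - ln (w w')"] by simp
    have 2: "(\<lambda>x. - ln (?r (a ((f ^^ j) x)) (Y ((f ^^ j) x)))) \<in> borel_measurable M" for j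
      using integrable_label[OF simple_function_comp[OF fj(1) aY], of "\<lambda>uy. - ln (?r (fst uy) (snd uy))" j] by simp
    show "(\<lambda>x. - ln (w (Z x)) + (\<Sum>j<n. - ln (?r (a ((f ^^ j) x)) (Y ((f ^^ j) x))))) \<in> borel_measurable M"
      by (intro borel_measurable_add borel_measurable_sum 1 2)
    show "AE x in M. - ln (q (?W x)) = - ln (w (Z x)) + (\<Sum>j<n. - ln (?r (a ((f ^^ j) x)) (Y ((f ^^ j) x))))"
      using AE_label_prob_pos[OF W] AE_space
    proof eventually_elim
      case (elim x)
      have r: "?r (a ((f ^^ j) x)) (Y ((f ^^ j) x)) > 0" if "j < n" for j
        using rpos[OF elim(1) that] elim(2) that by (simp add: itinerary_nth factor)
      have "q (?W x) = w (Z x) * (\<Prod>j<n. ?r (a ((f ^^ j) x)) (Y ((f ^^ j) x)))"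
        unfolding q_def using elim(2) by (auto simp: itinerary_nth factor intro!: prod.cong)
      also have "ln \<dots> = ln (w (Z x)) + ln (\<Prod>j<n. ?r (a ((f ^^ j) x)) (Y ((f ^^ j) x)))"
        using w(1)[of "Z x"] elim(2) r by (intro ln_mult_pos prod_pos) auto
      also have "ln (\<Prod>j<n. ?r (a ((f ^^ j) x)) (Y ((f ^^ j) x))) = (\<Sum>j<n. ln (?r (a ((f ^^ j) x)) (Y ((f ^^ j) x))))"
        using r by (intro ln_prod) (auto simp: less_imp_neq[symmetric])
      finally show ?case by (simp add: sum_negf)
    qed
  qed
  also have "\<dots> = (\<integral>x. - ln (w (Z x)) \<partial>M) + (\<Sum>j<n. \<integral>x. - ln (?r (a ((f ^^ j) x)) (Y ((f ^^ j) x))) \<partial>M)"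
  proof -
    have 1: "integrable M (\<lambda>x. - ln (w (Z x)))"
      using integrable_label[OF Z, of "\<lambda>w'. - ln (w w')"] by simp
    have 2: "integrable M (\<lambda>x. - ln (?r (a ((f ^^ j) x)) (Y ((f ^^ j) x))))" for j
      using integrable_label[OF simple_function_comp[OF fj(1) aY], of "\<lambda>uy. - ln (?r (fst uy) (snd uy))" j] by simp
    show ?thesis
      unfolding Bochner_Integration.integral_add[OF 1 Bochner_Integration.integrable_sum[OF 2]]
        Bochner_Integration.integral_sum[OF 2] ..
  qed
  also have "\<dots> = (\<integral>x. - ln (w (Z x)) \<partial>M) + (\<Sum>j<n. \<integral>x. - ln (?r (a x) (Y x)) \<partial>M)"
  proof -
    have "(\<integral>x. - ln (?r (a ((f ^^ j) x)) (Y ((f ^^ j) x))) \<partial>M) = (\<integral>x. - ln (?r (a x) (Y x)) \<partial>M)" for j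
      using integral_invariant[OF fj, of "\<lambda>x. - ln (?r (a x) (Y x))" j]
        integrable_label[OF aY, of "\<lambda>uy. - ln (?r (fst uy) (snd uy))"] by simp
    then show ?thesis by (simp only:)
  qed
  finally show ?thesis by simp
qed

end

lemma invariant_measuresD:
  assumes "\<nu> \<in> invariant_measures f" "C1_circle_map f"
  shows "\<nu> \<in> circle_measures" "f \<in> measurable \<nu> \<nu>" "distr \<nu> \<nu> f = \<nu>"
proof -
  show \<nu>: "\<nu> \<in> circle_measures" using assms by (simp add: invariant_measures_def)
  note s = circle_measuresD(1)[OF \<nu>]
  show "f \<in> measurable \<nu> \<nu>" using C1_measurable[OF assms(2)] measurable_cong_sets[OF s s] by simp
  have "distr \<nu> \<nu> f = distr \<nu> circle_borel f" by (rule distr_cong) (simp_all add: s)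
  then show "distr \<nu> \<nu> f = \<nu>" using assms(1) by (simp add: invariant_measures_def)
qed

context expanding_lift begin

text \<open>
  Choose $K \subseteq A \subseteq U$ with $K$ compact, $U$ open and $U - K$ of small measure. Once the cells are
  shorter than the distance from $K$ to the complement of $U$, the cells that meet $K$ lie in $U$.
\<close>

lemma markov_approximation:
  assumes \<nu>: "\<nu> \<in> circle_measures" and A: "A \<in> sets circle_borel" and \<epsilon>: "\<epsilon> > 0"
  obtains N0 where "\<And>N. N \<ge> N0 \<Longrightarrow> \<exists>H. measure \<nu> (markov N -` H \<inter> circle - A) \<le> \<epsilon> \<and> measure \<nu> (A - markov N -` H) \<le> \<epsilon>"
proof -
  interpret \<nu>: prob_space \<nu> using circle_measuresD[OF \<nu>] by simp
  note sp = circle_measuresD(2)[OF \<nu>] and st = circle_measuresD(1)[OF \<nu>]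
  have ic: "(\<lambda>x::complex. x) \<in> measurable circle_borel borel" by (rule circle_measurableI) simp
  then have im: "(\<lambda>x. x) \<in> measurable \<nu> borel" using measurable_cong_sets[OF st refl] by blast
  let ?D = "distr \<nu> borel (\<lambda>x. x)"
  interpret D: prob_space ?D by (rule \<nu>.prob_space_distr[OF im])
  have Dm: "measure ?D B = measure \<nu> (B \<inter> circle)" if "B \<in> sets borel" for B
    using that im sp by (simp add: measure_distr)
  have Ac: "A \<subseteq> circle" using sets.sets_into_space[OF A] by simp
  obtain B where B: "B \<in> sets borel" "A = B \<inter> circle"
    using A unfolding circle_borel_def sets_restrict_space by blast
  have Ab: "A \<in> sets borel" unfolding B(2) using B(1) by (intro sets.Int) (auto intro: borel_closed)
  have Dfin: "emeasure ?D (space ?D) \<noteq> \<infinity>" by simp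
  have "\<exists>K. K \<subseteq> A \<and> compact K \<and> measure ?D A < measure ?D K + \<epsilon>"
  proof (cases "measure ?D A < \<epsilon>")
    case False
    have "ennreal (measure ?D A - \<epsilon>) < emeasure ?D A"
      using False \<epsilon> by (simp add: D.emeasure_eq_measure ennreal_less_iff)
    also have "emeasure ?D A = (SUP K\<in>{K. K \<subseteq> A \<and> compact K}. emeasure ?D K)"
      by (rule inner_regular) (use Ab Dfin in auto)
    finally obtain K where K: "K \<subseteq> A" "compact K" "ennreal (measure ?D A - \<epsilon>) < emeasure ?D K"
      unfolding less_SUP_iff by blast
    then have "measure ?D A - \<epsilon> < measure ?D K"
      using False by (simp add: D.emeasure_eq_measure ennreal_less_iff)
    with K show ?thesis by (intro exI[of _ K]) simp
  qed (intro exI[of _ "{}"], simp)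
  then obtain K where K: "K \<subseteq> A" "compact K" "measure ?D A < measure ?D K + \<epsilon>" by blast
  have "(INF U\<in>{U. A \<subseteq> U \<and> open U}. emeasure ?D U) = emeasure ?D A"
    by (rule outer_regular[symmetric]) (use Ab Dfin in auto)
  also have "\<dots> < ennreal (measure ?D A + \<epsilon>)"
    using \<epsilon> by (simp add: D.emeasure_eq_measure ennreal_less_iff del: ennreal_plus)
  finally obtain U where U: "A \<subseteq> U" "open U" "emeasure ?D U < ennreal (measure ?D A + \<epsilon>)"
    unfolding INF_less_iff by blast
  have Kb: "K \<in> sets borel" "U \<in> sets borel" using K U by (auto intro: borel_compact borel_open)
  have KA: "measure ?D (A - K) \<le> \<epsilon>"
  proof -
    have "measure ?D (A - K) = measure ?D A - measure ?D K" using Ab Kb K by (intro D.finite_measure_Diff) auto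
    then show ?thesis using K(3) by linarith
  qed
  have UA: "measure ?D (U - A) \<le> \<epsilon>"
  proof -
    have "measure ?D (U - A) = measure ?D U - measure ?D A" using Ab Kb U by (intro D.finite_measure_Diff) auto
    moreover have "measure ?D U < measure ?D A + \<epsilon>"
      using U(3) by (simp add: D.emeasure_eq_measure ennreal_less_iff del: ennreal_plus)
    ultimately show ?thesis using \<epsilon> by linarith
  qed
  have "closed (- U)" "K \<inter> - U = {}" using U K by auto
  from separate_compact_closed[OF K(2) this]
  obtain d where d: "d > 0" "\<And>x y. x \<in> K \<Longrightarrow> y \<in> - U \<Longrightarrow> d \<le> dist x y" by blast
  obtain l where l: "l > 1" "\<And>x. x \<in> circle \<Longrightarrow> l \<le> circle_deriv f x" using min_expansion by blast
  obtain N0 where N0: "2 * pi / d < l ^ N0" using real_arch_pow[OF l(1)] by blast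
  show ?thesis
  proof (rule that[of N0])
    fix N assume N: "N \<ge> N0"
    \<comment> \<open>The union of the cells that meet $K$.\<close>
    let ?H = "markov N ` K"
    have "2 * pi / d < l ^ N" using N0 power_increasing[OF N, of l] l by linarith
    then have small: "2 * pi / l ^ N < d" using d l by (simp add: field_simps)
    have inU: "x \<in> U" if x: "x \<in> circle" "markov N x \<in> ?H" for x
    proof (rule ccontr)
      assume "x \<notin> U"
      obtain y where y: "y \<in> K" "markov N x = markov N y" using x(2) by auto
      have "d \<le> dist y x" using d(2)[OF y(1)] \<open>x \<notin> U\<close> by auto
      also have "dist y x \<le> 2 * pi / l ^ N"
        using markov_cell_diameter[of l y x N] l x y K Ac by auto
      finally show False using small by simp
    qed
    have "measure \<nu> (markov N -` ?H \<inter> circle - A) \<le> measure \<nu> ((U - A) \<inter> circle)"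
    proof (rule \<nu>.finite_measure_mono)
      show "(U - A) \<inter> circle \<in> sets \<nu>" unfolding st using Ab Kb by (intro Int_circle_borel) auto
    qed (use inU in auto)
    moreover have "measure \<nu> (A - markov N -` ?H) \<le> measure \<nu> ((A - K) \<inter> circle)"
    proof (rule \<nu>.finite_measure_mono)
      show "(A - K) \<inter> circle \<in> sets \<nu>" unfolding st using Ab Kb by (intro Int_circle_borel) auto
    qed (use Ac in auto)
    ultimately show "\<exists>H. measure \<nu> (markov N -` H \<inter> circle - A) \<le> \<epsilon> \<and> measure \<nu> (A - markov N -` H) \<le> \<epsilon>"
      using KA UA Dm[of "U - A"] Dm[of "A - K"] Ab Kb by (intro exI[of _ ?H]) auto
  qed
qed

lemma markov_conditional_entropy:
  assumes \<nu>: "\<nu> \<in> circle_measures" and a: "simple_function \<nu> a" and \<epsilon>: "\<epsilon> > 0"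
  obtains N where "(\<integral>x. - ln (cond_label_prob \<nu> a (markov N) (a x) (markov N x)) \<partial>\<nu>) \<le> \<epsilon>"
proof -
  interpret \<nu>: prob_space \<nu> using circle_measuresD[OF \<nu>] by simp
  note sp = circle_measuresD(2)[OF \<nu>] and st = circle_measuresD(1)[OF \<nu>]
  let ?V = "a ` space \<nu>"
  have fin: "finite ?V" using a by (simp add: simple_function_def)
  \<comment> \<open>Errors $t^2$ cost $t^2 + 2 \sqrt{t^2} \<le> 3 t$ per label.\<close>
  define t where "t = min 1 (\<epsilon> / (3 * (real (card ?V) + 1)))"
  have t: "t > 0" "t \<le> 1" "3 * t * real (card ?V) \<le> \<epsilon>"
  proof -
    show "t > 0" "t \<le> 1" using \<epsilon> by (auto simp: t_def)
    have "t \<le> \<epsilon> / (3 * (real (card ?V) + 1))" by (simp add: t_def)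
    then have "t * (3 * (real (card ?V) + 1)) \<le> \<epsilon>" by (subst (asm) pos_le_divide_eq) auto
    then show "3 * t * real (card ?V) \<le> \<epsilon>" using \<open>t > 0\<close> by (simp add: algebra_simps)
  qed
  have "\<exists>N0. \<forall>N\<ge>N0. \<exists>H. measure \<nu> (markov N -` H \<inter> circle - a -` {u} \<inter> circle) \<le> t\<^sup>2 \<and> measure \<nu> (a -` {u} \<inter> circle - markov N -` H) \<le> t\<^sup>2" for u
  proof -
    have "a -` {u} \<inter> circle \<in> sets circle_borel" using simple_functionD(2)[OF a, of "{u}"] sp st by simp
    from markov_approximation[OF \<nu> this, of "t\<^sup>2"] t show ?thesis by (metis zero_less_power)
  qed
  then obtain N0 where N0: "\<And>u N. N \<ge> N0 u \<Longrightarrow> \<exists>H. measure \<nu> (markov N -` H \<inter> circle - a -` {u} \<inter> circle) \<le> t\<^sup>2 \<and> measure \<nu> (a -` {u} \<inter> circle - markov N -` H) \<le> t\<^sup>2"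
    by metis
  define N where "N = Max (insert 0 (N0 ` ?V))"
  have "N \<ge> N0 u" if "u \<in> ?V" for u unfolding N_def using that fin by (intro Max_ge) auto
  then have "\<forall>u\<in>?V. \<exists>H. measure \<nu> (markov N -` H \<inter> circle - a -` {u} \<inter> circle) \<le> t\<^sup>2 \<and> measure \<nu> (a -` {u} \<inter> circle - markov N -` H) \<le> t\<^sup>2"
    using N0 by blast
  then obtain H where H: "\<And>u. u \<in> ?V \<Longrightarrow> measure \<nu> (markov N -` H u \<inter> circle - a -` {u} \<inter> circle) \<le> t\<^sup>2"
    "\<And>u. u \<in> ?V \<Longrightarrow> measure \<nu> (a -` {u} \<inter> circle - markov N -` H u) \<le> t\<^sup>2" by metis
  have "(\<integral>x. - ln (cond_label_prob \<nu> a (markov N) (a x) (markov N x)) \<partial>\<nu>)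
    \<le> (\<Sum>u\<in>?V. measure \<nu> (markov N -` H u \<inter> space \<nu> - a -` {u}) + 2 * sqrt (measure \<nu> (a -` {u} \<inter> space \<nu> - markov N -` H u)))"
    by (rule \<nu>.conditional_entropy_le[OF a markov_simple[OF st sp]])
  also have "\<dots> \<le> (\<Sum>u\<in>?V. 3 * t)"
  proof (rule sum_mono)
    fix u assume u: "u \<in> ?V"
    have "markov N -` H u \<inter> space \<nu> - a -` {u} = markov N -` H u \<inter> circle - a -` {u} \<inter> circle" unfolding sp by auto
    then have 1: "measure \<nu> (markov N -` H u \<inter> space \<nu> - a -` {u}) \<le> t\<^sup>2" using H(1)[OF u] by simp
    have "sqrt (measure \<nu> (a -` {u} \<inter> space \<nu> - markov N -` H u)) \<le> t"
      using H(2)[OF u] t unfolding sp by (intro real_le_lsqrt) auto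
    moreover have "t\<^sup>2 \<le> t" using t by (simp add: power2_eq_square mult_left_le)
    ultimately show "measure \<nu> (markov N -` H u \<inter> space \<nu> - a -` {u}) + 2 * sqrt (measure \<nu> (a -` {u} \<inter> space \<nu> - markov N -` H u)) \<le> 3 * t"
      using 1 by linarith
  qed
  also have "\<dots> \<le> \<epsilon>" using t by (simp add: mult.commute)
  finally show ?thesis by (rule that)
qed

lemma integral_orbit:
  fixes \<kappa> :: "complex \<Rightarrow> real"
  assumes \<nu>: "\<nu> \<in> invariant_measures f" and \<kappa>: "continuous_on circle \<kappa>"
  shows "(\<integral>x. \<kappa> ((f ^^ j) x) \<partial>\<nu>) = (\<integral>x. \<kappa> x \<partial>\<nu>)"
proof -
  note f = invariant_measuresD(2,3)[OF \<nu> C1]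
  show ?thesis
    by (rule integral_invariant[OF funpow_measurable[OF f(1)] distr_funpow[OF f]])
       (rule measurable_circle_measure[OF invariant_measuresD(1)[OF \<nu> C1] circle_measurable_continuous[OF \<kappa>]])
qed

text \<open>
  In \<open>label_entropy_itinerary_le_factor\<close> take for $Z$ the Markov cell of level $N + n$, which determines
  the cells of level $N$ at the times up to $n$, and weight it by its Lebesgue measure. Dividing by $n$
  removes the contribution of the fixed level $N$.
\<close>

theorem entropy_wrt_le_exponent:
  assumes \<nu>: "\<nu> \<in> invariant_measures f" and a: "simple_function \<nu> a"
  shows "entropy_wrt \<nu> f (fibres \<nu> a) \<le> (\<integral>x. lnD x \<partial>\<nu>)"
proof (rule field_le_epsilon)
  fix e :: real assume "e > 0"
  define \<epsilon> where "\<epsilon> = e / 2"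
  have \<epsilon>: "\<epsilon> > 0" using \<open>e > 0\<close> by (simp add: \<epsilon>_def)
  note \<nu>c = invariant_measuresD(1)[OF \<nu> C1] and f = invariant_measuresD(2,3)[OF \<nu> C1]
  interpret \<nu>: prob_space \<nu> using circle_measuresD[OF \<nu>c] by simp
  interpret m: prob_space circle_lebesgue by (rule prob_space_circle_lebesgue)
  note sp = circle_measuresD(2)[OF \<nu>c] and st = circle_measuresD(1)[OF \<nu>c]
  let ?L = "\<integral>x. lnD x \<partial>\<nu>" and ?E = "entropy_wrt \<nu> f (fibres \<nu> a)"
  obtain N where N: "(\<integral>x. - ln (cond_label_prob \<nu> a (markov N) (a x) (markov N x)) \<partial>\<nu>) \<le> \<epsilon>"
    using markov_conditional_entropy[OF \<nu>c a \<epsilon>] by blast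
  obtain C where C: "\<And>n x. x \<in> circle \<Longrightarrow> label_prob circle_lebesgue (markov n) (markov n x) > 0"
    "\<And>n x. x \<in> circle \<Longrightarrow> - ln (label_prob circle_lebesgue (markov n) (markov n x)) \<le> (\<Sum>j<n. lnD ((f ^^ j) x)) + real n * \<epsilon> + C"
    using markov_cell_volume[OF \<epsilon>] by metis
  have H: "?E * real n \<le> real (N + n) * (?L + \<epsilon>) + C + real n * \<epsilon>" if n: "n \<ge> 1" for n
  proof -
    let ?Z = "markov (N + n)"
    let ?w = "label_prob circle_lebesgue ?Z"
    have Zs: "simple_function \<nu> ?Z" by (rule markov_simple[OF st sp])
    have cont: "continuous_on circle (\<lambda>x. lnD ((f ^^ j) x))" for j by (rule continuous_along_orbit[OF C1 lnD_continuous])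
    have int: "integrable \<nu> (\<lambda>x. lnD ((f ^^ j) x))" for j by (rule integrable_continuous_circle[OF \<nu>c cont])
    have "?E * real n \<le> label_entropy \<nu> (itinerary a f n)"
      using entropy_wrt_le[OF \<nu>.prob_space_axioms f a n] n by (simp add: field_simps)
    also have "\<dots> \<le> (\<integral>x. - ln (?w (?Z x)) \<partial>\<nu>) + real n * (\<integral>x. - ln (cond_label_prob \<nu> a (markov N) (a x) (markov N x)) \<partial>\<nu>)"
    proof (rule \<nu>.label_entropy_itinerary_le_factor[OF f a Zs markov_simple[OF st sp],
          where yf="\<lambda>j z. z div int deg ^ (n - j) - z div int deg ^ (N + n - j) * int deg ^ N"])
      show "markov N ((f ^^ j) x) = ?Z x div int deg ^ (n - j) - ?Z x div int deg ^ (N + n - j) * int deg ^ N"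
        if "j < n" "x \<in> space \<nu>" for j x
        using that sp by (intro markov_orbit) auto
      show "?w z > 0" if "z \<in> ?Z ` space \<nu>" for z using that C(1) sp by auto
      show "(\<Sum>z\<in>?Z ` space \<nu>. ?w z) \<le> 1"
        using m.sum_label_prob[OF markov_simple] by (simp add: sp)
    qed
    also have "(\<integral>x. - ln (?w (?Z x)) \<partial>\<nu>) \<le> (\<integral>x. (\<Sum>j<N + n. lnD ((f ^^ j) x)) + (real (N + n) * \<epsilon> + C) \<partial>\<nu>)"
    proof (rule integral_mono)
      show "integrable \<nu> (\<lambda>x. - ln (?w (?Z x)))"
        using \<nu>.integrable_label[OF Zs, of "\<lambda>z. - ln (?w z)"] by simp
      show "integrable \<nu> (\<lambda>x. (\<Sum>j<N + n. lnD ((f ^^ j) x)) + (real (N + n) * \<epsilon> + C))"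
        using int by (intro Bochner_Integration.integrable_add Bochner_Integration.integrable_sum) auto
      fix x assume "x \<in> space \<nu>"
      then show "- ln (?w (?Z x)) \<le> (\<Sum>j<N + n. lnD ((f ^^ j) x)) + (real (N + n) * \<epsilon> + C)"
        using C(2)[of x "N + n"] sp by simp
    qed
    also have "(\<integral>x. (\<Sum>j<N + n. lnD ((f ^^ j) x)) + (real (N + n) * \<epsilon> + C) \<partial>\<nu>) = real (N + n) * ?L + (real (N + n) * \<epsilon> + C)"
    proof -
      have "(\<integral>x. (\<Sum>j<N + n. lnD ((f ^^ j) x)) + (real (N + n) * \<epsilon> + C) \<partial>\<nu>)
          = (\<integral>x. (\<Sum>j<N + n. lnD ((f ^^ j) x)) \<partial>\<nu>) + (\<integral>x. real (N + n) * \<epsilon> + C \<partial>\<nu>)"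
        using int by (intro Bochner_Integration.integral_add Bochner_Integration.integrable_sum) auto
      also have "(\<integral>x. (\<Sum>j<N + n. lnD ((f ^^ j) x)) \<partial>\<nu>) = (\<Sum>j<N + n. \<integral>x. lnD ((f ^^ j) x) \<partial>\<nu>)"
        using int by (intro Bochner_Integration.integral_sum) auto
      finally show ?thesis by (simp add: integral_orbit[OF \<nu> lnD_continuous] \<nu>.prob_space)
    qed
    also have "real n * (\<integral>x. - ln (cond_label_prob \<nu> a (markov N) (a x) (markov N x)) \<partial>\<nu>) \<le> real n * \<epsilon>"
      using N by (intro mult_left_mono) auto
    finally show ?thesis by (simp add: algebra_simps)
  qed
  show "?E \<le> ?L + e"
  proof (rule ccontr)
    assume "\<not> ?thesis"
    then have g: "?E - ?L - e > 0" by simp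
    obtain n :: nat where n: "(real N * (?L + \<epsilon>) + C) / (?E - ?L - e) < real n" using reals_Archimedean2 by blast
    have "real N * (?L + \<epsilon>) + C < real (Suc n) * (?E - ?L - e)"
      using n g by (simp add: divide_less_eq algebra_simps)
    moreover have "?E * real (Suc n) \<le> real (N + Suc n) * (?L + \<epsilon>) + C + real (Suc n) * \<epsilon>" by (rule H) simp
    moreover have "real (N + Suc n) * (?L + \<epsilon>) + C + real (Suc n) * \<epsilon>
        = real (Suc n) * (?L + 2 * \<epsilon>) + (real N * (?L + \<epsilon>) + C)" by (simp add: algebra_simps)
    moreover have "real (Suc n) * (?E - ?L - e) = ?E * real (Suc n) - real (Suc n) * (?L + 2 * \<epsilon>)"
      by (simp only: \<epsilon>_def) (simp add: algebra_simps)
    ultimately show False by linarith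
  qed
qed

theorem KS_entropy_le_exponent:
  assumes \<nu>: "\<nu> \<in> invariant_measures f"
  shows "KS_entropy \<nu> f \<le> ereal (\<integral>x. lnD x \<partial>\<nu>)"
  unfolding KS_entropy_def
proof (rule SUP_least)
  fix \<alpha> assume "\<alpha> \<in> {\<alpha>. finite_meas_partition \<nu> \<alpha>}"
  then obtain a :: "complex \<Rightarrow> complex set" where "simple_function \<nu> a" "fibres \<nu> a = \<alpha>"
    using finite_meas_partition_labels by blast
  then show "ereal (entropy_wrt \<nu> f \<alpha>) \<le> ereal (\<integral>x. lnD x \<partial>\<nu>)"
    using entropy_wrt_le_exponent[OF \<nu>] by auto
qed

end

section \<open>Entropy of an observable measure\<close>

text \<open>
  The weight of a word under a Markov chain of order $k$ that runs backwards in time: $r$ weights a letter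
  given the $k$ letters that follow it. Reading backwards matches the recursion of itineraries. Near
  the end of the word fewer letters follow, so $r$ takes contexts of every length up to $k$.
\<close>

primrec chain_weight :: "('b \<Rightarrow> 'b list \<Rightarrow> real) \<Rightarrow> nat \<Rightarrow> 'b list \<Rightarrow> real" where
  "chain_weight r k [] = 1"
| "chain_weight r k (u # w) = r u (take k w) * chain_weight r k w"

lemma chain_weight_nonneg: "(\<And>u w. r u w \<ge> 0) \<Longrightarrow> chain_weight r k v \<ge> 0"
  by (induction v) auto

lemma sum_chain_weight_le:
  assumes A: "finite A" and r: "\<And>u w. r u w \<ge> 0" "\<And>w. (\<Sum>u\<in>A. r u w) \<le> 1"
  shows "(\<Sum>v\<in>{v. set v \<subseteq> A \<and> length v = n}. chain_weight r k v) \<le> 1"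
proof (induction n)
  case 0
  have "{v. set v \<subseteq> A \<and> length v = 0} = {[]}" by auto
  then show ?case by simp
next
  case (Suc n)
  let ?L = "{v. set v \<subseteq> A \<and> length v = n}"
  have inj: "inj_on (\<lambda>(xs, x). x # xs) (?L \<times> A)" by (auto simp: inj_on_def)
  have "(\<Sum>v\<in>{v. set v \<subseteq> A \<and> length v = Suc n}. chain_weight r k v) = (\<Sum>(v,u)\<in>?L \<times> A. chain_weight r k (u # v))"
    unfolding lists_length_Suc_eq by (subst sum.reindex[OF inj]) (simp add: case_prod_unfold comp_def)
  also have "\<dots> = (\<Sum>v\<in>?L. (\<Sum>u\<in>A. r u (take k v)) * chain_weight r k v)"
    by (simp add: sum.cartesian_product[symmetric] sum_distrib_right)
  also have "\<dots> \<le> (\<Sum>v\<in>?L. 1 * chain_weight r k v)"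
    by (intro sum_mono mult_right_mono r chain_weight_nonneg)
  finally show ?case using Suc by simp
qed

text \<open>
  Only the last $k$ letters have a truncated context, and each of them costs at most $C$.
\<close>

lemma chain_weight_itinerary:
  assumes r: "\<And>u w. r u w > 0" and C: "\<And>u w. - ln (r u w) \<le> C" "C \<ge> 0"
    and G: "\<And>j. 0 \<le> - ln (r (a ((f ^^ j) x)) (itinerary a f k (f ((f ^^ j) x))))"
  shows "chain_weight r k (itinerary a f n x) > 0 \<and>
    - ln (chain_weight r k (itinerary a f n x))
      \<le> (\<Sum>j<n. - ln (r (a ((f ^^ j) x)) (itinerary a f k (f ((f ^^ j) x))))) + real (min n k) * C"
  using G
proof (induction n arbitrary: x)
  case (Suc n)
  let ?g = "\<lambda>x. - ln (r (a x) (itinerary a f k (f x)))"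
  have G': "0 \<le> ?g ((f ^^ j) (f x))" for j using Suc.prems[of "Suc j"] by (simp add: funpow_swap1)
  have IH: "chain_weight r k (itinerary a f n (f x)) > 0"
    "- ln (chain_weight r k (itinerary a f n (f x))) \<le> (\<Sum>j<n. ?g ((f ^^ j) (f x))) + real (min n k) * C"
    using Suc.IH[of "f x"] G' by blast+
  let ?r = "r (a x) (take k (itinerary a f n (f x)))"
  have shift: "(\<Sum>j<Suc n. ?g ((f ^^ j) x)) = ?g x + (\<Sum>j<n. ?g ((f ^^ j) (f x)))"
    by (simp add: sum.lessThan_Suc_shift funpow_swap1 del: sum.lessThan_Suc)
  have "- ln ?r + real (min n k) * C \<le> ?g x + real (min (Suc n) k) * C"
  proof (cases "k \<le> n")
    case True
    then show ?thesis by (simp add: take_itinerary min_absorb1)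
  next
    case False
    then have "real (min (Suc n) k) * C = real (min n k) * C + C" by (simp add: algebra_simps)
    then show ?thesis using C(1)[of "a x" "take k (itinerary a f n (f x))"] Suc.prems[of 0] by simp
  qed
  moreover have "- ln (?r * chain_weight r k (itinerary a f n (f x))) = - ln ?r - ln (chain_weight r k (itinerary a f n (f x)))"
    using r IH(1) by (simp add: ln_mult_pos)
  ultimately show ?case
    using IH r unfolding shift by (simp add: itinerary_Suc)
qed simp

text \<open>
  The probability that the letter $u$ precedes the word $w$, given $w$, after adding mass $s$ to every
  extension of $w$. The added mass bounds its logarithm, which would be infinite for a word
  of probability $0$.
\<close>

definition smoothed_cond :: "'a measure \<Rightarrow> ('a \<Rightarrow> 'b) \<Rightarrow> ('a \<Rightarrow> 'a) \<Rightarrow> real \<Rightarrow> 'b \<Rightarrow> 'b list \<Rightarrow> real" where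
  "smoothed_cond M a f s u w =
     (label_prob M (itinerary a f (Suc (length w))) (u # w) + s)
       / (label_prob M (itinerary a f (length w)) w + s * real (card (a ` space M)))"

context prob_space begin

context
  fixes a :: "'a \<Rightarrow> 'b" and f :: "'a \<Rightarrow> 'a"
  assumes f: "f \<in> measurable M M" "distr M M f = M" and a: "simple_function M a"
begin

lemma card_labels_pos: "card (a ` space M) > 0"
  using a not_empty by (auto simp: simple_function_def card_gt_0_iff)

lemma sum_label_prob_Cons:
  "(\<Sum>u\<in>a ` space M. label_prob M (itinerary a f (Suc l)) (u # w)) = label_prob M (itinerary a f l) w"
proof -
  have I: "simple_function M (itinerary a f l)" by (rule simple_function_itinerary[OF a f(1)])
  have "label_prob M (itinerary a f (Suc l)) (u # w) = label_prob M (\<lambda>x. (a x, itinerary a f l (f x))) (u, w)" for u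
    unfolding label_prob_def by (intro arg_cong[where f=prob]) (auto simp: itinerary_Suc)
  then have "(\<Sum>u\<in>a ` space M. label_prob M (itinerary a f (Suc l)) (u # w)) = label_prob M (\<lambda>x. itinerary a f l (f x)) w"
    using sum_label_prob_pair[OF a simple_function_comp[OF f(1) I], of w] by simp
  also have "\<dots> = label_prob M (itinerary a f l) w" by (rule label_prob_invariant[OF f I])
  finally show ?thesis .
qed

lemma label_prob_le_1: "label_prob M X v \<le> 1"
  by (simp add: label_prob_def)

lemma
  assumes s: "s > 0"
  shows smoothed_cond_pos: "smoothed_cond M a f s u w > 0"
    and sum_smoothed_cond: "(\<Sum>u\<in>a ` space M. smoothed_cond M a f s u w) = 1"
    and smoothed_cond_le_1: "u \<in> a ` space M \<Longrightarrow> smoothed_cond M a f s u w \<le> 1"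
    and smoothed_cond_bound: "- ln (smoothed_cond M a f s u w) \<le> ln ((1 + s * real (card (a ` space M))) / s)"
    and smoothed_bound_nonneg: "ln ((1 + s * real (card (a ` space M))) / s) \<ge> 0"
proof -
  let ?c = "real (card (a ` space M))"
  have c: "?c \<ge> 1" using card_labels_pos by simp
  have sc: "s * ?c > 0" using s c by simp
  have num: "label_prob M (itinerary a f (Suc (length w))) (u # w) + s > 0" for u w
    using label_prob_nonneg[of M "itinerary a f (Suc (length w))" "u # w"] s by linarith
  have den: "label_prob M (itinerary a f (length w)) w + s * ?c > 0" for w
    using label_prob_nonneg[of M "itinerary a f (length w)" w] sc by linarith
  show pos: "smoothed_cond M a f s u w > 0" for u
    unfolding smoothed_cond_def using num den by (intro divide_pos_pos)
  show sum1: "(\<Sum>u\<in>a ` space M. smoothed_cond M a f s u w) = 1"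
    unfolding smoothed_cond_def sum_divide_distrib[symmetric] sum.distrib sum_label_prob_Cons
    using den[of w] by (simp add: mult.commute)
  show "smoothed_cond M a f s u w \<le> 1" if "u \<in> a ` space M"
    unfolding sum1[symmetric] using a that by (intro member_le_sum) (auto simp: simple_function_def intro: less_imp_le[OF pos])
  have "s / (1 + s * ?c) \<le> smoothed_cond M a f s u w"
    unfolding smoothed_cond_def using s den label_prob_le_1 by (intro frac_le) auto
  moreover have sp: "s / (1 + s * ?c) > 0" using s sc by (intro divide_pos_pos) auto
  ultimately have "ln (s / (1 + s * ?c)) \<le> ln (smoothed_cond M a f s u w)" by simp
  moreover have "ln ((1 + s * ?c) / s) = - ln (s / (1 + s * ?c))"
    using s sc by (simp add: ln_div)
  ultimately show "- ln (smoothed_cond M a f s u w) \<le> ln ((1 + s * ?c) / s)" by linarith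
  have "s * 1 \<le> s * ?c" using s c by (intro mult_left_mono) auto
  then have "s \<le> 1 + s * ?c" by linarith
  then have "1 \<le> (1 + s * ?c) / s" using s by (simp only: le_divide_eq if_True mult_1)
  then show "ln ((1 + s * ?c) / s) \<ge> 0" by simp
qed

text \<open>
  For $s = 0$ the integral is the entropy of the first letter given the next $k$ letters. Only words of
  positive probability enter the sum, and for them the logarithm is continuous at $s = 0$.
\<close>

lemma smoothed_cond_limit:
  "((\<lambda>s. \<integral>x. - ln (smoothed_cond M a f s (a x) (itinerary a f k (f x))) \<partial>M)
     \<longlongrightarrow> label_entropy M (itinerary a f (Suc k)) - label_entropy M (itinerary a f k)) (at_right 0)"
proof -
  let ?I = "itinerary a f (Suc k)" and ?J = "itinerary a f k"
  let ?P = "label_prob M ?I" and ?R = "label_prob M ?J" and ?c = "real (card (a ` space M))"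
  have I: "simple_function M ?I" and J: "simple_function M ?J" by (auto intro: simple_function_itinerary[OF a f(1)])
  have Jf: "simple_function M (\<lambda>x. ?J (f x))" by (rule simple_function_comp[OF f(1) J])
  have tl: "tl (?I x) = ?J (f x)" "?I x = a x # ?J (f x)" for x by (simp_all add: itinerary_Suc)
  have 1: "(\<integral>x. - ln (smoothed_cond M a f s (a x) (?J (f x))) \<partial>M)
      = (\<Sum>v\<in>?I ` space M. - ln ((?P v + s) / (?R (tl v) + s * ?c)) * ?P v)" for s
    using integral_label[OF I, of "\<lambda>v. - ln ((?P v + s) / (?R (tl v) + s * ?c))"]
    by (simp add: smoothed_cond_def tl)
  have 2: "(\<Sum>v\<in>?I ` space M. - ln ((?P v + 0) / (?R (tl v) + 0 * ?c)) * ?P v)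
      = label_entropy M ?I - label_entropy M ?J"
  proof -
    have "(\<Sum>v\<in>?I ` space M. - ln ((?P v + 0) / (?R (tl v) + 0 * ?c)) * ?P v)
        = (\<Sum>v\<in>?I ` space M. - ln (?P v) * ?P v - (- ln (?R (tl v)) * ?P v))"
    proof (rule sum.cong[OF refl])
      fix v
      show "- ln ((?P v + 0) / (?R (tl v) + 0 * ?c)) * ?P v = - ln (?P v) * ?P v - (- ln (?R (tl v)) * ?P v)"
      proof (cases "?P v = 0")
        case False
        then have "?P v > 0" using label_prob_nonneg[of M ?I v] by linarith
        moreover have "?P v \<le> label_prob M (\<lambda>x. ?J (f x)) (tl v)"
          using label_prob_le_image[OF I, of v tl] by (simp add: tl(1))
        moreover have "label_prob M (\<lambda>x. ?J (f x)) (tl v) = ?R (tl v)" by (rule label_prob_invariant[OF f J])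
        ultimately have "?P v > 0" "?R (tl v) > 0" by linarith+
        then show ?thesis by (simp add: ln_div algebra_simps)
      qed simp
    qed
    also have "\<dots> = (\<integral>x. - ln (?P (?I x)) \<partial>M) - (\<integral>x. - ln (?R (tl (?I x))) \<partial>M)"
      using integral_label[OF I, of "\<lambda>v. - ln (?P v)"] integral_label[OF I, of "\<lambda>v. - ln (?R (tl v))"]
      by (simp only: sum_subtractf)
    also have "(\<integral>x. - ln (?R (tl (?I x))) \<partial>M) = (\<integral>x. - ln (?R (?J (f x))) \<partial>M)" by (simp only: tl(1))
    also have "\<dots> = (\<integral>x. - ln (?R (?J x)) \<partial>M)"
      using integrable_label[OF J, of "\<lambda>v. - ln (?R v)"] by (intro integral_invariant[OF f]) simp
    finally show ?thesis by (simp only: label_entropy_eq_integral[OF I] label_entropy_eq_integral[OF J])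
  qed
  have "((\<lambda>s. \<Sum>v\<in>?I ` space M. - ln ((?P v + s) / (?R (tl v) + s * ?c)) * ?P v)
      \<longlongrightarrow> (\<Sum>v\<in>?I ` space M. - ln ((?P v + 0) / (?R (tl v) + 0 * ?c)) * ?P v)) (at_right 0)"
  proof (rule tendsto_sum)
    fix v
    show "((\<lambda>s. - ln ((?P v + s) / (?R (tl v) + s * ?c)) * ?P v) \<longlongrightarrow> - ln ((?P v + 0) / (?R (tl v) + 0 * ?c)) * ?P v) (at_right 0)"
    proof (cases "?P v = 0")
      case False
      then have "?P v > 0" using label_prob_nonneg[of M ?I v] by linarith
      moreover have "?P v \<le> label_prob M (\<lambda>x. ?J (f x)) (tl v)"
        using label_prob_le_image[OF I, of v tl] by (simp add: tl(1))
      moreover have "label_prob M (\<lambda>x. ?J (f x)) (tl v) = ?R (tl v)" by (rule label_prob_invariant[OF f J])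
      ultimately have "?P v > 0" "?R (tl v) > 0" by linarith+
      then show ?thesis by (intro tendsto_intros) auto
    qed simp
  qed
  then show ?thesis unfolding 1 2 .
qed

end

end

definition arc_label :: "nat \<Rightarrow> real \<Rightarrow> complex \<Rightarrow> int" where
  "arc_label N \<theta> x = \<lfloor>real N * (angle \<theta> x - \<theta>)\<rfloor>"

definition arc_ends :: "nat \<Rightarrow> real \<Rightarrow> complex set" where
  "arc_ends N \<theta> = (\<lambda>i. turn (\<theta> + real i / real N)) ` {..<N}"

lemma arc_label_bounds: "N > 0 \<Longrightarrow> 0 \<le> arc_label N \<theta> x" "N > 0 \<Longrightarrow> arc_label N \<theta> x < int N"
proof -
  assume N: "N > 0"
  have "0 \<le> real N * (angle \<theta> x - \<theta>)" using angle_bounds[of \<theta> x] by simp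
  then show "0 \<le> arc_label N \<theta> x" unfolding arc_label_def by simp
  have "real N * (angle \<theta> x - \<theta>) < real N * 1" using N angle_bounds[of \<theta> x] by (intro mult_strict_left_mono) auto
  then show "arc_label N \<theta> x < int N" unfolding arc_label_def floor_less_iff by simp
qed

lemma arc_label_simple:
  assumes "sets M = sets circle_borel" "space M = circle" "N > 0"
  shows "simple_function M (arc_label N \<theta>)"
  unfolding simple_function_def
proof
  have "arc_label N \<theta> ` space M \<subseteq> {0..<int N}" using arc_label_bounds[OF assms(3)] by auto
  then show "finite (arc_label N \<theta> ` space M)" by (rule finite_subset) simp
  have "arc_label N \<theta> \<in> measurable circle_borel (count_space UNIV)"
    unfolding arc_label_def[abs_def] by (rule circle_measurableI) measurable
  then show "\<forall>x\<in>arc_label N \<theta> ` space M. arc_label N \<theta> -` {x} \<inter> space M \<in> sets M"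
    using measurable_sets[of "arc_label N \<theta>" circle_borel "count_space UNIV"] assms by simp
qed

lemma arc_label_arc:
  assumes N: "N > 0" and x: "x \<in> circle"
  shows "\<exists>t. \<theta> + real_of_int (arc_label N \<theta> x) / real N \<le> t \<and> t < \<theta> + real_of_int (arc_label N \<theta> x) / real N + 1 / real N \<and> x = turn t"
proof (intro exI conjI)
  let ?i = "arc_label N \<theta> x"
  have "of_int ?i \<le> real N * (angle \<theta> x - \<theta>)" "real N * (angle \<theta> x - \<theta>) < of_int ?i + 1"
    unfolding arc_label_def by linarith+
  then show "\<theta> + real_of_int ?i / real N \<le> angle \<theta> x" "angle \<theta> x < \<theta> + real_of_int ?i / real N + 1 / real N"
    using N by (auto simp: field_simps)
  show "x = turn (angle \<theta> x)" using turn_angle[OF x] by simp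
qed

lemma arc_label_locally_constant:
  assumes N: "N > 0" and x: "x \<in> circle" "x \<notin> arc_ends N \<theta>"
  shows "eventually (\<lambda>y. arc_label N \<theta> y = arc_label N \<theta> x) (nhds x)"
proof -
  have "turn \<theta> \<in> arc_ends N \<theta>" unfolding arc_ends_def using N by (auto intro!: image_eqI[of _ _ 0])
  then have "x \<noteq> turn \<theta>" using x by auto
  from angle_isCont[OF x(1) this]
  have "((\<lambda>y. real N * (angle \<theta> y - \<theta>)) \<longlongrightarrow> real N * (angle \<theta> x - \<theta>)) (at x)"
    unfolding isCont_def by (intro tendsto_intros)
  moreover have "real N * (angle \<theta> x - \<theta>) \<notin> \<int>"
  proof
    assume "real N * (angle \<theta> x - \<theta>) \<in> \<int>"
    then obtain z where z: "real N * (angle \<theta> x - \<theta>) = of_int z" by (auto elim: Ints_cases)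
    then have "arc_label N \<theta> x = z" by (simp add: arc_label_def)
    then have "0 \<le> z" "z < int N" using arc_label_bounds[OF N] by auto
    then have nz: "nat z < N" "real_of_int z = real (nat z)" by auto
    have "angle \<theta> x = \<theta> + real_of_int z / real N" using z N by (simp add: field_simps)
    then have "turn (angle \<theta> x) = turn (\<theta> + real (nat z) / real N)" by (simp only: nz(2))
    then have "x = turn (\<theta> + real (nat z) / real N)" by (simp only: turn_angle[OF x(1)])
    then show False using x(2) nz(1) unfolding arc_ends_def by blast
  qed
  ultimately have "eventually (\<lambda>y. arc_label N \<theta> y = arc_label N \<theta> x) (at x)"
    unfolding arc_label_def by (rule eventually_floor_eq)
  then show ?thesis unfolding eventually_at_filter by (rule eventually_mono) auto
qed

context expanding_lift begin

text \<open>
  The derivative bound makes $f$ map an arc of length $1/N$ to an arc of length at most $1$, so injectively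
  up to endpoints.
\<close>

definition fine_mesh :: "real \<Rightarrow> nat \<Rightarrow> bool" where
  "fine_mesh \<epsilon> N \<longleftrightarrow> N > 0 \<and> (\<forall>x\<in>circle. circle_deriv f x \<le> real N) \<and>
     (\<forall>s t. \<bar>s - t\<bar> \<le> 1 / real N \<longrightarrow> \<bar>lnD (turn s) - lnD (turn t)\<bar> \<le> \<epsilon>)"

lemma fine_mesh_exists:
  assumes "\<epsilon> > 0" obtains N where "fine_mesh \<epsilon> N"
proof -
  obtain B where B: "\<And>x. x \<in> circle \<Longrightarrow> \<bar>circle_deriv f x\<bar> \<le> B" using continuous_bounded_circle[OF deriv_continuous] by metis
  obtain \<delta> where \<delta>: "\<delta> > 0" "\<And>s t. \<bar>s - t\<bar> \<le> \<delta> \<Longrightarrow> \<bar>lnD (turn s) - lnD (turn t)\<bar> < \<epsilon>"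
    using uniformly_continuous_turn[OF lnD_continuous assms] by blast
  obtain N :: nat where N: "max B (1 / \<delta>) < real N" using reals_Archimedean2 by blast
  have "1 / \<delta> > 0" using \<delta> by simp
  then have N0: "N > 0" using N by (intro gr0I) auto
  have "1 / real N \<le> \<delta>" using N N0 \<delta>(1) by (simp add: field_simps)
  then have "\<bar>lnD (turn s) - lnD (turn t)\<bar> \<le> \<epsilon>" if "\<bar>s - t\<bar> \<le> 1 / real N" for s t
    using \<delta>(2)[of s t] that by linarith
  moreover have "circle_deriv f x \<le> real N" if "x \<in> circle" for x using B[OF that] N by linarith
  ultimately have "fine_mesh \<epsilon> N" unfolding fine_mesh_def using N0 by blast
  then show ?thesis by (rule that)
qed

text \<open>
  Going one step back along an itinerary divides the volume by at least $f'(x) e^{-\epsilon}$.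
\<close>

lemma cell_volume_le:
  assumes mesh: "fine_mesh \<epsilon> N" and x: "x \<in> circle"
  shows "measure circle_lebesgue {y \<in> circle. itinerary (arc_label N \<theta>) f n y = itinerary (arc_label N \<theta>) f n x}
    \<le> exp (- (\<Sum>j<n. lnD ((f ^^ j) x)) + real n * \<epsilon>)"
  using x
proof (induction n arbitrary: x)
  case 0
  interpret m: prob_space circle_lebesgue by (rule prob_space_circle_lebesgue)
  show ?case by simp
next
  case (Suc n)
  interpret m: prob_space circle_lebesgue by (rule prob_space_circle_lebesgue)
  have N: "N > 0" and Nb: "\<And>x. x \<in> circle \<Longrightarrow> circle_deriv f x \<le> real N"
    and osc: "\<And>s t. \<bar>s - t\<bar> \<le> 1 / real N \<Longrightarrow> \<bar>lnD (turn s) - lnD (turn t)\<bar> \<le> \<epsilon>"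
    using mesh by (auto simp: fine_mesh_def)
  let ?a = "arc_label N \<theta>"
  let ?S = "{y \<in> circle. itinerary ?a f (Suc n) y = itinerary ?a f (Suc n) x}"
  let ?B = "{y \<in> circle. itinerary ?a f n y = itinerary ?a f n (f x)}"
  let ?s = "\<theta> + real_of_int (?a x) / real N"
  let ?s' = "?s + 1 / real N"
  have fx: "f x \<in> circle" by (rule C1_maps_circle[OF C1 Suc.prems])
  obtain t where t: "?s \<le> t" "t < ?s'" "x = turn t" using arc_label_arc[OF N Suc.prems] by blast
  have I: "simple_function circle_lebesgue (itinerary ?a f k)" for k
    using C1_measurable[OF C1] measurable_cong_sets[OF sets_circle_lebesgue sets_circle_lebesgue]
    by (intro simple_function_itinerary arc_label_simple N) auto
  have set_eq: "{y \<in> circle. itinerary ?a f k y = v} = itinerary ?a f k -` {v} \<inter> space circle_lebesgue" for k v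
    by auto
  have meas: "?S \<in> sets circle_borel" "?B \<in> sets circle_borel"
    using simple_functionD(2)[OF I] unfolding set_eq by simp_all
  have D0: "circle_deriv f (turn u) > 0" for u using gt1[OF turn_circle, of u] by linarith
  let ?c = "exp (lnD x - \<epsilon>)"
  have "?c * measure circle_lebesgue ?S \<le> measure circle_lebesgue ?B"
  proof (rule expanding_branch_volume_le[OF lift der _ _ _ _ _ _ meas(1) _ _ meas(2)])
    show "continuous_on UNIV (\<lambda>t. circle_deriv f (turn t))" by (rule continuous_on_compose_turn[OF deriv_continuous])
    show "?s \<le> ?s'" "?s' \<le> ?s + 1" using N by auto
    show "F ?s' \<le> F ?s + 1"
    proof -
      have "?s < ?s'" using N by simp
      then obtain z where "F ?s' - F ?s = (?s' - ?s) * circle_deriv f (turn z)"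
        using MVT2[of ?s ?s' F "\<lambda>t. circle_deriv f (turn t)"] der by blast
      also have "\<dots> \<le> (?s' - ?s) * real N" using N Nb by (intro mult_left_mono) auto
      also have "\<dots> = 1" using N by simp
      finally show ?thesis by simp
    qed
    show "?c > 0" by simp
    show "?c \<le> circle_deriv f (turn u)" if u: "u \<in> {?s..?s'}" for u
    proof -
      have "\<bar>t - u\<bar> \<le> 1 / real N" using u t by auto
      then have "\<bar>lnD x - lnD (turn u)\<bar> \<le> \<epsilon>" using osc[of t u] t(3) by simp
      then have "lnD x - \<epsilon> \<le> lnD (turn u)" by linarith
      then have "?c \<le> exp (lnD (turn u))" by simp
      then show ?thesis using D0 by (simp add: lnD_def)
    qed
    show "?S \<subseteq> turn ` {?s..<?s'}"
    proof
      fix y assume "y \<in> ?S"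
      then have y: "y \<in> circle" "?a y = ?a x" by (auto simp: itinerary_Suc)
      obtain u where "?s \<le> u" "u < ?s'" "y = turn u" using arc_label_arc[OF N y(1), of \<theta>] unfolding y(2) by blast
      then show "y \<in> turn ` {?s..<?s'}" by auto
    qed
    show "f ` ?S \<subseteq> ?B" using C1_maps_circle[OF C1] by (auto simp: itinerary_Suc)
  qed
  also have "\<dots> \<le> exp (- (\<Sum>j<n. lnD ((f ^^ j) (f x))) + real n * \<epsilon>)" by (rule Suc.IH[OF fx])
  finally have "measure circle_lebesgue ?S \<le> exp (- (\<Sum>j<n. lnD ((f ^^ j) (f x))) + real n * \<epsilon>) / ?c"
    by (simp add: field_simps)
  also have "\<dots> = exp (- (\<Sum>j<Suc n. lnD ((f ^^ j) x)) + real (Suc n) * \<epsilon>)"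
    by (simp add: exp_diff[symmetric] sum.lessThan_Suc_shift funpow_swap1 algebra_simps del: sum.lessThan_Suc)
  finally show ?case .
qed

text \<open>
  On $D$ the volume $\exp(- \sum_j \log f')$ of a cell is at most the chain weight of its word times
  $\exp(cn + kC)$, up to the error $\epsilon$ per step; the chain weights of all words add up to at most $1$.
\<close>

lemma typical_set_volume_le:
  fixes r :: "int \<Rightarrow> int list \<Rightarrow> real"
  assumes mesh: "fine_mesh \<epsilon> N"
    and r: "\<And>u w. r u w > 0" "\<And>w. (\<Sum>u\<in>arc_label N \<theta> ` circle. r u w) \<le> 1"
    and C: "\<And>u w. - ln (r u w) \<le> C" "C \<ge> 0"
    and G: "\<And>x. x \<in> circle \<Longrightarrow> 0 \<le> - ln (r (arc_label N \<theta> x) (itinerary (arc_label N \<theta>) f k (f x)))"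
    and \<phi>: "\<And>x. x \<in> circle \<Longrightarrow> - ln (r (arc_label N \<theta> x) (itinerary (arc_label N \<theta>) f k (f x))) \<le> \<phi> x"
    and D: "D \<subseteq> circle" "\<And>x. x \<in> D \<Longrightarrow> (\<Sum>j<n. \<phi> ((f ^^ j) x) - lnD ((f ^^ j) x)) \<le> c * real n"
    and Dm: "D \<in> sets circle_borel"
  shows "measure circle_lebesgue D \<le> exp (real n * (c + \<epsilon>) + real k * C)"
proof -
  interpret m: prob_space circle_lebesgue by (rule prob_space_circle_lebesgue)
  let ?a = "arc_label N \<theta>"
  let ?I = "itinerary ?a f n"
  let ?K = "exp (real n * (c + \<epsilon>) + real k * C)"
  have N: "N > 0" using mesh by (simp add: fine_mesh_def)
  have as: "simple_function circle_lebesgue ?a" by (intro arc_label_simple N) auto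
  have Is: "simple_function circle_lebesgue ?I"
    using C1_measurable[OF C1] measurable_cong_sets[OF sets_circle_lebesgue sets_circle_lebesgue]
    by (intro simple_function_itinerary as) auto
  have finA: "finite (?a ` circle)" and finI: "finite (?I ` circle)"
    using as Is by (auto simp: simple_function_def)
  have finV: "finite (?I ` D)" using finI D(1) by (meson finite_subset image_mono)
  have cell: "measure circle_lebesgue (?I -` {v} \<inter> circle) \<le> ?K * chain_weight r k v" if v: "v \<in> ?I ` D" for v
  proof -
    obtain x where x: "x \<in> D" "v = ?I x" using v by auto
    have xc: "x \<in> circle" using x D by auto
    have oc: "(f ^^ j) x \<in> circle" for j by (rule funpow_circle[OF C1 xc])
    have q: "chain_weight r k v > 0"
      "- ln (chain_weight r k v) \<le> (\<Sum>j<n. - ln (r (?a ((f ^^ j) x)) (itinerary ?a f k (f ((f ^^ j) x))))) + real (min n k) * C"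
      using chain_weight_itinerary[of r C ?a f x k n, OF r(1) C G[OF oc]] unfolding x(2) by blast+
    note q(2)
    also have "(\<Sum>j<n. - ln (r (?a ((f ^^ j) x)) (itinerary ?a f k (f ((f ^^ j) x))))) \<le> (\<Sum>j<n. \<phi> ((f ^^ j) x))"
      by (intro sum_mono \<phi> oc)
    also have "real (min n k) * C \<le> real k * C" using C(2) by (intro mult_right_mono) auto
    finally have lq: "- ln (chain_weight r k v) \<le> (\<Sum>j<n. \<phi> ((f ^^ j) x)) + real k * C" by simp
    have "measure circle_lebesgue (?I -` {v} \<inter> circle) \<le> exp (- (\<Sum>j<n. lnD ((f ^^ j) x)) + real n * \<epsilon>)"
    proof -
      have "?I -` {v} \<inter> circle = {y \<in> circle. ?I y = ?I x}" using x(2) by auto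
      then show ?thesis using cell_volume_le[OF mesh xc, of \<theta> n] by simp
    qed
    also have "\<dots> \<le> exp (real n * (c + \<epsilon>) + real k * C + ln (chain_weight r k v))"
      using lq D(2)[OF x(1)] by (simp add: sum_subtractf algebra_simps)
    also have "\<dots> = ?K * chain_weight r k v" using q(1) by (simp add: exp_add)
    finally show ?thesis .
  qed
  have "measure circle_lebesgue D \<le> measure circle_lebesgue (\<Union>v\<in>?I ` D. ?I -` {v} \<inter> circle)"
    using D(1) finV simple_functionD(2)[OF Is]
    by (intro m.finite_measure_mono sets.finite_UN) auto
  also have "\<dots> \<le> (\<Sum>v\<in>?I ` D. measure circle_lebesgue (?I -` {v} \<inter> circle))"
    using finV simple_functionD(2)[OF Is] by (intro m.finite_measure_subadditive_finite) auto
  also have "\<dots> \<le> (\<Sum>v\<in>?I ` D. ?K * chain_weight r k v)" by (intro sum_mono cell)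
  also have "\<dots> = ?K * (\<Sum>v\<in>?I ` D. chain_weight r k v)" by (simp add: sum_distrib_left)
  also have "\<dots> \<le> ?K * 1"
  proof (rule mult_left_mono)
    have "set (?I x) \<subseteq> ?a ` circle" if "x \<in> circle" for x
      using imageI[OF funpow_circle[OF C1 that], of ?a] by (auto simp: itinerary_def)
    then have "?I ` D \<subseteq> {v. set v \<subseteq> ?a ` circle \<and> length v = n}"
      using D(1) length_itinerary[of ?a f n] by blast
    then have "(\<Sum>v\<in>?I ` D. chain_weight r k v) \<le> (\<Sum>v\<in>{v. set v \<subseteq> ?a ` circle \<and> length v = n}. chain_weight r k v)"
      using finA by (intro sum_mono2 finite_lists_length_eq chain_weight_nonneg less_imp_le[OF r(1)])
    also have "\<dots> \<le> 1" by (rule sum_chain_weight_le[OF finA less_imp_le[OF r(1)] r(2)])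
    finally show "(\<Sum>v\<in>?I ` D. chain_weight r k v) \<le> 1" .
  qed simp
  finally show ?thesis by simp
qed

text \<open>
  An itinerary can change only where the orbit meets an end of an arc; by invariance this set is null.
\<close>

lemma itinerary_continuous_off_null:
  assumes \<mu>: "\<mu> \<in> invariant_measures f" and N: "N > 0" and null: "measure \<mu> (arc_ends N \<theta>) = 0"
  shows "\<exists>E\<in>null_sets \<mu>. \<forall>x\<in>circle - E. \<forall>g :: int list \<Rightarrow> real.
    continuous (at x within circle) (\<lambda>x. g (itinerary (arc_label N \<theta>) f q x))"
proof -
  note \<mu>c = invariant_measuresD(1)[OF \<mu> C1] and f = invariant_measuresD(2,3)[OF \<mu> C1]
  interpret \<mu>: prob_space \<mu> using circle_measuresD[OF \<mu>c] by simp
  note sp = circle_measuresD(2)[OF \<mu>c] and st = circle_measuresD(1)[OF \<mu>c]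
  let ?B = "arc_ends N \<theta>" and ?a = "arc_label N \<theta>"
  let ?E = "\<Union>j<q. (f ^^ j) -` ?B \<inter> circle"
  have E0c: "?B \<subseteq> circle" unfolding arc_ends_def by auto
  have E0m: "?B \<in> sets \<mu>"
  proof -
    have "?B \<in> sets borel" unfolding arc_ends_def by (intro borel_closed finite_imp_closed finite_imageI) simp
    then have "?B \<inter> circle \<in> sets circle_borel" by (rule Int_circle_borel)
    then show ?thesis using E0c st by (simp add: Int_absorb2)
  qed
  have "(f ^^ j) -` ?B \<inter> circle \<in> null_sets \<mu>" for j
  proof -
    have fj: "f ^^ j \<in> measurable \<mu> \<mu>" by (rule funpow_measurable[OF f(1)])
    have "emeasure \<mu> ((f ^^ j) -` ?B \<inter> space \<mu>) = emeasure (distr \<mu> \<mu> (f ^^ j)) ?B"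
      by (rule emeasure_distr[OF fj E0m, symmetric])
    also have "\<dots> = 0" using null by (simp add: distr_funpow[OF f] \<mu>.emeasure_eq_measure)
    finally show ?thesis using measurable_sets[OF fj E0m] by (simp add: sp null_setsI)
  qed
  then have "?E \<in> null_sets \<mu>" by (intro null_sets_UN') auto
  then show ?thesis
  proof (intro bexI[of _ ?E] ballI allI)
    fix x and g :: "int list \<Rightarrow> real" assume x: "x \<in> circle - ?E"
    have "eventually (\<lambda>y. ?a ((f ^^ j) y) = ?a ((f ^^ j) x)) (at x within circle)" if j: "j < q" for j
    proof -
      have "(f ^^ j) x \<in> circle" using x by (intro funpow_circle[OF C1]) auto
      moreover have "(f ^^ j) x \<notin> ?B" using x j by auto
      ultimately have "eventually (\<lambda>z. ?a z = ?a ((f ^^ j) x)) (nhds ((f ^^ j) x))"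
        by (rule arc_label_locally_constant[OF N])
      moreover have "((f ^^ j) \<longlongrightarrow> (f ^^ j) x) (at x within circle)"
        using funpow_continuous[OF C1, of j] x by (auto simp: continuous_on_def)
      ultimately show ?thesis by (rule eventually_compose_filterlim)
    qed
    then have "eventually (\<lambda>y. \<forall>j\<in>{..<q}. ?a ((f ^^ j) y) = ?a ((f ^^ j) x)) (at x within circle)"
      by (intro eventually_ball_finite) auto
    then have "eventually (\<lambda>y. g (itinerary ?a f q y) = g (itinerary ?a f q x)) (at x within circle)"
    proof (rule eventually_mono)
      fix y assume "\<forall>j\<in>{..<q}. ?a ((f ^^ j) y) = ?a ((f ^^ j) x)"
      then have "itinerary ?a f q y = itinerary ?a f q x" by (simp add: itinerary_eq_iff)
      then show "g (itinerary ?a f q y) = g (itinerary ?a f q x)" by simp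
    qed
    then show "continuous (at x within circle) (\<lambda>x. g (itinerary ?a f q x))"
      unfolding continuous_within by (rule tendsto_eventually)
  qed
qed

text \<open>
  Otherwise a continuous majorant $\phi$ of the integrand still has integral below $\lambda(\mu) - \epsilon$ with a
  margin $\delta$. The points whose averages of $\phi - \log f'$ are that low at time $n$ have volume of order
  $e^{-\delta n}$, so by Borel--Cantelli almost every point is low only finitely often. Observability of $\mu$
  gives a set of positive volume where it happens infinitely often.
\<close>

lemma smoothed_entropy_ge:
  assumes d: "weak_star_metric d" and ob: "observable d f \<mu>" and mesh: "fine_mesh \<epsilon> N"
    and null: "measure \<mu> (arc_ends N \<theta>) = 0" and s: "s > 0"
  shows "(\<integral>x. lnD x \<partial>\<mu>) - \<epsilon>
    \<le> (\<integral>x. - ln (smoothed_cond \<mu> (arc_label N \<theta>) f s (arc_label N \<theta> x) (itinerary (arc_label N \<theta>) f k (f x))) \<partial>\<mu>)"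
proof (rule ccontr)
  assume neg: "\<not> ?thesis"
  have \<mu>: "\<mu> \<in> invariant_measures f" by (rule observable_invariant[OF d C1 ob])
  note \<mu>c = invariant_measuresD(1)[OF \<mu> C1] and f = invariant_measuresD(2,3)[OF \<mu> C1]
  interpret \<mu>: prob_space \<mu> using circle_measuresD[OF \<mu>c] by simp
  interpret m: prob_space circle_lebesgue by (rule prob_space_circle_lebesgue)
  note sp = circle_measuresD(2)[OF \<mu>c] and st = circle_measuresD(1)[OF \<mu>c]
  have N: "N > 0" using mesh by (simp add: fine_mesh_def)
  let ?a = "arc_label N \<theta>"
  have as: "simple_function \<mu> ?a" by (rule arc_label_simple[OF st sp N])
  let ?r = "smoothed_cond \<mu> ?a f s"
  let ?G = "\<lambda>x. - ln (?r (?a x) (itinerary ?a f k (f x)))"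
  define C where "C = ln ((1 + s * real (card (?a ` space \<mu>))) / s)"
  have r: "?r u w > 0" "(\<Sum>u\<in>?a ` circle. ?r u w) \<le> 1" "- ln (?r u w) \<le> C" "C \<ge> 0" for u w
    using \<mu>.smoothed_cond_pos[OF f as s] \<mu>.sum_smoothed_cond[OF f as s, of w] \<mu>.smoothed_cond_bound[OF f as s]
      \<mu>.smoothed_bound_nonneg[OF f as s] unfolding C_def sp by auto
  have G0: "0 \<le> ?G x" if "x \<in> circle" for x
  proof -
    have "?r (?a x) (itinerary ?a f k (f x)) \<le> 1" using that sp by (intro \<mu>.smoothed_cond_le_1[OF f as s]) auto
    then show ?thesis using r(1) by simp
  qed
  \<comment> \<open>The integrand is a function of the itinerary of length $k + 1$.\<close>
  let ?g = "\<lambda>v. - ln (?r (hd v) (tl v))"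
  have Gg: "?G = (\<lambda>x. ?g (itinerary ?a f (Suc k) x))" by (simp add: itinerary_Suc)
  obtain E where E: "E \<in> null_sets \<mu>"
    "\<forall>x\<in>circle - E. \<forall>g :: int list \<Rightarrow> real. continuous (at x within circle) (\<lambda>x. g (itinerary ?a f (Suc k) x))"
    using itinerary_continuous_off_null[OF \<mu> N null, of "Suc k"] by blast
  have E': "continuous (at x within circle) ?G" if "x \<in> circle - E" for x
    unfolding Gg by (rule E(2)[THEN bspec, OF that, THEN spec, of ?g])
  \<comment> \<open>Half of the gap is spent on the majorant, the other half is the rate of decay.\<close>
  define \<delta> where "\<delta> = ((\<integral>x. lnD x \<partial>\<mu>) - \<epsilon> - (\<integral>x. ?G x \<partial>\<mu>)) / 2"
  have \<delta>: "\<delta> > 0" using neg by (simp add: \<delta>_def)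
  have I: "simple_function \<mu> (itinerary ?a f (Suc k))" by (rule simple_function_itinerary[OF as f(1)])
  have Gm: "?G \<in> borel_measurable circle_borel"
    using \<mu>.integrable_label[OF I, of ?g] measurable_cong_sets[OF st refl] unfolding Gg by blast
  have GC: "\<bar>?G x\<bar> \<le> C" if "x \<in> circle" for x using G0[OF that] r(3) by (simp only: abs_of_nonneg)
  obtain \<phi> where \<phi>: "continuous_on circle \<phi>" "\<And>x. x \<in> circle \<Longrightarrow> ?G x \<le> \<phi> x" "(\<integral>x. \<phi> x \<partial>\<mu>) < (\<integral>x. ?G x \<partial>\<mu>) + \<delta>"
    by (rule continuous_majorant[OF \<mu>c Gm GC E(1) E' \<delta>]) (assumption | rule that | blast)+
  let ?\<kappa> = "\<lambda>x. \<phi> x - lnD x"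
  have \<kappa>: "continuous_on circle ?\<kappa>" by (intro continuous_on_diff \<phi>(1) lnD_continuous)
  define c where "c = (\<integral>x. ?G x \<partial>\<mu>) + \<delta> - (\<integral>x. lnD x \<partial>\<mu>)"
  have "(\<integral>x. ?\<kappa> x \<partial>\<mu>) = (\<integral>x. \<phi> x \<partial>\<mu>) - (\<integral>x. lnD x \<partial>\<mu>)"
    by (rule Bochner_Integration.integral_diff[OF integrable_continuous_circle[OF \<mu>c \<phi>(1)] integrable_continuous_circle[OF \<mu>c lnD_continuous]])
  then have "(\<integral>x. ?\<kappa> x \<partial>\<mu>) < c" using \<phi>(3) by (simp add: c_def)
  from observable_average_below[OF d C1 ob \<kappa> this]
  obtain A where A: "A \<subseteq> circle" "emeasure circle_lebesgue A > 0"
    "\<And>x. x \<in> A \<Longrightarrow> \<exists>\<^sub>F n in sequentially. (\<Sum>j<Suc n. ?\<kappa> ((f ^^ j) x)) < c * real (Suc n)" by blast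
  define D where "D n = {x \<in> circle. (\<Sum>j<Suc n. ?\<kappa> ((f ^^ j) x)) < c * real (Suc n)}" for n
  have Dm: "D n \<in> sets circle_borel" for n
  proof -
    have "(\<lambda>x. \<Sum>j<Suc n. ?\<kappa> ((f ^^ j) x)) \<in> borel_measurable circle_borel"
      by (intro circle_measurable_continuous continuous_on_sum continuous_along_orbit[OF C1 \<kappa>])
    from measurable_sets[OF this, of "{..<c * real (Suc n)}"] show ?thesis
      by (simp add: D_def vimage_def Int_def conj_commute del: sum.lessThan_Suc)
  qed
  have ce: "c + \<epsilon> = - \<delta>" using neg by (simp add: c_def \<delta>_def field_simps)
  have vol: "measure circle_lebesgue (D n) \<le> exp (real k * C) * exp (- \<delta>) ^ Suc n" for n
  proof -
    have "measure circle_lebesgue (D n) \<le> exp (real (Suc n) * (c + \<epsilon>) + real k * C)"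
      using Dm
      by (intro typical_set_volume_le[where r="?r" and \<phi>=\<phi> and \<theta>=\<theta>, OF mesh r(1,2,3,4) G0 \<phi>(2)])
         (auto simp: D_def less_imp_le simp del: sum.lessThan_Suc)
    also have "\<dots> = exp (real k * C) * exp (- \<delta>) ^ Suc n"
      unfolding ce exp_of_nat_mult[symmetric] exp_add by (rule mult.commute)
    finally show ?thesis .
  qed
  have "summable (\<lambda>n. measure circle_lebesgue (D n))"
  proof (rule summable_comparison_test)
    have "summable (\<lambda>n. exp (- \<delta>) ^ n)" using \<delta> by (intro summable_geometric) simp
    then show "summable (\<lambda>n. exp (real k * C) * exp (- \<delta>) ^ Suc n)"
      by (intro summable_mult) (simp only: summable_Suc_iff)
    show "\<exists>N. \<forall>n\<ge>N. norm (measure circle_lebesgue (D n)) \<le> exp (real k * C) * exp (- \<delta>) ^ Suc n"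
      using vol by auto
  qed
  then have ev: "AE x in circle_lebesgue. eventually (\<lambda>n. x \<in> space circle_lebesgue - D n) sequentially"
    using Dm by (intro borel_cantelli_AE1) (auto simp: m.emeasure_eq_measure)
  have "AE x in circle_lebesgue. x \<notin> A"
    using ev
  proof eventually_elim
    case (elim x)
    show ?case
    proof
      assume x: "x \<in> A"
      have "\<exists>\<^sub>F n in sequentially. x \<in> D n" using A(3)[OF x] A(1) x unfolding D_def by auto
      moreover have "eventually (\<lambda>n. \<not> x \<in> D n) sequentially" using elim by eventually_elim auto
      ultimately show False unfolding frequently_def by blast
    qed
  qed
  then obtain S where S: "{x \<in> space circle_lebesgue. \<not> x \<notin> A} \<subseteq> S" "emeasure circle_lebesgue S = 0" "S \<in> sets circle_lebesgue"
    by (rule AE_E)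
  have "A \<subseteq> S" using S(1) A(1) unfolding space_circle_lebesgue by blast
  then have "emeasure circle_lebesgue A \<le> emeasure circle_lebesgue S" using S(3) by (rule emeasure_mono)
  then show False using A(2) S by simp
qed

text \<open>
  The entropy of the itinerary is the sum of the entropies of a letter given the $k$ letters after it.
\<close>

theorem observable_arc_entropy:
  assumes d: "weak_star_metric d" and ob: "observable d f \<mu>" and mesh: "fine_mesh \<epsilon> N"
    and null: "measure \<mu> (arc_ends N \<theta>) = 0"
  shows "real n * ((\<integral>x. lnD x \<partial>\<mu>) - \<epsilon>) \<le> label_entropy \<mu> (itinerary (arc_label N \<theta>) f n)"
proof (induction n)
  case 0
  have "\<mu> \<in> circle_measures" using ob by (simp add: observable_def)
  from label_entropy_nonneg[OF circle_measuresD(3)[OF this], of "itinerary (arc_label N \<theta>) f 0"]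
  show ?case by (simp only: of_nat_0 mult_zero_left)
next
  case (Suc k)
  have \<mu>: "\<mu> \<in> invariant_measures f" by (rule observable_invariant[OF d C1 ob])
  note \<mu>c = invariant_measuresD(1)[OF \<mu> C1] and f = invariant_measuresD(2,3)[OF \<mu> C1]
  interpret \<mu>: prob_space \<mu> using circle_measuresD[OF \<mu>c] by simp
  have N: "N > 0" using mesh by (simp add: fine_mesh_def)
  have as: "simple_function \<mu> (arc_label N \<theta>)" by (rule arc_label_simple[OF circle_measuresD(1,2)[OF \<mu>c] N])
  have "(\<integral>x. lnD x \<partial>\<mu>) - \<epsilon> \<le> label_entropy \<mu> (itinerary (arc_label N \<theta>) f (Suc k)) - label_entropy \<mu> (itinerary (arc_label N \<theta>) f k)"
  proof (rule tendsto_lowerbound[OF \<mu>.smoothed_cond_limit[OF f as]])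
    show "\<forall>\<^sub>F s in at_right 0. (\<integral>x. lnD x \<partial>\<mu>) - \<epsilon>
        \<le> (\<integral>x. - ln (smoothed_cond \<mu> (arc_label N \<theta>) f s (arc_label N \<theta> x) (itinerary (arc_label N \<theta>) f k (f x))) \<partial>\<mu>)"
      using smoothed_entropy_ge[OF d ob mesh null] by (auto simp: eventually_at_filter)
  qed simp
  then show ?case using Suc by (simp add: algebra_simps)
qed

end

section \<open>Convex combinations and equilibrium states\<close>

text \<open>
  For each point of $S$ and each index at most one $\theta$ in $[0, 1)$ puts that end of an arc on that point.
\<close>

lemma arc_ends_avoid_countable:
  fixes S :: "complex set"
  assumes "countable S" "N > 0"
  obtains \<theta> where "arc_ends N \<theta> \<inter> S = {}"
proof -
  let ?bad = "\<Union>i<N. \<Union>x\<in>S. {\<theta>\<in>{0..<1}. turn (\<theta> + real i / real N) = x}"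
  have "countable {\<theta>\<in>{0..<1}. turn (\<theta> + c) = x}" for c x
  proof (cases "{\<theta>\<in>{0..<1}. turn (\<theta> + c) = x} = {}")
    case False
    then obtain \<theta> where \<theta>: "0 \<le> \<theta>" "\<theta> < 1" "turn (\<theta> + c) = x" by auto
    have "{\<theta>\<in>{0..<1}. turn (\<theta> + c) = x} \<subseteq> {\<theta>}"
    proof
      fix s assume "s \<in> {\<theta>\<in>{0..<1}. turn (\<theta> + c) = x}"
      then have "s + c = \<theta> + c" using \<theta> by (intro turn_eq_unique[of _ _ c]) auto
      then show "s \<in> {\<theta>}" by simp
    qed
    then show ?thesis by (rule countable_subset) simp
  next
    case True
    then show ?thesis by (simp only: countable_empty)
  qed
  then have "countable ?bad" using assms(1) by (intro countable_UN) auto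
  moreover have "uncountable {0..<1::real}" by (simp add: uncountable_half_open_interval_1)
  ultimately have "\<not> {0..<1} \<subseteq> ?bad" using countable_subset by blast
  then obtain \<theta> where \<theta>: "\<theta> \<in> {0..<1}" "\<theta> \<notin> ?bad" by blast
  have "arc_ends N \<theta> \<inter> S = {}" using \<theta> unfolding arc_ends_def by auto
  then show ?thesis by (rule that)
qed

lemma measure_finite_non_atoms:
  assumes \<mu>: "\<mu> \<in> circle_measures" and A: "finite A" "A \<subseteq> circle" "\<And>x. x \<in> A \<Longrightarrow> measure \<mu> {x} = 0"
  shows "measure \<mu> A = 0"
proof -
  interpret prob_space \<mu> using circle_measuresD[OF \<mu>] by simp
  have "{x} \<in> sets \<mu>" if "x \<in> A" for x
    using Int_circle_borel[of "{x}"] that A(2) circle_measuresD(1)[OF \<mu>] by (auto simp: Int_absorb2)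
  then have "measure \<mu> A = (\<Sum>x\<in>A. measure \<mu> {x})"
    using A(1) by (intro finite_measure_eq_sum_singleton) auto
  then show ?thesis using A(3) by simp
qed

lemma common_arc_ends:
  assumes "countable Z" "\<And>\<nu>. \<nu> \<in> Z \<Longrightarrow> \<nu> \<in> circle_measures" "N > 0"
  obtains \<theta> where "\<And>\<nu>. \<nu> \<in> Z \<Longrightarrow> measure \<nu> (arc_ends N \<theta>) = 0"
proof -
  have "countable {x. measure \<nu> {x} \<noteq> 0}" if "\<nu> \<in> Z" for \<nu>
  proof -
    interpret prob_space \<nu> using assms(2)[OF that] circle_measuresD(3) by blast
    show ?thesis by (rule countable_support)
  qed
  then have "countable (\<Union>\<nu>\<in>Z. {x. measure \<nu> {x} \<noteq> 0})" using assms(1) by (intro countable_UN) auto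
  then obtain \<theta> where \<theta>: "arc_ends N \<theta> \<inter> (\<Union>\<nu>\<in>Z. {x. measure \<nu> {x} \<noteq> 0}) = {}"
    using arc_ends_avoid_countable assms(3) by blast
  show ?thesis
  proof (rule that)
    fix \<nu> assume \<nu>: "\<nu> \<in> Z"
    show "measure \<nu> (arc_ends N \<theta>) = 0"
    proof (rule measure_finite_non_atoms[OF assms(2)[OF \<nu>]])
      show "finite (arc_ends N \<theta>)" "arc_ends N \<theta> \<subseteq> circle" by (auto simp: arc_ends_def)
      show "measure \<nu> {x} = 0" if "x \<in> arc_ends N \<theta>" for x using \<theta> \<nu> that by blast
    qed
  qed
qed

lemma nn_integral_mixture:
  fixes c :: "nat \<Rightarrow> real" and \<nu> :: "nat \<Rightarrow> 'a measure"
  assumes s: "\<And>i. i < n \<Longrightarrow> sets (\<nu> i) = sets \<mu>"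
    and mix: "\<And>A. A \<in> sets \<mu> \<Longrightarrow> emeasure \<mu> A = (\<Sum>i<n. ennreal (c i) * emeasure (\<nu> i) A)"
    and g: "g \<in> borel_measurable \<mu>"
  shows "(\<integral>\<^sup>+x. g x \<partial>\<mu>) = (\<Sum>i<n. ennreal (c i) * (\<integral>\<^sup>+x. g x \<partial>\<nu> i))"
  using g
proof (induction rule: borel_measurable_induct)
  case (cong f g)
  then have "(\<integral>\<^sup>+x. f x \<partial>\<nu> i) = (\<integral>\<^sup>+x. g x \<partial>\<nu> i)" if "i < n" for i
    using sets_eq_imp_space_eq[OF s[OF that]] by (intro nn_integral_cong) auto
  then show ?case using cong by (simp cong: nn_integral_cong)
next
  case (set A)
  then show ?case using s mix by simp
next
  case (mult u k)
  have "u \<in> borel_measurable (\<nu> i)" if "i < n" for i using mult measurable_cong_sets[OF s[OF that] refl] by blast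
  then show ?case using mult by (simp add: nn_integral_cmult sum_distrib_left mult.left_commute)
next
  case (add u v)
  have "u \<in> borel_measurable (\<nu> i)" "v \<in> borel_measurable (\<nu> i)" if "i < n" for i
    using add measurable_cong_sets[OF s[OF that] refl] by blast+
  then show ?case using add by (simp add: nn_integral_add distrib_left sum.distrib)
next
  case (seq U)
  have Um: "U j \<in> borel_measurable (\<nu> i)" if "i < n" for i j
    using seq measurable_cong_sets[OF s[OF that] refl] by blast
  have "(\<integral>\<^sup>+x. (SUP j. U j) x \<partial>\<mu>) = (SUP j. \<integral>\<^sup>+x. U j x \<partial>\<mu>)"
    using seq by (simp add: nn_integral_monotone_convergence_SUP image_comp)
  also have "\<dots> = (SUP j. \<Sum>i<n. ennreal (c i) * (\<integral>\<^sup>+x. U j x \<partial>\<nu> i))" using seq by simp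
  also have "\<dots> = (\<Sum>i<n. SUP j. ennreal (c i) * (\<integral>\<^sup>+x. U j x \<partial>\<nu> i))"
    using seq by (intro ennreal_SUP_sum) (auto simp: incseq_def le_fun_def intro!: mult_left_mono nn_integral_mono)
  also have "\<dots> = (\<Sum>i<n. ennreal (c i) * (\<integral>\<^sup>+x. (SUP j. U j) x \<partial>\<nu> i))"
    using seq Um by (intro sum.cong) (auto simp: SUP_mult_left_ennreal nn_integral_monotone_convergence_SUP image_comp)
  finally show ?case by (simp add: SUP_apply[abs_def])
qed

lemma integral_mixture:
  fixes g :: "complex \<Rightarrow> real" and c :: "nat \<Rightarrow> real"
  assumes \<mu>: "\<mu> \<in> circle_measures" and \<nu>: "\<And>i. i < n \<Longrightarrow> \<nu> i \<in> circle_measures" and c: "\<And>i. i < n \<Longrightarrow> 0 \<le> c i"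
    and mix: "\<And>A. A \<in> sets circle_borel \<Longrightarrow> measure \<mu> A = (\<Sum>i<n. c i * measure (\<nu> i) A)"
    and g: "continuous_on circle g" "\<And>x. x \<in> circle \<Longrightarrow> g x \<ge> 0"
  shows "(\<integral>x. g x \<partial>\<mu>) = (\<Sum>i<n. c i * (\<integral>x. g x \<partial>\<nu> i))"
proof -
  have fin: "finite_measure M" if "M \<in> circle_measures" for M
    using prob_space.finite_measure[OF circle_measuresD(3)[OF that]] .
  have em: "emeasure \<mu> A = (\<Sum>i<n. ennreal (c i) * emeasure (\<nu> i) A)" if "A \<in> sets \<mu>" for A
  proof -
    have "emeasure \<mu> A = ennreal (\<Sum>i<n. c i * measure (\<nu> i) A)"
      using mix[of A] that circle_measuresD(1)[OF \<mu>] finite_measure.emeasure_eq_measure[OF fin[OF \<mu>]] by simp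
    also have "\<dots> = (\<Sum>i<n. ennreal (c i * measure (\<nu> i) A))" using c by (intro sum_ennreal[symmetric]) auto
    also have "\<dots> = (\<Sum>i<n. ennreal (c i) * emeasure (\<nu> i) A)"
      using c \<nu> finite_measure.emeasure_eq_measure[OF fin] by (intro sum.cong) (auto simp: ennreal_mult)
    finally show ?thesis .
  qed
  have nn: "(\<integral>\<^sup>+x. ennreal (g x) \<partial>M) = ennreal (\<integral>x. g x \<partial>M)" if "M \<in> circle_measures" for M
    using integrable_continuous_circle[OF that g(1)] g(2) circle_measuresD(2)[OF that]
    by (intro nn_integral_eq_integral AE_I2) auto
  have pos: "(\<integral>x. g x \<partial>M) \<ge> 0" if "M \<in> circle_measures" for M
    using g(2) circle_measuresD(2)[OF that] by (intro integral_nonneg_AE AE_I2) auto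
  have gm: "(\<lambda>x. ennreal (g x)) \<in> borel_measurable \<mu>"
    using measurable_circle_measure[OF \<mu> circle_measurable_continuous[OF g(1)]] by simp
  have "ennreal (\<integral>x. g x \<partial>\<mu>) = (\<Sum>i<n. ennreal (c i) * (\<integral>\<^sup>+x. ennreal (g x) \<partial>\<nu> i))"
    unfolding nn[OF \<mu>, symmetric]
    by (rule nn_integral_mixture[OF _ em gm]) (auto simp: circle_measuresD(1)[OF \<mu>] circle_measuresD(1)[OF \<nu>])
  also have "\<dots> = (\<Sum>i<n. ennreal (c i * (\<integral>x. g x \<partial>\<nu> i)))"
    using c \<nu> nn pos by (intro sum.cong) (auto simp: ennreal_mult)
  also have "\<dots> = ennreal (\<Sum>i<n. c i * (\<integral>x. g x \<partial>\<nu> i))"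
    using c \<nu> pos by (intro sum_ennreal) auto
  finally have "ennreal (\<integral>x. g x \<partial>\<mu>) = ennreal (\<Sum>i<n. c i * (\<integral>x. g x \<partial>\<nu> i))" .
  moreover have "0 \<le> (\<Sum>i<n. c i * (\<integral>x. g x \<partial>\<nu> i))"
    using c \<nu> pos by (intro sum_nonneg mult_nonneg_nonneg) auto
  ultimately show ?thesis using pos[OF \<mu>] by (simp only: ennreal_inj)
qed

text \<open>
  Gibbs' inequality for each component, with the law under the mixture as common weight.
\<close>

lemma label_entropy_concave:
  fixes c :: "nat \<Rightarrow> real"
  assumes \<mu>: "prob_space \<mu>" and \<nu>: "\<And>i. i < n \<Longrightarrow> prob_space (\<nu> i)"
    and s: "\<And>i. i < n \<Longrightarrow> sets (\<nu> i) = sets \<mu>" and c: "\<And>i. i < n \<Longrightarrow> 0 \<le> c i"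
    and mix: "\<And>A. A \<in> sets \<mu> \<Longrightarrow> measure \<mu> A = (\<Sum>i<n. c i * measure (\<nu> i) A)"
    and X: "simple_function \<mu> X"
  shows "(\<Sum>i<n. c i * label_entropy (\<nu> i) X) \<le> label_entropy \<mu> X"
proof -
  let ?V = "X ` space \<mu>"
  let ?P = "label_prob \<mu> X"
  have sp: "space (\<nu> i) = space \<mu>" if "i < n" for i by (rule sets_eq_imp_space_eq[OF s[OF that]])
  have Xi: "simple_function (\<nu> i) X" if "i < n" for i
    using X s[OF that] sp[OF that] by (simp add: simple_function_def)
  have P: "?P v = (\<Sum>i<n. c i * label_prob (\<nu> i) X v)" for v
    unfolding label_prob_def using mix[OF simple_functionD(2)[OF X, of "{v}"]] sp by simp
  have sum1: "(\<Sum>v\<in>?V. ?P v) = 1" by (rule prob_space.sum_label_prob[OF \<mu> X])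
  have "c i * label_entropy (\<nu> i) X \<le> (\<Sum>v\<in>?V. - ln (?P v) * (c i * label_prob (\<nu> i) X v))" if i: "i < n" for i
  proof (cases "c i = 0")
    case False
    then have ci: "c i > 0" using c[OF i] by simp
    interpret \<nu>i: prob_space "\<nu> i" by (rule \<nu>[OF i])
    have "label_entropy (\<nu> i) (\<lambda>x. X x) \<le> (\<integral>x. - ln (?P (X x)) \<partial>\<nu> i)"
    proof (rule \<nu>i.gibbs_inequality[OF Xi[OF i]])
      show "(\<Sum>w\<in>X ` space (\<nu> i). ?P w) \<le> 1" using sum1 sp[OF i] by simp
      fix w assume "label_prob (\<nu> i) X w > 0"
      then have "0 < c i * label_prob (\<nu> i) X w" using ci by simp
      also have "\<dots> \<le> ?P w" unfolding P using i c by (intro member_le_sum) auto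
      finally show "?P w > 0" .
    qed simp
    also have "\<dots> = (\<Sum>v\<in>?V. - ln (?P v) * label_prob (\<nu> i) X v)"
      using \<nu>i.integral_label[OF Xi[OF i], of "\<lambda>v. - ln (?P v)"] sp[OF i] by simp
    finally have "c i * label_entropy (\<nu> i) X \<le> c i * (\<Sum>v\<in>?V. - ln (?P v) * label_prob (\<nu> i) X v)"
      using ci by (intro mult_left_mono) auto
    then show ?thesis by (simp add: sum_distrib_left mult.left_commute)
  qed simp
  then have "(\<Sum>i<n. c i * label_entropy (\<nu> i) X) \<le> (\<Sum>i<n. \<Sum>v\<in>?V. - ln (?P v) * (c i * label_prob (\<nu> i) X v))"
    by (intro sum_mono) auto
  also have "\<dots> = (\<Sum>v\<in>?V. - ln (?P v) * ?P v)"
    by (subst sum.swap) (simp add: P sum_distrib_left)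
  also have "\<dots> = label_entropy \<mu> X" by (simp add: label_entropy_def sum_negf mult.commute)
  finally show ?thesis .
qed

lemma convex_combination_invariant:
  assumes f: "C1_circle_map f" and \<mu>: "\<mu> \<in> circle_measures" and \<nu>: "\<And>i. i < n \<Longrightarrow> \<nu> i \<in> invariant_measures f"
    and mix: "\<And>A. A \<in> sets circle_borel \<Longrightarrow> measure \<mu> A = (\<Sum>i<n. c i * measure (\<nu> i) A)"
  shows "\<mu> \<in> invariant_measures f"
proof -
  interpret prob_space \<mu> using circle_measuresD[OF \<mu>] by simp
  have fm: "f \<in> measurable \<mu> circle_borel"
    using C1_measurable[OF f] measurable_cong_sets[OF circle_measuresD(1)[OF \<mu>] refl] by blast
  interpret D: prob_space "distr \<mu> circle_borel f" by (rule prob_space_distr[OF fm])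
  have "distr \<mu> circle_borel f = \<mu>"
  proof (rule measure_eqI)
    fix A assume "A \<in> sets (distr \<mu> circle_borel f)"
    then have A: "A \<in> sets circle_borel" by simp
    have fA: "f -` A \<inter> circle \<in> sets circle_borel" using measurable_sets[OF C1_measurable[OF f] A] by simp
    have "measure (distr \<mu> circle_borel f) A = measure \<mu> (f -` A \<inter> circle)"
      using measure_distr[OF fm A] circle_measuresD(2)[OF \<mu>] by simp
    also have "\<dots> = (\<Sum>i<n. c i * measure (\<nu> i) (f -` A \<inter> circle))" by (rule mix[OF fA])
    also have "\<dots> = (\<Sum>i<n. c i * measure (\<nu> i) A)"
    proof (rule sum.cong[OF refl])
      fix i assume "i \<in> {..<n}"
      then have i: "\<nu> i \<in> invariant_measures f" using \<nu> by simp
      note ic = invariant_measuresD(1)[OF i f]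
      have "measure (distr (\<nu> i) (\<nu> i) f) A = measure (\<nu> i) (f -` A \<inter> space (\<nu> i))"
        by (rule measure_distr[OF invariant_measuresD(2)[OF i f]]) (simp add: circle_measuresD(1)[OF ic] A)
      then show "c i * measure (\<nu> i) (f -` A \<inter> circle) = c i * measure (\<nu> i) A"
        using invariant_measuresD(3)[OF i f] circle_measuresD(2)[OF ic] by simp
    qed
    also have "\<dots> = measure \<mu> A" by (rule mix[OF A, symmetric])
    finally show "emeasure (distr \<mu> circle_borel f) A = emeasure \<mu> A"
      by (simp add: D.emeasure_eq_measure emeasure_eq_measure)
  qed (simp add: circle_measuresD(1)[OF \<mu>])
  then show ?thesis using \<mu> by (simp add: invariant_measures_def)
qed

context expanding_lift begin

text \<open>
  The ends of the arcs are chosen off the atoms of all components, so that the lower bound holds for every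
  component with the same labelling and passes to the mixture by concavity.
\<close>

theorem convex_combination_entropy:
  assumes d: "weak_star_metric d" and cc: "convex_combination_of {\<nu>. observable d f \<nu>} \<mu>"
  shows "\<mu> \<in> invariant_measures f" "KS_entropy \<mu> f = ereal (\<integral>x. lnD x \<partial>\<mu>)"
proof -
  have \<mu>: "\<mu> \<in> circle_measures" using cc by (simp add: convex_combination_of_def)
  obtain n :: nat and c \<nu> where c: "\<And>i. i < n \<Longrightarrow> (0::real) \<le> c i" "(\<Sum>i<n. c i) = 1"
    and ob: "\<And>i. i < n \<Longrightarrow> observable d f (\<nu> i)"
    and mix: "\<And>A. A \<in> sets circle_borel \<Longrightarrow> measure \<mu> A = (\<Sum>i<n. c i * measure (\<nu> i) A)"
    using cc unfolding convex_combination_of_def by blast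
  have \<nu>i: "\<nu> i \<in> invariant_measures f" if "i < n" for i by (rule observable_invariant[OF d C1 ob[OF that]])
  have \<nu>c: "\<nu> i \<in> circle_measures" if "i < n" for i by (rule invariant_measuresD(1)[OF \<nu>i[OF that] C1])
  show inv: "\<mu> \<in> invariant_measures f" by (rule convex_combination_invariant[OF C1 \<mu> \<nu>i mix])
  note f = invariant_measuresD(2,3)[OF inv C1]
  interpret \<mu>: prob_space \<mu> using circle_measuresD[OF \<mu>] by simp
  note sp = circle_measuresD(2)[OF \<mu>] and st = circle_measuresD(1)[OF \<mu>]
  have L: "(\<integral>x. lnD x \<partial>\<mu>) = (\<Sum>i<n. c i * (\<integral>x. lnD x \<partial>\<nu> i))"
    by (rule integral_mixture[OF \<mu> \<nu>c c(1) mix lnD_continuous]) (auto intro: less_imp_le[OF lnD_pos])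
  have "ereal (\<integral>x. lnD x \<partial>\<mu>) \<le> KS_entropy \<mu> f + ereal \<epsilon>" if \<epsilon>: "\<epsilon> > 0" for \<epsilon>
  proof -
    obtain N where mesh: "fine_mesh \<epsilon> N" using fine_mesh_exists[OF \<epsilon>] by blast
    then have N: "N > 0" by (simp add: fine_mesh_def)
    obtain \<theta> where \<theta>: "\<And>\<nu>'. \<nu>' \<in> \<nu> ` {..<n} \<Longrightarrow> measure \<nu>' (arc_ends N \<theta>) = 0"
      by (rule common_arc_ends[of "\<nu> ` {..<n}" N]) (use \<nu>c N in auto)
    let ?a = "arc_label N \<theta>"
    have as: "simple_function \<mu> ?a" by (rule arc_label_simple[OF st sp N])
    have "(\<integral>x. lnD x \<partial>\<mu>) - \<epsilon> \<le> entropy_wrt \<mu> f (fibres \<mu> ?a)"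
    proof (rule entropy_wrt_ge[OF \<mu>.prob_space_axioms f as])
      fix q :: nat
      have "((\<integral>x. lnD x \<partial>\<mu>) - \<epsilon>) * real q = (\<Sum>i<n. c i * (real q * ((\<integral>x. lnD x \<partial>\<nu> i) - \<epsilon>)))"
      proof -
        have "(\<Sum>i<n. c i * (real q * ((\<integral>x. lnD x \<partial>\<nu> i) - \<epsilon>)))
            = (\<Sum>i<n. real q * (c i * (\<integral>x. lnD x \<partial>\<nu> i)) - (real q * \<epsilon>) * c i)"
          by (intro sum.cong) (auto simp: algebra_simps)
        also have "\<dots> = real q * (\<Sum>i<n. c i * (\<integral>x. lnD x \<partial>\<nu> i)) - (real q * \<epsilon>) * (\<Sum>i<n. c i)"
          by (simp only: sum_subtractf sum_distrib_left)
        finally show ?thesis by (simp add: L c(2) algebra_simps)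
      qed
      also have "\<dots> \<le> (\<Sum>i<n. c i * label_entropy (\<nu> i) (itinerary ?a f q))"
        using c(1) \<theta> by (intro sum_mono mult_left_mono observable_arc_entropy[OF d ob mesh]) auto
      also have "\<dots> \<le> label_entropy \<mu> (itinerary ?a f q)"
        using circle_measuresD(3)[OF \<nu>c] circle_measuresD(1)[OF \<nu>c] st mix c(1)
        by (intro label_entropy_concave \<mu>.prob_space_axioms simple_function_itinerary[OF as f(1)]) auto
      finally show "((\<integral>x. lnD x \<partial>\<mu>) - \<epsilon>) * real q \<le> label_entropy \<mu> (itinerary ?a f q)" .
    qed
    then have "ereal ((\<integral>x. lnD x \<partial>\<mu>) - \<epsilon>) \<le> KS_entropy \<mu> f"
      unfolding KS_entropy_def using finite_meas_partition_fibres[OF as] by (intro SUP_upper2[of "fibres \<mu> ?a"]) auto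
    then have "ereal ((\<integral>x. lnD x \<partial>\<mu>) - \<epsilon>) + ereal \<epsilon> \<le> KS_entropy \<mu> f + ereal \<epsilon>" by (rule add_right_mono)
    then show ?thesis by simp
  qed
  then have "ereal (\<integral>x. lnD x \<partial>\<mu>) \<le> KS_entropy \<mu> f" by (rule ereal_le_epsilon2)
  then show "KS_entropy \<mu> f = ereal (\<integral>x. lnD x \<partial>\<mu>)"
    using KS_entropy_le_exponent[OF inv] by (rule antisym[rotated])
qed

end

lemma observable_convex_combination:
  assumes "observable d f \<mu>"
  shows "convex_combination_of {\<nu>. observable d f \<nu>} \<mu>"
  unfolding convex_combination_of_def
  using assms by (auto simp: observable_def intro!: exI[of _ "1::nat"] exI[of _ "\<lambda>_. 1::real"] exI[of _ "\<lambda>_. \<mu>"])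

theorem theorem5p7:
  fixes f :: "complex \<Rightarrow> complex"
    and d :: "complex measure \<Rightarrow> complex measure \<Rightarrow> real"
    and \<psi> :: "complex \<Rightarrow> real"
  assumes "weak_star_metric d"
    and "expanding_circle_map f"
    and "\<psi> = (\<lambda>x. - ln (circle_deriv f x))"
  shows "(\<forall>\<mu>. observable d f \<mu> \<or> convex_combination_of {\<nu>. observable d f \<nu>} \<mu> \<longrightarrow>
            equilibrium_state f \<psi> \<mu> \<and> measure_pressure f \<psi> \<mu> = 0) \<and>
         (\<forall>\<mu>. observable d f \<mu> \<longrightarrow>
            KS_entropy \<mu> f = ereal (\<integral>x. ln (circle_deriv f x) \<partial>\<mu>))"
proof -
  have C1: "C1_circle_map f" and gt1: "\<And>x. x \<in> circle \<Longrightarrow> circle_deriv f x > 1"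
    using assms(2) by (auto simp: expanding_circle_map_def)
  obtain F p where "expanding_lift f F p" using expanding_lift_exists[OF C1 gt1] by blast
  then interpret expanding_lift f F p .
  have \<psi>: "(\<integral>x. \<psi> x \<partial>\<nu>) = - (\<integral>x. lnD x \<partial>\<nu>)" for \<nu>
    unfolding assms(3) lnD_def by simp
  have le0: "measure_pressure f \<psi> \<nu> \<le> 0" if "\<nu> \<in> invariant_measures f" for \<nu>
  proof -
    have "measure_pressure f \<psi> \<nu> \<le> ereal (\<integral>x. lnD x \<partial>\<nu>) + ereal (- (\<integral>x. lnD x \<partial>\<nu>))"
      unfolding measure_pressure_def \<psi> by (intro add_right_mono KS_entropy_le_exponent that)
    then show ?thesis by (simp add: zero_ereal_def)
  qed
  have main: "equilibrium_state f \<psi> \<mu> \<and> measure_pressure f \<psi> \<mu> = 0"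
    if "convex_combination_of {\<nu>. observable d f \<nu>} \<mu>" for \<mu>
  proof -
    note e = convex_combination_entropy[OF assms(1) that]
    have 0: "measure_pressure f \<psi> \<mu> = 0" unfolding measure_pressure_def e(2) \<psi> by (simp add: zero_ereal_def)
    have "pressure f \<psi> = 0"
    proof (rule antisym)
      show "pressure f \<psi> \<le> 0" unfolding pressure_def by (rule SUP_least) (rule le0)
      show "0 \<le> pressure f \<psi>" unfolding pressure_def using e(1) 0 by (intro SUP_upper2[of \<mu>]) auto
    qed
    then show ?thesis using 0 e(1) by (simp add: equilibrium_state_def)
  qed
  show ?thesis
    using main observable_convex_combination convex_combination_entropy(2)[OF assms(1) observable_convex_combination]
    unfolding lnD_def by blast
qed

end
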